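(* Let $d\geq 2$ and let $\beta_{ij}=\beta_{ji}\in\mathbb{R}$ for $i,j=1,\dots,d$. If - $\beta_{ii}>0$ for every $i=1,\dots,d$; - $\beta_{ij}\le0$ for every $i\ne j$, $i,j=1,\dots,d$; - there exist $i_1\ne j_1$ such that $\beta_{i_1j_1}<0$; then $l:=\inf_{\mathcal{M}}E$ is not achieved and $l=\sum_{h=1}^dl_h$.
   Context: Here $$E(\mathbf{u})=\frac12\sum_{i=1}^d\int_{\mathbb{R}^4}|\nabla u_i|^2-\frac14\sum_{i,j=1}^d\int_{\mathbb{R}^4}\beta_{ij}u_i^2u_j^2,\qquad \mathbf{u}\in\mathcal{D}^{1,2}(\mathbb{R}^4;\mathbb{R}^d),$$ $$\mathcal{M}:=\{\mathbf{u}\in\mathcal{D}^{1,2}(\mathbb{R}^4;\mathbb{R}^d):\ u_i\ne0\ \text{ and }\ \partial_iE(\mathbf{u})u_i=0\ \text{ for every }i=1,\dots,d\},$$ and, for $h=1,\dots,d$, $$l_h:=\inf\Big\{\frac12\int_{\mathbb{R}^4}|\nabla v|^2-\frac14\int_{\mathbb{R}^4}\beta_{hh}v^4:\ v\in\mathcal{D}^{1,2}(\mathbb{R}^4)\setminus\{0\},\ \int_{\mathbb{R}^4}|\nabla v|^2=\int_{\mathbb{R}^4}\beta_{hh}v^4\Big\}.$$ *)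

theory Defs
  imports "HOL-Analysis.Analysis"
begin

type_synonym R4 = "real ^ 4"

definition pderiv_at :: "4 \<Rightarrow> (R4 \<Rightarrow> real) \<Rightarrow> R4 \<Rightarrow> real" where
  "pderiv_at k f x = frechet_derivative f (at x) (axis k 1)"

primrec C_k :: "nat \<Rightarrow> (R4 \<Rightarrow> real) \<Rightarrow> bool" where
  "C_k 0 f \<longleftrightarrow> continuous_on UNIV f"
| "C_k (Suc n) f \<longleftrightarrow> (\<forall>x. f differentiable at x) \<and> (\<forall>k. C_k n (pderiv_at k f))"

definition test_function :: "(R4 \<Rightarrow> real) \<Rightarrow> bool" where
  "test_function f \<longleftrightarrow> (\<forall>n. C_k n f) \<and> compact (closure {x. f x \<noteq> 0})"

definition locally_integrable :: "(R4 \<Rightarrow> 'b::{banach, second_countable_topology}) \<Rightarrow> bool" where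
  "locally_integrable f \<longleftrightarrow>
     f \<in> borel_measurable borel \<and> (\<forall>K. compact K \<longrightarrow> set_integrable lborel K f)"

definition is_weak_gradient :: "(R4 \<Rightarrow> real) \<Rightarrow> (R4 \<Rightarrow> R4) \<Rightarrow> bool" where
  "is_weak_gradient u G \<longleftrightarrow> locally_integrable u \<and> locally_integrable G \<and>
     (\<forall>f k. test_function f \<longrightarrow>
        (\<integral>x. u x * pderiv_at k f x \<partial>lborel) = - (\<integral>x. G x $ k * f x \<partial>lborel))"

text \<open>The weak gradient is unique only up to null sets; only integrals of it are used below.\<close>

definition weak_grad :: "(R4 \<Rightarrow> real) \<Rightarrow> R4 \<Rightarrow> R4" where
  "weak_grad u = (SOME G. is_weak_gradient u G)"

text \<open>
  The space of functions in \<open>L\<^sup>4\<close> (4 being the critical exponent in dimension 4) with weak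
  gradient in \<open>L\<^sup>2\<close>. Elements are Borel representatives; functions that agree almost everywhere
  are not identified, so that being nonzero has to be expressed as not vanishing almost everywhere.
\<close>

definition D12 :: "(R4 \<Rightarrow> real) set" where
  "D12 = {u. u \<in> borel_measurable borel \<and> integrable lborel (\<lambda>x. u x ^ 4) \<and>
     (\<exists>G. is_weak_gradient u G \<and> integrable lborel (\<lambda>x. (norm (G x))\<^sup>2))}"

definition nonzero :: "(R4 \<Rightarrow> real) \<Rightarrow> bool" where
  "nonzero u \<longleftrightarrow> \<not> (AE x in lborel. u x = 0)"

definition dirichlet :: "(R4 \<Rightarrow> real) \<Rightarrow> real" where
  "dirichlet u = (\<integral>x. (norm (weak_grad u x))\<^sup>2 \<partial>lborel)"

text \<open>
  A vector function with \<open>d\<close> components is a family indexed by \<open>nat\<close>, of which only the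
  members with index in \<open>{1..d}\<close> matter.
\<close>

definition energy ::
  "nat \<Rightarrow> (nat \<Rightarrow> nat \<Rightarrow> real) \<Rightarrow> (nat \<Rightarrow> R4 \<Rightarrow> real) \<Rightarrow> real" where
  "energy d \<beta> u =
     1/2 * (\<Sum>i=1..d. dirichlet (u i))
     - 1/4 * (\<Sum>i=1..d. \<Sum>j=1..d. (\<integral>x. \<beta> i j * (u i x)\<^sup>2 * (u j x)\<^sup>2 \<partial>lborel))"

text \<open>
  The partial derivative of the energy with respect to the component \<open>i\<close>, applied to \<open>v\<close>.
  For \<open>u\<close> and \<open>v\<close> in \<open>D12\<close> the function of \<open>t\<close> is a polynomial, so that \<open>deriv\<close> is a
  genuine derivative.
\<close>

definition partial_energy ::
  "nat \<Rightarrow> (nat \<Rightarrow> nat \<Rightarrow> real) \<Rightarrow> nat \<Rightarrow> (nat \<Rightarrow> R4 \<Rightarrow> real) \<Rightarrow> (R4 \<Rightarrow> real) \<Rightarrow> real" where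
  "partial_energy d \<beta> i u v =
     deriv (\<lambda>t::real. energy d \<beta> (u(i := (\<lambda>x. u i x + t * v x)))) 0"

definition nehari :: "nat \<Rightarrow> (nat \<Rightarrow> nat \<Rightarrow> real) \<Rightarrow> (nat \<Rightarrow> R4 \<Rightarrow> real) set" where
  "nehari d \<beta> = {u. (\<forall>i\<in>{1..d}. u i \<in> D12) \<and>
     (\<forall>i\<in>{1..d}. nonzero (u i) \<and> partial_energy d \<beta> i u (u i) = 0)}"

text \<open>Infima are taken in \<open>ereal\<close>, where they are meaningful for every set.\<close>

definition level :: "nat \<Rightarrow> (nat \<Rightarrow> nat \<Rightarrow> real) \<Rightarrow> ereal" where
  "level d \<beta> = (INF u\<in>nehari d \<beta>. ereal (energy d \<beta> u))"

definition scalar_level :: "(nat \<Rightarrow> nat \<Rightarrow> real) \<Rightarrow> nat \<Rightarrow> ereal" where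
  "scalar_level \<beta> h =
     (INF v\<in>{v \<in> D12. nonzero v \<and> dirichlet v = (\<integral>x. \<beta> h h * v x ^ 4 \<partial>lborel)}.
        ereal (1/2 * dirichlet v - 1/4 * (\<integral>x. \<beta> h h * v x ^ 4 \<partial>lborel)))"

end

theory Submission
  imports Defs
begin

text \<open>
  Write \<open>A\<close> for the Dirichlet integral, \<open>B\<close> for the integral of the fourth power and \<open>I\<^sub>i\<^sub>j\<close> for the
  integral of \<open>u\<^sub>i\<^sup>2 u\<^sub>j\<^sup>2\<close>. On the Nehari set \<open>A(u\<^sub>i) = \<Sum>\<^sub>j \<beta>\<^sub>i\<^sub>j I\<^sub>i\<^sub>j\<close>, so the energy is \<open>1/4 \<Sum>\<^sub>i A(u\<^sub>i)\<close>, and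
  \<open>A(u\<^sub>i) \<le> \<beta>\<^sub>i\<^sub>i B(u\<^sub>i)\<close> because the couplings are nonpositive. Rescaling each component to its scalar
  Nehari set therefore does not increase the energy, whence \<open>l \<ge> \<Sum> l\<^sub>h\<close>. Conversely, scalar competitors
  translated far apart have small interactions \<open>I\<^sub>i\<^sub>j\<close>; the diagonally dominant linear system for the squares
  of the scaling factors that put them on the Nehari set then has a solution close to \<open>1\<close>.

  If \<open>l\<close> were attained at \<open>u\<close>, every \<open>u\<^sub>i\<close> would minimise \<open>A\<^sup>2/B\<close> and all interactions with \<open>\<beta>\<^sub>i\<^sub>j < 0\<close>
  would vanish. But \<open>|u\<^sub>i|\<close> is a minimiser too; comparing it with \<open>|u\<^sub>i| + t \<phi>\<close> for \<open>\<phi> \<ge> 0\<close> shows that it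
  is weakly superharmonic, so by the mean value inequality it cannot vanish on a set of positive
  measure unless it vanishes almost everywhere.
\<close>


section \<open>Smooth functions\<close>

text \<open>Elements of \<open>D12\<close> are mere Borel functions whose gradient is known only
  through test functions, while the argument needs |u|, rigidity for zero gradient, and statements
  about zero sets. The link is an a.e. identity: u(x + h e_k) - u(x) is h times the mean of G_k over
  the segment from x to x + h e_k. It is obtained by translating the test function instead of u, and
  it yields convergence of difference quotients in L1 on balls; from there come the gradient of |u|
  and the fact that A(u) = 0 forces u = 0 a.e.

  The mean value inequality is derived for a smooth kernel in place of balls or spheres: the kernel
  is chosen so that its derivative in the scale is a multiple of the Laplacian of a rescaled
  nonnegative test function, which is exactly what weak superharmonicity controls. Since pointwise
  values are only a.e. meaningful, the principle starts from a zero of V at which the small-scale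
  averages also tend to 0.

  That an attained level makes each u_i a minimiser of A^2/B comes from equality in a sum of
  termwise inequalities.\<close>

lemma pderiv_at_eqI:
  "(f has_derivative f') (at x) \<Longrightarrow> pderiv_at k f x = f' (axis k 1)"
  unfolding pderiv_at_def using frechet_derivative_at[of f f' x] by simp

text \<open>In \<open>C_k (Suc n) f\<close> continuity of \<open>f\<close> itself is implicit: it
  comes from differentiability, which is the base case.\<close>

lemma C_k_Suc_imp: "C_k (Suc n) f \<Longrightarrow> C_k n f"
proof (induction n arbitrary: f)
  case 0
  then have "f differentiable_on UNIV" by (auto simp: differentiable_on_def)
  then show ?case by (simp add: differentiable_imp_continuous_on)
next
  case (Suc n)
  then show ?case by auto
qed

lemma C_k_SucI:
  assumes "\<And>x. (f has_derivative f' x) (at x)" "\<And>k. C_k n (\<lambda>x. f' x (axis k 1))"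
  shows "C_k (Suc n) f"
proof -
  have "pderiv_at k f = (\<lambda>x. f' x (axis k 1))" for k
    using pderiv_at_eqI[OF assms(1)] by auto
  then show ?thesis using assms by (auto simp: differentiable_def)
qed

lemma C_k_Suc_has_derivative:
  "C_k (Suc n) f \<Longrightarrow> (f has_derivative frechet_derivative f (at x)) (at x)"
  by (simp add: frechet_derivative_works)

lemma C_k_const: "C_k n (\<lambda>x. c)"
proof (induction n arbitrary: c)
  case (Suc n)
  show ?case by (rule C_k_SucI[where f'="\<lambda>x h. 0"]) (auto simp: Suc)
qed simp

lemma C_k_coord: "C_k n (\<lambda>x. x $ j)"
proof (cases n)
  case (Suc m)
  show ?thesis unfolding Suc
    by (rule C_k_SucI[where f'="\<lambda>x h. h $ j"]) (auto simp: C_k_const intro!: derivative_eq_intros bounded_linear_imp_has_derivative)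
qed (auto intro!: continuous_intros)

lemma C_k_add: "C_k n f \<Longrightarrow> C_k n g \<Longrightarrow> C_k n (\<lambda>x. f x + g x)"
proof (induction n arbitrary: f g)
  case (Suc n)
  show ?case
  proof (rule C_k_SucI)
    fix x show "((\<lambda>x. f x + g x) has_derivative (\<lambda>h. frechet_derivative f (at x) h + frechet_derivative g (at x) h)) (at x)"
      by (intro has_derivative_add C_k_Suc_has_derivative[of n] Suc.prems)
  next
    fix k show "C_k n (\<lambda>x. frechet_derivative f (at x) (axis k 1) + frechet_derivative g (at x) (axis k 1))"
      using Suc.IH[of "pderiv_at k f" "pderiv_at k g"] Suc.prems by (simp add: pderiv_at_def[abs_def])
  qed
qed (auto intro!: continuous_intros)

lemma C_k_mult: "C_k n f \<Longrightarrow> C_k n g \<Longrightarrow> C_k n (\<lambda>x. f x * g x)"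
proof (induction n arbitrary: f g)
  case (Suc n)
  show ?case
  proof (rule C_k_SucI)
    fix x show "((\<lambda>x. f x * g x) has_derivative (\<lambda>h. f x * frechet_derivative g (at x) h + frechet_derivative f (at x) h * g x)) (at x)"
      by (intro has_derivative_mult C_k_Suc_has_derivative[of n] Suc.prems)
  next
    fix k 
    have "C_k n (\<lambda>x. f x * pderiv_at k g x + pderiv_at k f x * g x)"
      using Suc.IH[of f "pderiv_at k g"] Suc.IH[of "pderiv_at k f" g] Suc.prems C_k_Suc_imp[of n f] C_k_Suc_imp[of n g]
      by (intro C_k_add) auto
    then show "C_k n (\<lambda>x. f x * frechet_derivative g (at x) (axis k 1) + frechet_derivative f (at x) (axis k 1) * g x)"
      by (simp add: pderiv_at_def)
  qed
qed (auto intro!: continuous_intros)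

lemma has_derivative_affine:
  assumes "\<And>x. (f has_derivative f' x) (at x)"
  shows "((\<lambda>x. f (a + c *\<^sub>R x)) has_derivative (\<lambda>h. f' (a + c *\<^sub>R x) (c *\<^sub>R h))) (at x)"
proof -
  have "((\<lambda>x. a + c *\<^sub>R x) has_derivative (\<lambda>h. c *\<^sub>R h)) (at x)"
    by (auto intro!: derivative_eq_intros)
  from has_derivative_compose[OF this assms] show ?thesis .
qed

lemma pderiv_at_affine:
  assumes "\<And>x. f differentiable at x"
  shows "pderiv_at k (\<lambda>x. f (a + c *\<^sub>R x)) x = c * pderiv_at k f (a + c *\<^sub>R x)"
proof -
  have "pderiv_at k (\<lambda>x. f (a + c *\<^sub>R x)) x = frechet_derivative f (at (a + c *\<^sub>R x)) (c *\<^sub>R axis k 1)"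
    using pderiv_at_eqI[OF has_derivative_affine[of f "\<lambda>x. frechet_derivative f (at x)"]] assms
    by (simp add: frechet_derivative_works)
  then show ?thesis
    using linear_frechet_derivative[OF assms] by (simp add: pderiv_at_def linear_cmul)
qed

lemma C_k_affine: "C_k n f \<Longrightarrow> C_k n (\<lambda>x. f (a + c *\<^sub>R x))"
proof (induction n arbitrary: f)
  case 0
  then show ?case by (auto intro!: continuous_intros continuous_on_compose2[of UNIV f])
next
  case (Suc n)
  have d: "\<And>x. f differentiable at x" using Suc.prems by auto
  have "(\<lambda>x. f (a + c *\<^sub>R x)) differentiable at x" for x
    using has_derivative_affine[where f=f, OF iffD1[OF frechet_derivative_works d]]
    by (rule differentiableI)
  moreover have "C_k n (pderiv_at k (\<lambda>x. f (a + c *\<^sub>R x)))" for k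
  proof -
    have "pderiv_at k (\<lambda>x. f (a + c *\<^sub>R x)) = (\<lambda>x. c * pderiv_at k f (a + c *\<^sub>R x))"
      by (rule ext) (rule pderiv_at_affine[where f=f, OF d])
    moreover have "C_k n (\<lambda>x. c * pderiv_at k f (a + c *\<^sub>R x))"
      using Suc.IH[of "pderiv_at k f"] Suc.prems C_k_mult[OF C_k_const] by simp
    ultimately show ?thesis by simp
  qed
  ultimately show ?case by simp
qed

section \<open>Functions flat at 0 and smooth radial bumps\<close>

definition flat_exp :: "real poly \<Rightarrow> real \<Rightarrow> real" where
  "flat_exp p t = (if t > 0 then poly p (1/t) * exp (- (1/t)) else 0)"

lemma poly_times_exp_tendsto_0: "((\<lambda>x::real. poly p x * exp (- x)) \<longlongrightarrow> 0) at_top"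
proof -
  have "(\<lambda>x::real. poly p x * exp (- x)) = (\<lambda>x. \<Sum>i\<le>degree p. coeff p i * (x ^ i / exp x))"
    by (auto simp: poly_altdef sum_distrib_right exp_minus divide_inverse mult.assoc)
  moreover have "((\<lambda>x::real. \<Sum>i\<le>degree p. coeff p i * (x ^ i / exp x)) \<longlongrightarrow> (\<Sum>i\<le>degree p. coeff p i * 0)) at_top"
    by (intro tendsto_sum tendsto_mult tendsto_const tendsto_power_div_exp_0)
  ultimately show ?thesis by simp
qed

lemma flat_exp_tendsto_0: "(flat_exp p \<longlongrightarrow> 0) (at 0)"
proof -
  have "((\<lambda>t. poly p (1/t) * exp (- (1/t))) \<longlongrightarrow> 0) (at_right (0::real))"
    using filterlim_compose[OF poly_times_exp_tendsto_0 filterlim_inverse_at_top_right]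
    by (simp add: inverse_eq_divide)
  then have "(flat_exp p \<longlongrightarrow> 0) (at_right 0)"
    by (rule Lim_transform_eventually) (auto simp: eventually_at_right_less flat_exp_def eventually_at_filter)
  moreover have "(flat_exp p \<longlongrightarrow> 0) (at_left 0)"
    by (rule Lim_transform_eventually[OF tendsto_const]) (auto simp: flat_exp_def eventually_at_filter)
  ultimately show ?thesis by (simp add: filterlim_split_at)
qed

text \<open>With s = 1/t the derivative of p(s) exp(-s) in t is s^2 (p(s) - p'(s)) exp(-s). The
  functions \<open>flat_exp p\<close>, p an arbitrary polynomial, are thus closed under
  differentiation, so that smoothness of all orders comes from a single induction.\<close>

definition flat_deriv :: "real poly \<Rightarrow> real poly" where
  "flat_deriv p = [:0,0,1:] * (p - pderiv p)"

lemma flat_exp_deriv: "(flat_exp p has_real_derivative flat_exp (flat_deriv p) t) (at t)"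
proof -
  consider "t > 0" | "t < 0" | "t = 0" by linarith
  then show ?thesis
  proof cases
    case 1
    have "((\<lambda>t. poly p (1/t) * exp (- (1/t))) has_real_derivative flat_exp (flat_deriv p) t) (at t)"
      using 1 by (auto intro!: derivative_eq_intros simp: flat_exp_def flat_deriv_def field_simps power2_eq_square)
    moreover have "eventually (\<lambda>t. t \<in> {0<..}) (nhds t)"
      using 1 by (intro eventually_nhds_in_open) auto
    ultimately show ?thesis
      by (subst DERIV_cong_ev[OF refl _ refl, where g="\<lambda>t. poly p (1/t) * exp (- (1/t))"])
        (auto simp: flat_exp_def elim!: eventually_mono)
  next
    case 2
    moreover have "eventually (\<lambda>t. t \<in> {..<0}) (nhds t)"
      using 2 by (intro eventually_nhds_in_open) auto
    ultimately show ?thesis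
      by (subst DERIV_cong_ev[OF refl _ refl, where g="\<lambda>t. 0"])
        (auto simp: flat_exp_def elim!: eventually_mono)
  next
    case 3
    \<comment> \<open>Dividing by h amounts to multiplying the polynomial by X, so the difference
      quotient at 0 belongs to the same family and tends to 0.\<close>
    have "(\<lambda>h. (flat_exp p (0 + h) - flat_exp p 0) / h) = flat_exp ([:0,1:] * p)"
      by (auto simp: flat_exp_def field_simps)
    then show ?thesis using 3 flat_exp_tendsto_0 by (simp add: DERIV_def flat_exp_def)
  qed
qed

text \<open>The argument 1 - |x|^2 is polynomial in x, so the function is smooth also at the origin;
  it vanishes outside the open unit ball.\<close>

definition bump :: "real poly \<Rightarrow> R4 \<Rightarrow> real" where
  "bump p x = flat_exp p (1 - x \<bullet> x)"

lemma bump_has_derivative: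
  "(bump p has_derivative (\<lambda>h. bump (flat_deriv p) x * (- 2 * (x \<bullet> h)))) (at x)"
proof -
  have "((\<lambda>x::R4. 1 - x \<bullet> x) has_derivative (\<lambda>h. - 2 * (x \<bullet> h))) (at x)"
    by (auto intro!: derivative_eq_intros simp: inner_commute)
  from has_derivative_compose[OF this, of "flat_exp p" "\<lambda>h. flat_exp (flat_deriv p) (1 - x \<bullet> x) * h"]
  show ?thesis
    using flat_exp_deriv[of p "1 - x \<bullet> x"] by (simp add: bump_def[abs_def] has_field_derivative_def)
qed

lemma pderiv_at_bump: "pderiv_at k (bump p) = (\<lambda>x. - 2 * (bump (flat_deriv p) x * x $ k))"
  by (rule ext, subst pderiv_at_eqI[OF bump_has_derivative]) (simp add: inner_axis)

lemma C_k_bump: "C_k n (bump p)"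
proof (induction n arbitrary: p)
  case 0
  have "(bump p) differentiable_on UNIV"
    using bump_has_derivative by (auto simp: differentiable_on_def differentiable_def)
  then show ?case by (simp add: differentiable_imp_continuous_on)
next
  case (Suc n)
  have "C_k n (pderiv_at k (bump p))" for k
    unfolding pderiv_at_bump by (intro C_k_mult C_k_const Suc C_k_coord)
  then show ?case using bump_has_derivative by (auto simp: differentiable_def)
qed

section \<open>Test functions\<close>

lemma test_function_C_k: "test_function f \<Longrightarrow> C_k n f"
  by (simp add: test_function_def)

lemma test_function_differentiable: "test_function f \<Longrightarrow> f differentiable at x"
  using test_function_C_k[of f "Suc 0"] by simp

lemma test_function_continuous: "test_function f \<Longrightarrow> continuous_on S f"
  using test_function_C_k[of f 0] continuous_on_subset by auto

lemma test_function_support: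
  assumes "test_function f"
  obtains R where "R > 0" "\<And>x. norm x \<ge> R \<Longrightarrow> f x = 0"
proof -
  have "bounded {x. f x \<noteq> 0}"
    using assms unfolding test_function_def
    by (meson bounded_subset closure_subset compact_imp_bounded)
  then obtain R where "\<forall>x\<in>{x. f x \<noteq> 0}. norm x < R" "R > 0" by (auto simp: bounded_pos_less)
  then show ?thesis using that[of R] by force
qed

lemma test_functionI:
  assumes "\<And>n. C_k n f" "\<And>x. norm x \<ge> R \<Longrightarrow> f x = 0"
  shows "test_function f"
proof -
  have "bounded {x. f x \<noteq> 0}"
    using assms(2) by (auto simp: bounded_iff intro!: exI[of _ R]) (meson linorder_le_cases)
  then show ?thesis using assms(1) by (simp add: test_function_def)
qed

lemma test_function_pderiv:
  assumes "test_function f"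
  shows "test_function (pderiv_at k f)"
proof -
  obtain R where R: "R > 0" "\<And>x. norm x \<ge> R \<Longrightarrow> f x = 0" using test_function_support[OF assms] by blast
  show ?thesis
  \<comment> \<open>The enlarged radius leaves room: around each point of norm at least R + 1 the
    function vanishes on a whole neighbourhood, so its derivative there is 0.\<close>
  proof (rule test_functionI[where R="R + 1"])
    fix n show "C_k n (pderiv_at k f)" using test_function_C_k[OF assms, of "Suc n"] by simp
  next
    fix x :: R4 assume x: "norm x \<ge> R + 1"
    have "eventually (\<lambda>y. y \<in> {y. norm y > R}) (nhds x)"
      using x by (intro eventually_nhds_in_open open_Collect_less continuous_intros) auto
    then have "eventually (\<lambda>y. f y = 0) (nhds x)"
      by eventually_elim (auto simp: R)
    then have "(f has_derivative (\<lambda>h. 0)) (at x)"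
      using x R(2)[of x]
      by (intro has_derivative_transform_eventually[OF has_derivative_const[of 0]])
        (auto simp: eventually_nhds_conv_at elim: eventually_mono)
    from pderiv_at_eqI[OF this] show "pderiv_at k f x = 0" by simp
  qed
qed

lemma test_function_affine:
  assumes "test_function f" "c \<noteq> 0"
  shows "test_function (\<lambda>x. f (a + c *\<^sub>R x))"
proof -
  obtain R where R: "R > 0" "\<And>x. norm x \<ge> R \<Longrightarrow> f x = 0" using test_function_support[OF assms(1)] by blast
  show ?thesis
  proof (rule test_functionI[where R="(R + norm a) / \<bar>c\<bar>"])
    fix n show "C_k n (\<lambda>x. f (a + c *\<^sub>R x))" using test_function_C_k[OF assms(1)] by (rule C_k_affine)
  next
    fix x :: R4 assume x: "norm x \<ge> (R + norm a) / \<bar>c\<bar>"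
    then have "norm (c *\<^sub>R x) \<ge> R + norm a" using assms(2) by (simp add: field_simps)
    then have "norm (a + c *\<^sub>R x) \<ge> R" using norm_triangle_ineq4[of "a + c *\<^sub>R x" a] by simp
    then show "f (a + c *\<^sub>R x) = 0" by (rule R)
  qed
qed

lemma test_function_cmult:
  assumes "test_function f"
  shows "test_function (\<lambda>x. c * f x)"
proof -
  obtain R where R: "R > 0" "\<And>x. norm x \<ge> R \<Longrightarrow> f x = 0"
    using test_function_support[OF assms] by blast
  show ?thesis
    by (rule test_functionI[where R=R, OF C_k_mult[OF C_k_const test_function_C_k[OF assms]]])
      (simp add: R)
qed

lemma test_function_bump: "test_function (bump p)"
proof (rule test_functionI[OF C_k_bump, where R=1])
  fix x :: R4 assume "norm x \<ge> 1"
  then have "x \<bullet> x \<ge> 1" by (simp add: dot_square_norm)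
  then show "bump p x = 0" by (simp add: bump_def flat_exp_def)
qed

lemma test_function_bounded:
  assumes "test_function f"
  obtains C where "C > 0" "\<And>x. \<bar>f x\<bar> \<le> C"
proof -
  obtain R where R: "R > 0" "\<And>x. norm x \<ge> R \<Longrightarrow> f x = 0" using test_function_support[OF assms] by blast
  have "compact (f ` cball 0 R)"
    by (intro compact_continuous_image test_function_continuous assms) auto
  then obtain C where C: "\<And>y. y \<in> f ` cball 0 R \<Longrightarrow> norm y \<le> C" "C > 0"
    by (metis bounded_pos compact_imp_bounded)
  have "\<bar>f x\<bar> \<le> C" for x
    using R(2)[of x] C by (cases "norm x \<le> R") force+
  then show ?thesis using that C by blast
qed

lemma test_function_measurable [measurable_dest]: "test_function f \<Longrightarrow> f \<in> borel_measurable borel"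
  by (rule borel_measurable_continuous_onI[OF test_function_continuous])


section \<open>Translations and averages of integrable functions\<close>

lemma lborel_integral_shift:
  fixes f :: "R4 \<Rightarrow> real"
  assumes [measurable]: "f \<in> borel_measurable borel"
  shows "(\<integral>x. f (a + x) \<partial>lborel) = (\<integral>x. f x \<partial>lborel)"
proof -
  have "(\<integral>x. f x \<partial>lborel) = (\<integral>x. f x \<partial>distr lborel borel ((+) a))"
    by (simp add: lborel_distr_plus)
  also have "\<dots> = (\<integral>x. f (a + x) \<partial>lborel)"
    by (rule integral_distr) auto
  finally show ?thesis by simp
qed

lemma lborel_integrable_shift:
  fixes f :: "R4 \<Rightarrow> 'b::{banach, second_countable_topology}"
  assumes "integrable lborel f"
  shows "integrable lborel (\<lambda>x. f (a + x))"
proof -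
  have "integrable (distr lborel borel ((+) a)) f"
    using assms by (simp add: lborel_distr_plus)
  then show ?thesis using assms by (subst (asm) integrable_distr_eq) auto
qed

lemma lborel_integral_scale:
  fixes f :: "R4 \<Rightarrow> real"
  assumes [measurable]: "f \<in> borel_measurable borel" and c: "c \<noteq> 0"
  shows "(\<integral>x. f x \<partial>lborel) = \<bar>c\<bar> ^ 4 * (\<integral>x. f (a + c *\<^sub>R x) \<partial>lborel)"
proof -
  have "(\<integral>x. f x \<partial>lborel) = (\<integral>x. f x \<partial>density (distr lborel borel (\<lambda>x. a + c *\<^sub>R x)) (\<lambda>_. ennreal (\<bar>c\<bar> ^ 4)))"
    using lborel_affine[OF c, of a] by (simp add: ennreal_power)
  also have "\<dots> = (\<integral>x. \<bar>c\<bar> ^ 4 *\<^sub>R f x \<partial>distr lborel borel (\<lambda>x. a + c *\<^sub>R x))"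
    by (rule integral_density) auto
  also have "\<dots> = (\<integral>x. \<bar>c\<bar> ^ 4 *\<^sub>R f (a + c *\<^sub>R x) \<partial>lborel)"
    by (rule integral_distr) auto
  finally show ?thesis by simp
qed

text \<open>The L1 modulus of continuity under translation. That it tends to 0 with h for integrable
  functions is the common source of the convergence of mollifications and of difference
  quotients.\<close>

definition shift_modulus :: "(R4 \<Rightarrow> real) \<Rightarrow> R4 \<Rightarrow> real" where
  "shift_modulus f h = (\<integral>x. \<bar>f (h + x) - f x\<bar> \<partial>lborel)"

lemma shift_modulus_integrable:
  fixes f :: "R4 \<Rightarrow> real"
  assumes "integrable lborel f"
  shows "integrable lborel (\<lambda>x. \<bar>f (h + x) - f x\<bar>)"
  using lborel_integrable_shift[OF assms, of h] assms by simp

lemma shift_modulus_nonneg: "0 \<le> shift_modulus f h"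
  unfolding shift_modulus_def by (intro Bochner_Integration.integral_nonneg) simp

text \<open>The difference f - g is paid at x and at h + x, with the same integral by translation
  invariance; hence the factor 2.\<close>

lemma shift_modulus_diff:
  assumes f: "integrable lborel f" and g: "integrable lborel g"
  shows "shift_modulus f h \<le> shift_modulus g h + 2 * (\<integral>x. \<bar>f x - g x\<bar> \<partial>lborel)"
proof -
  have d: "integrable lborel (\<lambda>x. \<bar>f x - g x\<bar>)" using f g by simp
  note dh = lborel_integrable_shift[OF d, of h]
  have [measurable]: "f \<in> borel_measurable borel" "g \<in> borel_measurable borel"
    using f g by (auto dest: borel_measurable_integrable)
  have "shift_modulus f h \<le> (\<integral>x. (\<bar>g (h + x) - g x\<bar> + \<bar>f (h + x) - g (h + x)\<bar>) + \<bar>f x - g x\<bar> \<partial>lborel)"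
    unfolding shift_modulus_def
    by (intro Bochner_Integration.integral_mono Bochner_Integration.integrable_add shift_modulus_integrable f g d dh) simp
  also have "\<dots> = shift_modulus g h + (\<integral>x. \<bar>f (h + x) - g (h + x)\<bar> \<partial>lborel) + (\<integral>x. \<bar>f x - g x\<bar> \<partial>lborel)"
    unfolding shift_modulus_def using shift_modulus_integrable[OF g, of h] d dh
    by (simp add: Bochner_Integration.integral_add)
  also have "(\<integral>x. \<bar>f (h + x) - g (h + x)\<bar> \<partial>lborel) = (\<integral>x. \<bar>f x - g x\<bar> \<partial>lborel)"
    using lborel_integral_shift[of "\<lambda>x. \<bar>f x - g x\<bar>" h] by simp
  finally show ?thesis by simp
qed

lemma shift_modulus_le:
  assumes f: "integrable lborel f"
  shows "shift_modulus f h \<le> 2 * (\<integral>x. \<bar>f x\<bar> \<partial>lborel)"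
  using shift_modulus_diff[OF f, of "\<lambda>x. 0" h] by (simp add: shift_modulus_def)

text \<open>Openness makes the shifted indicator converge to 1 at every point of U. Translation
  invariance moves the whole modulus into U: it is twice the measure of the part of U that the shift
  pushes out of U, and dominated convergence applies to that.\<close>

lemma shift_modulus_open:
  assumes U: "open U" "emeasure lborel U < \<infinity>" and h: "h \<longlonglongrightarrow> 0"
  shows "(\<lambda>n. shift_modulus (indicator U) (h n)) \<longlonglongrightarrow> 0"
proof -
  have [measurable]: "U \<in> sets borel" using U by simp
  have iU: "integrable lborel (indicator U :: R4 \<Rightarrow> real)" using U by simp
  have iUh: "integrable lborel (\<lambda>x. indicator U (a + x) :: real)" for a
    using lborel_integrable_shift[OF iU] .
  have *: "shift_modulus (indicator U) a = 2 * (\<integral>x. indicator U x - indicator U x * indicator U (a + x) \<partial>lborel)" for a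
  proof -
    have im: "integrable lborel (\<lambda>x. indicator U x * indicator U (a + x) :: real)"
      by (rule Bochner_Integration.integrable_bound[OF iU]) (auto simp: indicator_def)
    have "shift_modulus (indicator U) a = (\<integral>x. (indicator U x + indicator U (a + x)) - 2 * (indicator U x * indicator U (a + x)) \<partial>lborel)"
      unfolding shift_modulus_def
      by (intro Bochner_Integration.integral_cong) (auto simp: indicator_def)
    also have "\<dots> = 2 * (\<integral>x. indicator U x - indicator U x * indicator U (a + x) \<partial>lborel)"
      using lborel_integral_shift[of "indicator U" a] iU iUh im by simp
    finally show ?thesis .
  qed
  have "(\<lambda>n. \<integral>x. indicator U x - indicator U x * indicator U (h n + x) \<partial>lborel) \<longlonglongrightarrow> (\<integral>x. (0::real) \<partial>(lborel :: R4 measure))"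
  proof (rule integral_dominated_convergence[where w="indicator U"])
    show "AE x in lborel. (\<lambda>n. indicator U x - indicator U x * indicator U (h n + x)) \<longlonglongrightarrow> (0::real)"
    proof (rule AE_I2)
      fix x :: R4
      show "(\<lambda>n. indicator U x - indicator U x * indicator U (h n + x)) \<longlonglongrightarrow> (0::real)"
      proof (cases "x \<in> U")
        case True
        have "(\<lambda>n. h n + x) \<longlonglongrightarrow> 0 + x" by (intro tendsto_intros h)
        then have "eventually (\<lambda>n. h n + x \<in> U) sequentially"
          using topological_tendstoD U(1) True by fastforce
        then have "eventually (\<lambda>n. indicator U x - indicator U x * indicator U (h n + x) = (0::real)) sequentially"
          by eventually_elim (simp add: True)
        then show ?thesis by (rule tendsto_eventually)
      qed simp
    qed
  qed (use iU in \<open>auto simp: indicator_def\<close>)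
  then show ?thesis unfolding * using tendsto_mult_right_zero by auto
qed

lemma shift_modulus_approx:
  assumes "integrable lborel f"
    and "\<And>e. e > 0 \<Longrightarrow> \<exists>g. integrable lborel g \<and> (\<integral>x. \<bar>f x - g x\<bar> \<partial>lborel) \<le> e \<and> (\<lambda>n. shift_modulus g (h n)) \<longlonglongrightarrow> 0"
  shows "(\<lambda>n. shift_modulus f (h n)) \<longlonglongrightarrow> 0"
proof (rule tendstoI)
  fix e :: real assume e: "e > 0"
  then obtain g where g: "integrable lborel g" "(\<integral>x. \<bar>f x - g x\<bar> \<partial>lborel) \<le> e / 4" "(\<lambda>n. shift_modulus g (h n)) \<longlonglongrightarrow> 0"
    using assms(2)[of "e/4"] by auto
  have "eventually (\<lambda>n. shift_modulus g (h n) < e / 2) sequentially"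
    using order_tendstoD(2)[OF g(3), of "e/2"] e by simp
  then show "eventually (\<lambda>n. dist (shift_modulus f (h n)) 0 < e) sequentially"
  proof eventually_elim
    case (elim n)
    then show ?case using shift_modulus_diff[OF assms(1) g(1), of "h n"] g(2) shift_modulus_nonneg[of f "h n"] by simp
  qed
qed

text \<open>Continuity of translations in L1, by density: a set of finite measure is approximated
  from outside by open sets, sums use the triangle inequality, and pointwise limits with a majorant
  are limits in L1.\<close>

lemma shift_modulus_tendsto_0:
  assumes f: "integrable lborel f" and h: "h \<longlonglongrightarrow> 0"
  shows "(\<lambda>n. shift_modulus f (h n)) \<longlonglongrightarrow> 0"
  using f
proof (induction rule: integrable_induct)
  case (base A c)
  then have [measurable]: "A \<in> sets borel" by simp
  have iA: "integrable lborel (indicator A :: R4 \<Rightarrow> real)" using base by simp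
  have "(\<lambda>n. shift_modulus (indicator A) (h n)) \<longlonglongrightarrow> 0"
  proof (rule shift_modulus_approx[OF iA])
    fix e :: real assume e: "e > 0"
    have "A \<in> sets lebesgue" by simp
    then obtain U where U: "open U" "A \<subseteq> U" "emeasure lebesgue (U - A) < ennreal e"
      using sets_lebesgue_outer_open e by metis
    have [measurable]: "U \<in> sets borel" using U by simp
    have eU: "emeasure lborel (U - A) < ennreal e" using U(3) by simp
    have "emeasure lborel U = emeasure lborel A + emeasure lborel (U - A)"
      using U(2) by (subst plus_emeasure) (auto simp: Un_absorb1)
    also have "\<dots> < \<infinity>" using base(2) order.strict_trans[OF eU ennreal_less_top] by simp
    finally have fU: "emeasure lborel U < \<infinity>" .
    have "(\<integral>x. \<bar>indicator A x - indicator U x :: real\<bar> \<partial>lborel) = (\<integral>x. indicator (U - A) x \<partial>lborel)"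
      using U(2) by (intro Bochner_Integration.integral_cong) (auto simp: indicator_def)
    also have "\<dots> = measure lborel (U - A)" by simp
    also have "\<dots> \<le> e" unfolding measure_def using eU e by (simp add: enn2real_leI order_less_imp_le)
    finally show "\<exists>g. integrable lborel g \<and> (\<integral>x. \<bar>indicator A x - g x\<bar> \<partial>lborel) \<le> e \<and> (\<lambda>n. shift_modulus g (h n)) \<longlonglongrightarrow> 0"
      using fU shift_modulus_open[OF U(1) fU h] by (intro exI[of _ "indicator U"]) simp
  qed
  moreover have "\<bar>indicat_real A (a + x) *\<^sub>R c - indicat_real A x *\<^sub>R c\<bar>
      = \<bar>c\<bar> * \<bar>indicat_real A (a + x) - indicat_real A x\<bar>" for a x
    by (simp add: left_diff_distrib[symmetric] abs_mult)
  ultimately show ?case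
    using tendsto_mult_left[of _ 0 _ "\<bar>c\<bar>"] unfolding shift_modulus_def by simp
next
  case (add f g)
  have "(\<lambda>n. shift_modulus f (h n) + shift_modulus g (h n)) \<longlonglongrightarrow> 0"
    using tendsto_add[OF add.IH] by simp
  moreover have "shift_modulus (\<lambda>x. f x + g x) a \<le> shift_modulus f a + shift_modulus g a" for a
  proof -
    have "shift_modulus (\<lambda>x. f x + g x) a \<le> (\<integral>x. \<bar>f (a + x) - f x\<bar> + \<bar>g (a + x) - g x\<bar> \<partial>lborel)"
      unfolding shift_modulus_def
      by (intro Bochner_Integration.integral_mono shift_modulus_integrable Bochner_Integration.integrable_add add) simp
    also have "\<dots> = shift_modulus f a + shift_modulus g a"
      unfolding shift_modulus_def
      by (intro Bochner_Integration.integral_add shift_modulus_integrable add)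
    finally show ?thesis .
  qed
  ultimately show ?case
    by (elim tendsto_sandwich[OF always_eventually always_eventually tendsto_const, rotated 2])
      (auto simp: shift_modulus_nonneg)
next
  case (lim f s)
  have [measurable]: "f \<in> borel_measurable lborel" "\<And>i. s i \<in> borel_measurable lborel"
    using lim(1,4) by (auto dest: borel_measurable_integrable)
  \<comment> \<open>The induction rule supplies |s_i| \<le> 2 |f|, hence the majorant 3 |f|.\<close>
  have 1: "(\<lambda>i. \<integral>x. \<bar>f x - s i x\<bar> \<partial>lborel) \<longlonglongrightarrow> (\<integral>x. (0::real) \<partial>(lborel :: R4 measure))"
  proof (rule integral_dominated_convergence[where w="\<lambda>x. 3 * norm (f x)"])
    show "AE x in lborel. (\<lambda>i. \<bar>f x - s i x\<bar>) \<longlonglongrightarrow> 0"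
    proof (rule AE_I2)
      fix x :: R4
      have "(\<lambda>i. \<bar>f x - s i x\<bar>) \<longlonglongrightarrow> \<bar>f x - f x\<bar>" using lim(2) by (intro tendsto_intros) auto
      then show "(\<lambda>i. \<bar>f x - s i x\<bar>) \<longlonglongrightarrow> 0" by simp
    qed
    show "AE x in lborel. norm \<bar>f x - s i x\<bar> \<le> 3 * norm (f x)" for i
    proof (rule AE_I2)
      fix x :: R4
      show "norm \<bar>f x - s i x\<bar> \<le> 3 * norm (f x)" using lim(3)[of x i] by simp
    qed
  qed (use lim(4) in auto)
  show ?case
  proof (rule shift_modulus_approx[OF lim(4)])
    fix e :: real assume e: "e > 0"
    have "eventually (\<lambda>i. (\<integral>x. \<bar>f x - s i x\<bar> \<partial>lborel) < e) sequentially"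
      using order_tendstoD(2)[OF 1, of e] e by simp
    then obtain i where "(\<integral>x. \<bar>f x - s i x\<bar> \<partial>lborel) < e" by (auto simp: eventually_sequentially)
    then show "\<exists>g. integrable lborel g \<and> (\<integral>x. \<bar>f x - g x\<bar> \<partial>lborel) \<le> e \<and> (\<lambda>n. shift_modulus g (h n)) \<longlonglongrightarrow> 0"
      using lim(1,5) by (intro exI[of _ "s i"]) (simp add: order_less_imp_le)
  qed
qed

text \<open>The parameter space is general because there are two uses: parameters in R^4 with weight
  \<open>rho\<close> give mollification, real parameters weighted by the indicator of the unit
  interval give means over segments. The estimate is Fubini: the weighted mean of f(a(p) + x) - f(x)
  has L1 norm at most the weighted mean of the moduli.\<close>

lemma average_of_shifts:
  fixes w :: "'p \<Rightarrow> real" and f :: "R4 \<Rightarrow> real"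
  assumes M: "sigma_finite_measure M" and w: "integrable M w" "\<And>p. 0 \<le> w p"
    and a [measurable]: "a \<in> M \<rightarrow>\<^sub>M borel" and f: "integrable lborel f"
  shows average_of_shifts_integrable: "integrable lborel (\<lambda>x. \<integral>p. w p * f (a p + x) \<partial>M)"
    and average_of_shifts_AE: "AE x in lborel. integrable M (\<lambda>p. w p * f (a p + x))"
    and average_of_shifts_dist: "(\<integral>x. \<bar>(\<integral>p. w p * f (a p + x) \<partial>M) - (\<integral>p. w p \<partial>M) * f x\<bar> \<partial>lborel)
      \<le> (\<integral>p. w p * shift_modulus f (a p) \<partial>M)"
    and average_of_shifts_modulus_integrable: "integrable M (\<lambda>p. w p * shift_modulus f (a p))"
proof -
  interpret M: sigma_finite_measure M by fact
  interpret P: pair_sigma_finite M "lborel :: R4 measure" ..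
  have [measurable]: "f \<in> borel_measurable borel" "w \<in> borel_measurable M"
    using f w by (auto dest: borel_measurable_integrable)
  have K: "integrable (M \<Otimes>\<^sub>M lborel) (\<lambda>(p, x). w p * f (a p + x))"
  proof (rule P.Fubini_integrable)
    have "(\<integral>x. norm (w p * f (a p + x)) \<partial>lborel) = w p * (\<integral>x. norm (f x) \<partial>lborel)" for p
      using lborel_integral_shift[of "\<lambda>x. norm (f x)" "a p"] w(2)[of p] by (simp add: abs_mult)
    then show "integrable M (\<lambda>p. \<integral>x. norm (case (p, x) of (p, x) \<Rightarrow> w p * f (a p + x)) \<partial>lborel)"
      using w by simp
    show "AE p in M. integrable lborel (\<lambda>x. case (p, x) of (p, x) \<Rightarrow> w p * f (a p + x))"
      using lborel_integrable_shift[OF f] by simp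
  qed measurable
  have K0: "integrable (M \<Otimes>\<^sub>M lborel) (\<lambda>(p, x). w p * f x)"
  proof (rule P.Fubini_integrable)
    show "integrable M (\<lambda>p. \<integral>x. norm (case (p, x) of (p, x) \<Rightarrow> w p * f x) \<partial>lborel)"
      using w by (simp add: abs_mult)
    show "AE p in M. integrable lborel (\<lambda>x. case (p, x) of (p, x) \<Rightarrow> w p * f x)"
      using f by simp
  qed measurable
  show 1: "integrable lborel (\<lambda>x. \<integral>p. w p * f (a p + x) \<partial>M)" by (rule P.integrable_snd[OF K])
  show 2: "AE x in lborel. integrable M (\<lambda>p. w p * f (a p + x))" by (rule P.AE_integrable_snd[OF K])
  have H: "integrable (M \<Otimes>\<^sub>M lborel) (\<lambda>(p, x). w p * \<bar>f (a p + x) - f x\<bar>)"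
  proof -
    have "integrable (M \<Otimes>\<^sub>M lborel) (\<lambda>z. \<bar>(case z of (p, x) \<Rightarrow> w p * f (a p + x)) - (case z of (p, x) \<Rightarrow> w p * f x)\<bar>)"
      using K K0 by (intro Bochner_Integration.integrable_abs Bochner_Integration.integrable_diff)
    then show ?thesis
      by (rule Bochner_Integration.integrable_cong[THEN iffD1, rotated -1])
        (auto simp: right_diff_distrib[symmetric] abs_mult w(2))
  qed
  have "(\<integral>x. \<bar>(\<integral>p. w p * f (a p + x) \<partial>M) - (\<integral>p. w p \<partial>M) * f x\<bar> \<partial>lborel)
      \<le> (\<integral>x. (\<integral>p. w p * \<bar>f (a p + x) - f x\<bar> \<partial>M) \<partial>lborel)"
  proof (rule integral_mono_AE)
    show "integrable lborel (\<lambda>x. \<bar>(\<integral>p. w p * f (a p + x) \<partial>M) - (\<integral>p. w p \<partial>M) * f x\<bar>)"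
      using 1 f by simp
    show "integrable lborel (\<lambda>x. (\<integral>p. w p * \<bar>f (a p + x) - f x\<bar> \<partial>M))" by (rule P.integrable_snd[OF H])
    show "AE x in lborel. \<bar>(\<integral>p. w p * f (a p + x) \<partial>M) - (\<integral>p. w p \<partial>M) * f x\<bar> \<le> (\<integral>p. w p * \<bar>f (a p + x) - f x\<bar> \<partial>M)"
      using 2
    proof eventually_elim
      case (elim x)
      have "(\<integral>p. w p * f (a p + x) \<partial>M) - (\<integral>p. w p \<partial>M) * f x = (\<integral>p. w p * f (a p + x) - w p * f x \<partial>M)"
        using elim w(1) by simp
      also have "\<bar>\<dots>\<bar> \<le> (\<integral>p. \<bar>w p * f (a p + x) - w p * f x\<bar> \<partial>M)" by (rule integral_abs_bound)
      also have "\<dots> = (\<integral>p. w p * \<bar>f (a p + x) - f x\<bar> \<partial>M)"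
        by (intro Bochner_Integration.integral_cong) (auto simp: right_diff_distrib[symmetric] abs_mult w(2))
      finally show ?case .
    qed
  qed
  also have "\<dots> = (\<integral>p. (\<integral>x. w p * \<bar>f (a p + x) - f x\<bar> \<partial>lborel) \<partial>M)"
    by (rule P.Fubini_integral[OF H])
  also have "\<dots> = (\<integral>p. w p * shift_modulus f (a p) \<partial>M)" by (simp add: shift_modulus_def)
  finally show "(\<integral>x. \<bar>(\<integral>p. w p * f (a p + x) \<partial>M) - (\<integral>p. w p \<partial>M) * f x\<bar> \<partial>lborel)
      \<le> (\<integral>p. w p * shift_modulus f (a p) \<partial>M)" .
  show "integrable M (\<lambda>p. w p * shift_modulus f (a p))"
    using P.integrable_fst[OF H] by (simp add: shift_modulus_def)
qed

text \<open>Dominated convergence in the parameter: each modulus tends to 0 and is at most twice the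
  L1 norm of f.\<close>

lemma average_of_shifts_tendsto:
  fixes w :: "'p \<Rightarrow> real" and f :: "R4 \<Rightarrow> real"
  assumes M: "sigma_finite_measure M" and w: "integrable M w" "\<And>p. 0 \<le> w p"
    and a [measurable]: "\<And>n. a n \<in> M \<rightarrow>\<^sub>M borel" and f: "integrable lborel f"
    and lim: "\<And>p. (\<lambda>n. a n p) \<longlonglongrightarrow> 0"
  shows "(\<lambda>n. \<integral>x. \<bar>(\<integral>p. w p * f (a n p + x) \<partial>M) - (\<integral>p. w p \<partial>M) * f x\<bar> \<partial>lborel) \<longlonglongrightarrow> 0"
proof (rule tendsto_sandwich[OF always_eventually always_eventually tendsto_const])
  have m: "(\<lambda>p. w p * shift_modulus f (a n p)) \<in> borel_measurable M" for n
    using average_of_shifts_modulus_integrable[OF M w a f] by (rule borel_measurable_integrable)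
  have "(\<lambda>n. \<integral>p. w p * shift_modulus f (a n p) \<partial>M) \<longlonglongrightarrow> (\<integral>p. 0 \<partial>M)"
  proof (rule integral_dominated_convergence[where w="\<lambda>p. w p * (2 * (\<integral>x. \<bar>f x\<bar> \<partial>lborel))"])
    show "AE p in M. (\<lambda>n. w p * shift_modulus f (a n p)) \<longlonglongrightarrow> 0"
      using shift_modulus_tendsto_0[OF f lim] by (auto intro!: tendsto_mult_right_zero)
    show "AE p in M. norm (w p * shift_modulus f (a n p)) \<le> w p * (2 * (\<integral>x. \<bar>f x\<bar> \<partial>lborel))" for n
      using shift_modulus_le[OF f] shift_modulus_nonneg w(2)
      by (intro AE_I2) (auto simp: abs_mult intro!: mult_left_mono)
    show "integrable M (\<lambda>p. w p * (2 * (\<integral>x. \<bar>f x\<bar> \<partial>lborel)))" using w by simp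
  qed (use m in auto)
  then show "(\<lambda>n. \<integral>p. w p * shift_modulus f (a n p) \<partial>M) \<longlonglongrightarrow> 0" by simp
  show "\<forall>n. 0 \<le> (\<integral>x. \<bar>(\<integral>p. w p * f (a n p + x) \<partial>M) - (\<integral>p. w p \<partial>M) * f x\<bar> \<partial>lborel)"
    by (intro allI Bochner_Integration.integral_nonneg) simp
  show "\<forall>n. (\<integral>x. \<bar>(\<integral>p. w p * f (a n p + x) \<partial>M) - (\<integral>p. w p \<partial>M) * f x\<bar> \<partial>lborel) \<le> (\<integral>p. w p * shift_modulus f (a n p) \<partial>M)"
    using average_of_shifts_dist[OF M w a f] by blast
qed


section \<open>Mollification\<close>

lemma locally_integrable_measurable [measurable_dest]:
  "locally_integrable g \<Longrightarrow> g \<in> borel_measurable borel"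
  by (simp add: locally_integrable_def)

lemma locally_integrable_truncate:
  fixes g :: "R4 \<Rightarrow> real"
  assumes "locally_integrable g"
  shows "integrable lborel (\<lambda>x. indicator (cball 0 R) x * g x)"
  using assms compact_cball[of "0::R4" R] by (simp add: locally_integrable_def set_integrable_def)

lemma locally_integrableI:
  fixes g :: "R4 \<Rightarrow> real"
  assumes [measurable]: "g \<in> borel_measurable borel"
    and i: "\<And>R. R > 0 \<Longrightarrow> integrable lborel (\<lambda>x. indicator (cball 0 R) x * g x)"
  shows "locally_integrable g"
  unfolding locally_integrable_def set_integrable_def
proof (intro conjI allI impI)
  fix K :: "R4 set" assume K: "compact K"
  then have [measurable]: "K \<in> sets borel" by (simp add: compact_imp_closed)
  obtain R where R: "R > 0" "K \<subseteq> cball 0 R"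
    using compact_imp_bounded[OF K] by (metis bounded_pos mem_cball_0 subsetI)
  show "integrable lborel (\<lambda>x. indicator K x *\<^sub>R g x)"
    by (rule Bochner_Integration.integrable_bound[OF i[OF R(1)]]) (use R in \<open>auto simp: indicator_def subset_iff\<close>)
qed (rule assms)

lemma locally_integrable_component:
  assumes "locally_integrable (G :: R4 \<Rightarrow> R4)"
  shows "locally_integrable (\<lambda>x. G x $ k)"
proof -
  have "integrable lborel (\<lambda>x. (indicator K x *\<^sub>R G x) $ k)" if "compact K" for K
    using assms that integrable_bounded_linear[OF bounded_linear_vec_nth]
    unfolding locally_integrable_def set_integrable_def by blast
  moreover have "(\<lambda>x. G x $ k) \<in> borel_measurable borel"
    using assms
    by (intro measurable_compose[OF _ borel_measurable_continuous_onI[of "\<lambda>v. v $ k"]])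
      (auto simp: locally_integrable_def intro!: continuous_intros)
  ultimately show ?thesis by (simp add: locally_integrable_def set_integrable_def)
qed

lemma locally_integrable_mult_bounded:
  fixes g :: "R4 \<Rightarrow> real"
  assumes g: "locally_integrable g" and [measurable]: "f \<in> borel_measurable borel"
    and f: "\<And>x. \<bar>f x\<bar> \<le> C" "\<And>x. norm x \<ge> R \<Longrightarrow> f x = 0"
  shows "integrable lborel (\<lambda>x. g x * f x)"
proof (rule Bochner_Integration.integrable_bound)
  have [measurable]: "g \<in> borel_measurable borel" using g by measurable
  show "integrable lborel (\<lambda>x. C * (indicator (cball 0 R) x * g x))"
    using locally_integrable_truncate[OF g] by simp
  show "(\<lambda>x. g x * f x) \<in> borel_measurable lborel" by measurable
  have C: "0 \<le> C" using f(1)[of 0] by linarith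
  show "AE x in lborel. norm (g x * f x) \<le> norm (C * (indicator (cball 0 R) x * g x))"
  proof (rule AE_I2)
    fix x
    show "norm (g x * f x) \<le> norm (C * (indicator (cball 0 R) x * g x))"
    proof (cases "norm x \<le> R")
      case True
      then show ?thesis using mult_left_mono[OF f(1)[of x], of "\<bar>g x\<bar>"] C by (simp add: abs_mult mult.commute)
    qed (use f(2)[of x] in simp)
  qed
qed

lemma locally_integrable_mult_test:
  fixes g :: "R4 \<Rightarrow> real"
  assumes g: "locally_integrable g" and f: "test_function f"
  shows "integrable lborel (\<lambda>x. g x * f x)"
proof -
  obtain C where "\<And>x. \<bar>f x\<bar> \<le> C" using test_function_bounded[OF f] by blast
  moreover obtain R where "\<And>x. norm x \<ge> R \<Longrightarrow> f x = 0" using test_function_support[OF f] by blast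
  ultimately show ?thesis using locally_integrable_mult_bounded[OF g test_function_measurable[OF f]] by blast
qed

text \<open>The polynomial X^2 is \<open>flat_deriv 1\<close>, so the gradient of
  \<open>bump 1\<close> at x is -2 \<open>rho x\<close> times x. This relation makes the scale
  derivative of the averages a Laplacian. The kernel is not normalised; its integral is carried
  along as a positive factor.\<close>

definition rho :: "R4 \<Rightarrow> real" where "rho = bump [:0, 0, 1:]"

lemma test_function_rho: "test_function rho"
  by (simp add: rho_def test_function_bump)

lemma rho_measurable [measurable]: "rho \<in> borel_measurable borel"
  by (rule test_function_measurable[OF test_function_rho])

lemma rho_nonneg: "0 \<le> rho x"
  by (simp add: rho_def bump_def flat_exp_def)

lemma rho_pos: "norm x < 1 \<Longrightarrow> 0 < rho x"
  using abs_square_less_1[of "norm x"] by (auto simp: rho_def bump_def flat_exp_def dot_square_norm)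

lemma rho_eq_0: "norm x \<ge> 1 \<Longrightarrow> rho x = 0"
proof -
  assume "norm x \<ge> 1"
  then have "1 \<le> x \<bullet> x" using one_le_power[of "norm x" 2] by (simp only: dot_square_norm)
  then show ?thesis by (simp add: rho_def bump_def flat_exp_def)
qed

lemma rho_integrable: "integrable lborel rho"
proof -
  have "locally_integrable (\<lambda>x::R4. 1 :: real)"
    by (intro locally_integrableI) (simp_all add: integrable_indicator_iff emeasure_lborel_cball_finite[unfolded infinity_ennreal_def])
  from locally_integrable_mult_test[OF this test_function_rho] show ?thesis by simp
qed

lemma rho_integral_pos: "0 < (\<integral>x. rho x \<partial>lborel)"
proof (rule ccontr)
  assume "\<not> ?thesis"
  moreover have "0 \<le> (\<integral>x. rho x \<partial>lborel)"
    by (intro Bochner_Integration.integral_nonneg rho_nonneg)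
  ultimately have "(\<integral>x. rho x \<partial>lborel) = 0" by linarith
  then have "AE x in lborel. rho x = 0"
    using integral_nonneg_eq_0_iff_AE[OF rho_integrable AE_I2[OF rho_nonneg]] by simp
  then have "AE x in lborel. x \<notin> ball (0::R4) 1"
    by eventually_elim (use rho_pos in force)
  then have "emeasure lborel (ball (0::R4) 1) = 0"
    by (subst (asm) AE_iff_measurable[of "ball 0 1"]) auto
  then show False using content_ball_pos[of 1 "0::R4"] by (simp add: measure_def)
qed

text \<open>The substitution z = x + s y puts all dependence on x and s into a rescaled test
  function of z. In this form the average can be tested against a hypothesis on g and differentiated
  in s although g is not smooth.\<close>

lemma mollify_eq:
  assumes [measurable]: "g \<in> borel_measurable borel" and s: "s > 0"
  shows "(\<integral>y. rho y * g (s *\<^sub>R y + x) \<partial>lborel)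
    = (1/s) ^ 4 * (\<integral>z. g z * rho (- ((1/s) *\<^sub>R x) + (1/s) *\<^sub>R z) \<partial>lborel)"
proof -
  have "(\<integral>z. g z * rho (- ((1/s) *\<^sub>R x) + (1/s) *\<^sub>R z) \<partial>lborel)
    = s ^ 4 * (\<integral>y. g (x + s *\<^sub>R y) * rho (- ((1/s) *\<^sub>R x) + (1/s) *\<^sub>R (x + s *\<^sub>R y)) \<partial>lborel)"
    using lborel_integral_scale[of "\<lambda>z. g z * rho (- ((1/s) *\<^sub>R x) + (1/s) *\<^sub>R z)" s x] s by simp
  also have "(\<lambda>y. g (x + s *\<^sub>R y) * rho (- ((1/s) *\<^sub>R x) + (1/s) *\<^sub>R (x + s *\<^sub>R y))) = (\<lambda>y. rho y * g (s *\<^sub>R y + x))"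
    using s by (auto simp: scaleR_add_right add.commute mult.commute)
  finally show ?thesis using s by (simp add: power_divide)
qed

text \<open>Since \<open>rho\<close> lives in the unit ball and the scales are at most 1, the
  averages at points of the ball of radius R see g only in the ball of radius R + 1. There g may be
  replaced by an integrable truncation.\<close>

lemma mollify_L1:
  fixes g :: "R4 \<Rightarrow> real"
  assumes g: "locally_integrable g" and s: "s \<longlonglongrightarrow> 0" "\<And>n. 0 \<le> s n" "\<And>n. s n \<le> 1"
  shows "(\<lambda>n. \<integral>x. indicator (cball 0 R) x * \<bar>(\<integral>y. rho y * g (s n *\<^sub>R y + x) \<partial>lborel) - (\<integral>y. rho y \<partial>lborel) * g x\<bar> \<partial>lborel) \<longlonglongrightarrow> 0"
    and "integrable lborel (\<lambda>x. indicator (cball 0 R) x * (\<integral>y. rho y * g (s n *\<^sub>R y + x) \<partial>lborel))"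
proof -
  define f where "f = (\<lambda>x. indicator (cball 0 (R + 1)) x * g x)"
  have f: "integrable lborel f" unfolding f_def by (rule locally_integrable_truncate[OF g])
  have [measurable]: "g \<in> borel_measurable borel" using g by measurable
  have eq: "indicator (cball 0 R) x * (\<integral>y. rho y * g (s n *\<^sub>R y + x) \<partial>lborel) = indicator (cball 0 R) x * (\<integral>y. rho y * f (s n *\<^sub>R y + x) \<partial>lborel)" for n x
  proof (cases "norm x \<le> R")
    case True
    have "rho y * g (s n *\<^sub>R y + x) = rho y * f (s n *\<^sub>R y + x)" for y
    proof (cases "norm y < 1")
      case y: True
      have "norm (s n *\<^sub>R y) \<le> 1 * 1" unfolding norm_scaleR
        using s(2,3)[of n] y by (intro mult_mono) auto
      then have "norm (s n *\<^sub>R y + x) \<le> R + 1" using True norm_triangle_ineq[of "s n *\<^sub>R y" x] by linarith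
      then show ?thesis by (simp add: f_def)
    qed (simp add: rho_eq_0)
    then show ?thesis by (simp only:)
  qed (simp add: indicator_def)
  have a: "(\<lambda>y. s n *\<^sub>R y) \<in> lborel \<rightarrow>\<^sub>M borel" for n by measurable
  note A = average_of_shifts_integrable[OF sigma_finite_lborel rho_integrable rho_nonneg a f]
  have i: "integrable lborel (\<lambda>x. indicator (cball 0 R) x * h x :: real)" if "integrable lborel h" for h :: "R4 \<Rightarrow> real"
    by (rule Bochner_Integration.integrable_bound[OF that]) (use that in \<open>auto simp: indicator_def dest: borel_measurable_integrable\<close>)
  show "integrable lborel (\<lambda>x. indicator (cball 0 R) x * (\<integral>y. rho y * g (s n *\<^sub>R y + x) \<partial>lborel))"
    unfolding eq by (rule i[OF A])
  show "(\<lambda>n. \<integral>x. indicator (cball 0 R) x * \<bar>(\<integral>y. rho y * g (s n *\<^sub>R y + x) \<partial>lborel) - (\<integral>y. rho y \<partial>lborel) * g x\<bar> \<partial>lborel) \<longlonglongrightarrow> 0"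
  proof (rule tendsto_sandwich[OF always_eventually always_eventually tendsto_const])
    show "(\<lambda>n. \<integral>x. \<bar>(\<integral>y. rho y * f (s n *\<^sub>R y + x) \<partial>lborel) - (\<integral>y. rho y \<partial>lborel) * f x\<bar> \<partial>lborel) \<longlonglongrightarrow> 0"
    proof (rule average_of_shifts_tendsto[OF sigma_finite_lborel rho_integrable rho_nonneg a f])
      fix y :: R4 show "(\<lambda>n. s n *\<^sub>R y) \<longlonglongrightarrow> 0" using tendsto_scaleR[OF s(1) tendsto_const[of y]] by simp
    qed
    show "\<forall>n. 0 \<le> (\<integral>x. indicator (cball 0 R) x * \<bar>(\<integral>y. rho y * g (s n *\<^sub>R y + x) \<partial>lborel) - (\<integral>y. rho y \<partial>lborel) * g x\<bar> \<partial>lborel)"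
      by (intro allI Bochner_Integration.integral_nonneg) simp
    show "\<forall>n. (\<integral>x. indicator (cball 0 R) x * \<bar>(\<integral>y. rho y * g (s n *\<^sub>R y + x) \<partial>lborel) - (\<integral>y. rho y \<partial>lborel) * g x\<bar> \<partial>lborel)
      \<le> (\<integral>x. \<bar>(\<integral>y. rho y * f (s n *\<^sub>R y + x) \<partial>lborel) - (\<integral>y. rho y \<partial>lborel) * f x\<bar> \<partial>lborel)"
    proof
      fix n
      have I: "integrable lborel (\<lambda>x. \<bar>(\<integral>y. rho y * f (s n *\<^sub>R y + x) \<partial>lborel) - (\<integral>y. rho y \<partial>lborel) * f x\<bar>)"
        using A[of n] f by simp
      have E: "indicator (cball 0 R) x * \<bar>(\<integral>y. rho y * g (s n *\<^sub>R y + x) \<partial>lborel) - (\<integral>y. rho y \<partial>lborel) * g x\<bar>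
        = indicator (cball 0 R) x * \<bar>(\<integral>y. rho y * f (s n *\<^sub>R y + x) \<partial>lborel) - (\<integral>y. rho y \<partial>lborel) * f x\<bar>" for x
        using eq[of x n] by (auto simp: indicator_def f_def split: if_splits)
      show "(\<integral>x. indicator (cball 0 R) x * \<bar>(\<integral>y. rho y * g (s n *\<^sub>R y + x) \<partial>lborel) - (\<integral>y. rho y \<partial>lborel) * g x\<bar> \<partial>lborel)
      \<le> (\<integral>x. \<bar>(\<integral>y. rho y * f (s n *\<^sub>R y + x) \<partial>lborel) - (\<integral>y. rho y \<partial>lborel) * f x\<bar> \<partial>lborel)"
        unfolding E by (intro Bochner_Integration.integral_mono i I) (auto simp: indicator_def)
    qed
  qed
qed

section \<open>The fundamental lemma of the calculus of variations, and differentiation under the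
  integral\<close>

lemma AE_all_cballI:
  assumes "\<And>n::nat. AE x::R4 in lborel. norm x \<le> real n \<longrightarrow> P x"
  shows "AE x in lborel. P x"
proof -
  have "AE x::R4 in lborel. \<forall>n::nat. norm x \<le> real n \<longrightarrow> P x"
    unfolding AE_all_countable using assms by blast
  then show ?thesis by eventually_elim (metis real_arch_simple)
qed

text \<open>By \<open>mollify_eq\<close> every average of g against \<open>rho\<close> is an
  integral of g against a test function, hence 0. These averages converge in L1 on balls to a
  positive multiple of g.\<close>

lemma AE_zero_test_functions:
  fixes g :: "R4 \<Rightarrow> real"
  assumes g: "locally_integrable g" and 0: "\<And>f. test_function f \<Longrightarrow> (\<integral>x. g x * f x \<partial>lborel) = 0"
  shows "AE x in lborel. g x = 0"
proof (rule AE_all_cballI)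
  fix R :: nat
  have [measurable]: "g \<in> borel_measurable borel" using g by measurable
  \<comment> \<open>The shift by one keeps the scales positive, as \<open>mollify_eq\<close>
    requires, and at most 1, as \<open>mollify_L1\<close> requires.\<close>
  let ?s = "\<lambda>n::nat. 1 / real (Suc n)"
  have "(\<integral>y. rho y * g (?s n *\<^sub>R y + x) \<partial>lborel) = 0" for n x
  proof -
    have s: "?s n > 0" by simp
    have "test_function (\<lambda>z. rho (- ((1 / ?s n) *\<^sub>R x) + (1 / ?s n) *\<^sub>R z))"
      by (rule test_function_affine[OF test_function_rho]) simp
    then show ?thesis by (simp only: mollify_eq[OF \<open>g \<in> borel_measurable borel\<close> s] 0 mult_zero_right)
  qed
  then have "(\<lambda>n::nat. \<integral>x. indicator (cball 0 R) x * \<bar>0 - (\<integral>y. rho y \<partial>lborel) * g x\<bar> \<partial>lborel) \<longlonglongrightarrow> 0"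
    using mollify_L1(1)[OF g LIMSEQ_Suc[OF lim_1_over_n], of R] by simp
  then have "(\<integral>x. indicator (cball 0 R) x * \<bar>0 - (\<integral>y. rho y \<partial>lborel) * g x\<bar> \<partial>lborel) = 0"
    using LIMSEQ_const_iff by blast
  moreover have "integrable lborel (\<lambda>x. indicator (cball 0 R) x * \<bar>0 - (\<integral>y. rho y \<partial>lborel) * g x\<bar>)"
  proof -
    have "integrable lborel (\<lambda>x. \<bar>(\<integral>y. rho y \<partial>lborel) * (indicator (cball 0 R) x * g x)\<bar>)"
      using locally_integrable_truncate[OF g] by (intro Bochner_Integration.integrable_abs integrable_mult_right)
    then show ?thesis
      by (rule Bochner_Integration.integrable_cong[THEN iffD1, rotated -1]) (auto simp: indicator_def)
  qed
  ultimately have "AE x in lborel. indicator (cball 0 R) x * \<bar>0 - (\<integral>y. rho y \<partial>lborel) * g x\<bar> = 0"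
    by (subst (asm) integral_nonneg_eq_0_iff_AE) auto
  then show "AE x in lborel. norm x \<le> real R \<longrightarrow> g x = 0"
    by eventually_elim (use rho_integral_pos in \<open>auto simp: indicator_def split: if_splits\<close>)
qed

text \<open>The mean value theorem bounds the difference quotients of the kernel by C, so C |V| on
  the common support is a majorant. Parameters range over an interval because the mollifying kernels
  make sense only at positive scales and are bounded only away from scale 0.\<close>

lemma has_derivative_integral_parameter:
  fixes V :: "R4 \<Rightarrow> real"
  assumes V: "locally_integrable V" and t: "a < t" "t < b"
    and k: "\<And>u z. a < u \<Longrightarrow> u < b \<Longrightarrow> ((\<lambda>u. k u z) has_real_derivative k' u z) (at u)"
    and k'C: "\<And>u z. a < u \<Longrightarrow> u < b \<Longrightarrow> \<bar>k' u z\<bar> \<le> C"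
    and kC: "\<And>u z. a < u \<Longrightarrow> u < b \<Longrightarrow> \<bar>k u z\<bar> \<le> C'"
    and k0: "\<And>u z. a < u \<Longrightarrow> u < b \<Longrightarrow> norm z \<ge> R \<Longrightarrow> k u z = 0"
    and km: "\<And>u. a < u \<Longrightarrow> u < b \<Longrightarrow> k u \<in> borel_measurable borel"
    and k'm: "k' t \<in> borel_measurable borel"
  shows "((\<lambda>u. \<integral>z. V z * k u z \<partial>lborel) has_real_derivative (\<integral>z. V z * k' t z \<partial>lborel)) (at t)"
proof -
  have [measurable]: "V \<in> borel_measurable borel" using V by measurable
  have ab: "at t within {a<..<b} = at t" using t by (intro at_within_open) auto
  have int: "integrable lborel (\<lambda>z. V z * k u z)" if "a < u" "u < b" for u
    using locally_integrable_mult_bounded[OF V km[OF that] kC[OF that] k0[OF that]] by blast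
  have mvt: "\<bar>k u z - k t z\<bar> \<le> C * \<bar>u - t\<bar>" if "a < u" "u < b" for u z
    using field_differentiable_bound[of "{a<..<b}" "\<lambda>u. k u z" "\<lambda>u. k' u z" C u t] that t k k'C
    by (auto intro: has_field_derivative_at_within)
  have "((\<lambda>u. ((\<integral>z. V z * k u z \<partial>lborel) - (\<integral>z. V z * k t z \<partial>lborel)) / (u - t)) \<longlongrightarrow> (\<integral>z. V z * k' t z \<partial>lborel)) (at t within {a<..<b})"
    unfolding tendsto_at_iff_sequentially o_def
  proof (intro allI impI)
    fix X assume X: "\<forall>i. X i \<in> {a<..<b} - {t}" "X \<longlonglongrightarrow> t"
    then have Xab: "a < X i" "X i < b" "X i \<noteq> t" for i by auto
    have "(\<lambda>i. \<integral>z. V z * ((k (X i) z - k t z) / (X i - t)) \<partial>lborel) \<longlonglongrightarrow> (\<integral>z. V z * k' t z \<partial>lborel)"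
    proof (rule integral_dominated_convergence[where w="\<lambda>z. C * \<bar>indicator (cball 0 R) z * V z\<bar>"])
      show "(\<lambda>z. V z * k' t z) \<in> borel_measurable lborel" using k'm by measurable
      show "(\<lambda>z. V z * ((k (X i) z - k t z) / (X i - t))) \<in> borel_measurable lborel" for i
        using km[OF Xab(1,2)] km[OF t] by measurable
      show "integrable lborel (\<lambda>z. C * \<bar>indicator (cball 0 R) z * V z\<bar>)"
        using locally_integrable_truncate[OF V] by (intro Bochner_Integration.integrable_abs integrable_mult_right)
      show "AE z in lborel. (\<lambda>i. V z * ((k (X i) z - k t z) / (X i - t))) \<longlonglongrightarrow> V z * k' t z"
      proof (rule AE_I2)
        fix z
        have "((\<lambda>u. (k u z - k t z) / (u - t)) \<longlongrightarrow> k' t z) (at t)"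
          using k[OF t, of z] by (simp add: has_field_derivative_iff)
        then have "(\<lambda>i. (k (X i) z - k t z) / (X i - t)) \<longlonglongrightarrow> k' t z"
          using X Xab unfolding tendsto_at_iff_sequentially o_def by auto
        then show "(\<lambda>i. V z * ((k (X i) z - k t z) / (X i - t))) \<longlonglongrightarrow> V z * k' t z"
          by (rule tendsto_mult_left)
      qed
      show "AE z in lborel. norm (V z * ((k (X i) z - k t z) / (X i - t))) \<le> C * \<bar>indicator (cball 0 R) z * V z\<bar>" for i
      proof (rule AE_I2)
        fix z
        have C: "\<bar>(k (X i) z - k t z) / (X i - t)\<bar> \<le> C"
          using mvt[OF Xab(1,2)[of i], of z] Xab(3)[of i] by (simp add: abs_divide divide_le_eq)
        show "norm (V z * ((k (X i) z - k t z) / (X i - t))) \<le> C * \<bar>indicator (cball 0 R) z * V z\<bar>"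
        proof (cases "norm z \<le> R")
          case True
          then show ?thesis using mult_left_mono[OF C, of "\<bar>V z\<bar>"] by (simp add: abs_mult mult.commute)
        qed (use k0[OF Xab(1,2)[of i], of z] k0[OF t, of z] in \<open>simp add: indicator_def\<close>)
      qed
    qed
    also have "(\<lambda>i. \<integral>z. V z * ((k (X i) z - k t z) / (X i - t)) \<partial>lborel)
      = (\<lambda>i. ((\<integral>z. V z * k (X i) z \<partial>lborel) - (\<integral>z. V z * k t z \<partial>lborel)) / (X i - t))"
    proof
      fix i
      have "(\<integral>z. V z * ((k (X i) z - k t z) / (X i - t)) \<partial>lborel) = (\<integral>z. (V z * k (X i) z - V z * k t z) / (X i - t) \<partial>lborel)"
        by (simp add: right_diff_distrib)
      also have "\<dots> = ((\<integral>z. V z * k (X i) z \<partial>lborel) - (\<integral>z. V z * k t z \<partial>lborel)) / (X i - t)"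
        using int[OF Xab(1,2)[of i]] int[OF t] by (subst integral_divide_zero) simp
      finally show "(\<integral>z. V z * ((k (X i) z - k t z) / (X i - t)) \<partial>lborel)
        = ((\<integral>z. V z * k (X i) z \<partial>lborel) - (\<integral>z. V z * k t z \<partial>lborel)) / (X i - t)" .
    qed
    finally show "(\<lambda>i. ((\<integral>z. V z * k (X i) z \<partial>lborel) - (\<integral>z. V z * k t z \<partial>lborel)) / (X i - t)) \<longlonglongrightarrow> (\<integral>z. V z * k' t z \<partial>lborel)" .
  qed
  then show ?thesis unfolding has_field_derivative_iff ab .
qed


section \<open>Weak gradients\<close>

lemma locally_integrable_integrable:
  "locally_integrable g \<Longrightarrow> compact K \<Longrightarrow> integrable lborel (\<lambda>x. indicator K x *\<^sub>R g x)"
  by (simp add: locally_integrable_def set_integrable_def)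

lemma locally_integrable_add:
  assumes "locally_integrable f" "locally_integrable g"
  shows "locally_integrable (\<lambda>x. f x + g x)"
  using assms unfolding locally_integrable_def set_integrable_def
  by (auto simp: scaleR_right_distrib)

lemma locally_integrable_scaleR:
  assumes "locally_integrable f"
  shows "locally_integrable (\<lambda>x. (c::real) *\<^sub>R f x)"
  unfolding locally_integrable_def set_integrable_def
proof (intro conjI allI impI)
  show "(\<lambda>x. c *\<^sub>R f x) \<in> borel_measurable borel" using assms by (auto simp: locally_integrable_def)
  fix K :: "R4 set" assume "compact K"
  then have "integrable lborel (\<lambda>x. c *\<^sub>R (indicator K x *\<^sub>R f x))"
    by (intro integrable_scaleR_right locally_integrable_integrable assms)
  then show "integrable lborel (\<lambda>x. indicator K x *\<^sub>R c *\<^sub>R f x)" by (simp only: scaleR_left_commute)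
qed

lemma locally_integrable_shift:
  assumes f: "locally_integrable f"
  shows "locally_integrable (\<lambda>x. f (a + x))"
  unfolding locally_integrable_def set_integrable_def
proof (intro conjI allI impI)
  have [measurable]: "f \<in> borel_measurable borel" using f by measurable
  show "(\<lambda>x. f (a + x)) \<in> borel_measurable borel" by measurable
  fix K :: "R4 set" assume "compact K"
  then have "integrable lborel (\<lambda>x. indicator ((+) a ` K) x *\<^sub>R f x)"
    by (intro locally_integrable_integrable f compact_translation)
  from lborel_integrable_shift[OF this, of a]
  show "integrable lborel (\<lambda>x. indicator K x *\<^sub>R f (a + x))"
    by (rule Bochner_Integration.integrable_cong[THEN iffD1, rotated -1]) (auto simp: indicator_def)
qed

lemma locally_integrable_continuous:
  fixes f :: "R4 \<Rightarrow> 'b::{banach, second_countable_topology}"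
  assumes "continuous_on UNIV f"
  shows "locally_integrable f"
  unfolding locally_integrable_def
proof (intro conjI allI impI)
  show "f \<in> borel_measurable borel" by (rule borel_measurable_continuous_onI[OF assms])
  fix K :: "R4 set" assume "compact K"
  then show "set_integrable lborel K f"
    unfolding set_integrable_def
    by (rule borel_integrable_compact) (rule continuous_on_subset[OF assms], simp)
qed

lemma is_weak_gradientD:
  assumes "is_weak_gradient u G"
  shows "locally_integrable u" "locally_integrable G" "locally_integrable (\<lambda>x. G x $ k)"
    and "test_function f \<Longrightarrow> (\<integral>x. u x * pderiv_at k f x \<partial>lborel) = - (\<integral>x. G x $ k * f x \<partial>lborel)"
  using assms locally_integrable_component[of G] by (auto simp: is_weak_gradient_def)

lemma is_weak_gradient_unique:
  assumes "is_weak_gradient u G" "is_weak_gradient u H"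
  shows "AE x in lborel. G x = H x"
proof -
  note G = is_weak_gradientD[OF assms(1)] and H = is_weak_gradientD[OF assms(2)]
  have "AE x in lborel. G x $ k + (-1) *\<^sub>R (H x $ k) = 0" for k
  proof (rule AE_zero_test_functions)
    show "locally_integrable (\<lambda>x. G x $ k + (-1) *\<^sub>R (H x $ k))"
      by (intro locally_integrable_add locally_integrable_scaleR G(3) H(3))
    fix f assume f: "test_function f"
    have "(\<integral>x. (G x $ k + (-1) *\<^sub>R (H x $ k)) * f x \<partial>lborel) = (\<integral>x. G x $ k * f x - H x $ k * f x \<partial>lborel)"
      by (simp add: left_diff_distrib)
    also have "\<dots> = (\<integral>x. G x $ k * f x \<partial>lborel) - (\<integral>x. H x $ k * f x \<partial>lborel)"
      by (intro Bochner_Integration.integral_diff locally_integrable_mult_test G(3) H(3) f)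
    also have "\<dots> = 0" using G(4)[OF f, of k] H(4)[OF f, of k] by simp
    finally show "(\<integral>x. (G x $ k + (-1) *\<^sub>R (H x $ k)) * f x \<partial>lborel) = 0" .
  qed
  then have "AE x in lborel. \<forall>k. G x $ k + (-1) *\<^sub>R (H x $ k) = 0"
    by (simp add: AE_all_countable)
  then show ?thesis by eventually_elim (simp add: vec_eq_iff)
qed

text \<open>This removes the choice made in \<open>weak_grad\<close>: two weak gradients agree a.e.,
  so any of them computes the integral.\<close>

lemma dirichlet_eq:
  assumes "is_weak_gradient u G"
  shows "dirichlet u = (\<integral>x. (norm (G x))\<^sup>2 \<partial>lborel)"
proof -
  have w: "is_weak_gradient u (weak_grad u)"
    unfolding weak_grad_def by (rule someI[of "is_weak_gradient u", OF assms])
  have [measurable]: "G \<in> borel_measurable borel" "weak_grad u \<in> borel_measurable borel"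
    using is_weak_gradientD(2)[OF assms] is_weak_gradientD(2)[OF w] by (auto simp: locally_integrable_def)
  have "AE x in lborel. (norm (weak_grad u x))\<^sup>2 = (norm (G x))\<^sup>2"
    using is_weak_gradient_unique[OF w assms] by eventually_elim simp
  then show ?thesis unfolding dirichlet_def by (intro integral_cong_AE) auto
qed

lemma dirichlet_nonneg: "0 \<le> dirichlet u"
  unfolding dirichlet_def by (intro Bochner_Integration.integral_nonneg) simp

lemma is_weak_gradient_cmult:
  assumes "is_weak_gradient u G"
  shows "is_weak_gradient (\<lambda>x. c * u x) (\<lambda>x. c *\<^sub>R G x)"
  unfolding is_weak_gradient_def
proof (intro conjI allI impI)
  note G = is_weak_gradientD[OF assms]
  show "locally_integrable (\<lambda>x. c * u x)" using locally_integrable_scaleR[OF G(1), of c] by simp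
  show "locally_integrable (\<lambda>x. c *\<^sub>R G x)" by (intro locally_integrable_scaleR G)
  fix f k assume f: "test_function f"
  have "(\<integral>x. c * u x * pderiv_at k f x \<partial>lborel) = c * (\<integral>x. u x * pderiv_at k f x \<partial>lborel)"
    by (simp add: mult.assoc)
  also have "\<dots> = - (c * (\<integral>x. G x $ k * f x \<partial>lborel))" using G(4)[OF f, of k] by simp
  also have "\<dots> = - (\<integral>x. (c *\<^sub>R G x) $ k * f x \<partial>lborel)" by (simp add: mult.assoc)
  finally show "(\<integral>x. c * u x * pderiv_at k f x \<partial>lborel) = - (\<integral>x. (c *\<^sub>R G x) $ k * f x \<partial>lborel)" .
qed

lemma is_weak_gradient_add:
  assumes "is_weak_gradient u G" "is_weak_gradient v H"
  shows "is_weak_gradient (\<lambda>x. u x + v x) (\<lambda>x. G x + H x)"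
  unfolding is_weak_gradient_def
proof (intro conjI allI impI)
  note G = is_weak_gradientD[OF assms(1)] and H = is_weak_gradientD[OF assms(2)]
  show "locally_integrable (\<lambda>x. u x + v x)" "locally_integrable (\<lambda>x. G x + H x)"
    by (intro locally_integrable_add G H)+
  fix f k assume f: "test_function f"
  note p = test_function_pderiv[OF f, of k]
  have "(\<integral>x. (u x + v x) * pderiv_at k f x \<partial>lborel) = (\<integral>x. u x * pderiv_at k f x \<partial>lborel) + (\<integral>x. v x * pderiv_at k f x \<partial>lborel)"
    unfolding distrib_right
    by (intro Bochner_Integration.integral_add locally_integrable_mult_test G(1) H(1) p)
  also have "\<dots> = - ((\<integral>x. G x $ k * f x \<partial>lborel) + (\<integral>x. H x $ k * f x \<partial>lborel))"
    using G(4)[OF f, of k] H(4)[OF f, of k] by simp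
  also have "(\<integral>x. G x $ k * f x \<partial>lborel) + (\<integral>x. H x $ k * f x \<partial>lborel) = (\<integral>x. (G x + H x) $ k * f x \<partial>lborel)"
    unfolding vector_add_component distrib_right
    by (intro Bochner_Integration.integral_add[symmetric] locally_integrable_mult_test G(3) H(3) f)
  finally show "(\<integral>x. (u x + v x) * pderiv_at k f x \<partial>lborel) = - (\<integral>x. (G x + H x) $ k * f x \<partial>lborel)" .
qed

lemma test_function_shift: "test_function f \<Longrightarrow> test_function (\<lambda>x. f (a + x))"
  using test_function_affine[of f 1 a] by simp

lemma pderiv_at_shift: "test_function f \<Longrightarrow> pderiv_at k (\<lambda>x. f (a + x)) x = pderiv_at k f (a + x)"
  using pderiv_at_affine[of f k a 1 x] test_function_differentiable[of f] by simp

lemma integral_shift_test: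
  fixes g :: "R4 \<Rightarrow> real"
  assumes [measurable]: "g \<in> borel_measurable borel" "f \<in> borel_measurable borel"
  shows "(\<integral>x. g (a + x) * f x \<partial>lborel) = (\<integral>x. g x * f (- a + x) \<partial>lborel)"
  using lborel_integral_shift[of "\<lambda>x. g x * f (- a + x)" a] by simp

lemma is_weak_gradient_shift:
  assumes "is_weak_gradient u G"
  shows "is_weak_gradient (\<lambda>x. u (a + x)) (\<lambda>x. G (a + x))"
  unfolding is_weak_gradient_def
proof (intro conjI allI impI)
  note G = is_weak_gradientD[OF assms]
  show "locally_integrable (\<lambda>x. u (a + x))" "locally_integrable (\<lambda>x. G (a + x))"
    by (intro locally_integrable_shift G)+
  fix f k assume f: "test_function f"
  have "(\<integral>x. u (a + x) * pderiv_at k f x \<partial>lborel) = (\<integral>x. u x * pderiv_at k f (- a + x) \<partial>lborel)"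
    by (intro integral_shift_test locally_integrable_measurable G test_function_measurable test_function_pderiv f)
  also have "\<dots> = (\<integral>x. u x * pderiv_at k (\<lambda>x. f (- a + x)) x \<partial>lborel)"
    by (simp only: pderiv_at_shift[OF f])
  also have "\<dots> = - (\<integral>x. G x $ k * f (- a + x) \<partial>lborel)"
    by (rule G(4)[OF test_function_shift[OF f]])
  also have "(\<integral>x. G x $ k * f (- a + x) \<partial>lborel) = (\<integral>x. G (a + x) $ k * f x \<partial>lborel)"
    using integral_shift_test[OF locally_integrable_measurable[OF G(3)[of k]] test_function_measurable[OF f], of a] by simp
  finally show "(\<integral>x. u (a + x) * pderiv_at k f x \<partial>lborel) = - (\<integral>x. G (a + x) $ k * f x \<partial>lborel)" .
qed

section \<open>Derivatives along translations and integration by parts\<close>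

lemma test_function_line_derivative:
  assumes f: "test_function f"
  shows "((\<lambda>t. f (z - t *\<^sub>R axis k 1)) has_real_derivative - pderiv_at k f (z - t *\<^sub>R axis k 1)) (at t)"
proof -
  let ?D = "frechet_derivative f (at (z - t *\<^sub>R axis k 1))"
  have D: "(f has_derivative ?D) (at (z - t *\<^sub>R axis k 1))"
    using test_function_differentiable[OF f] by (simp add: frechet_derivative_works)
  have "((\<lambda>t. z - t *\<^sub>R axis k 1) has_derivative (\<lambda>h. - (h *\<^sub>R axis k 1))) (at t)"
    by (auto intro!: derivative_eq_intros)
  from has_derivative_compose[OF this D]
  have "((\<lambda>t. f (z - t *\<^sub>R axis k 1)) has_derivative (\<lambda>h. ?D (- (h *\<^sub>R axis k 1)))) (at t)" .
  moreover have "?D (- (h *\<^sub>R axis k 1)) = - pderiv_at k f (z - t *\<^sub>R axis k 1) * h" for h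
    using has_derivative_linear[OF D] by (simp add: linear_neg linear_cmul pderiv_at_def)
  moreover have "(\<lambda>h. - pderiv_at k f (z - t *\<^sub>R axis k 1) * h) = (*) (- pderiv_at k f (z - t *\<^sub>R axis k 1))"
    by (rule refl)
  ultimately show ?thesis unfolding has_field_derivative_def by (simp only:)
qed

text \<open>The translation sits on the smooth factor, so V may be any locally integrable function;
  \<open>integral_shift_test\<close> converts the result into a statement about increments of
  V.\<close>

lemma shift_derivative:
  fixes V :: "R4 \<Rightarrow> real"
  assumes V: "locally_integrable V" and f: "test_function f"
  shows "((\<lambda>t. \<integral>z. V z * f (z - t *\<^sub>R axis k 1) \<partial>lborel) has_real_derivative
    - (\<integral>z. V z * pderiv_at k f (z - t *\<^sub>R axis k 1) \<partial>lborel)) (at t)"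
proof -
  obtain C where C: "\<And>x. \<bar>f x\<bar> \<le> C" using test_function_bounded[OF f] by blast
  obtain C' where C': "\<And>x. \<bar>pderiv_at k f x\<bar> \<le> C'"
    using test_function_bounded[OF test_function_pderiv[OF f]] by blast
  obtain R where R: "R > 0" "\<And>x. norm x \<ge> R \<Longrightarrow> f x = 0" using test_function_support[OF f] by blast
  have [measurable]: "f \<in> borel_measurable borel" "pderiv_at k f \<in> borel_measurable borel"
    using f by (auto intro: test_function_measurable test_function_pderiv)
  have "((\<lambda>t. \<integral>z. V z * f (z - t *\<^sub>R axis k 1) \<partial>lborel) has_real_derivative
    (\<integral>z. V z * (- pderiv_at k f (z - t *\<^sub>R axis k 1)) \<partial>lborel)) (at t)"
  proof (rule has_derivative_integral_parameter[OF V, where a="t - 1" and b="t + 1" and C=C' and C'=C and R="R + \<bar>t\<bar> + 1"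
      and k = "\<lambda>t z. f (z - t *\<^sub>R axis k 1)" and k' = "\<lambda>t z. - pderiv_at k f (z - t *\<^sub>R axis k 1)"])
    fix u and z :: R4 assume u: "t - 1 < u" "u < t + 1" and z: "norm z \<ge> R + \<bar>t\<bar> + 1"
    have "norm z \<le> norm (z - u *\<^sub>R axis k 1) + norm (u *\<^sub>R (axis k 1 :: R4))"
      by (metis diff_add_cancel norm_triangle_ineq)
    also have "norm (u *\<^sub>R (axis k 1 :: R4)) = \<bar>u\<bar>" by (simp add: norm_axis_1)
    finally have "norm (z - u *\<^sub>R axis k 1) \<ge> R" using u z by linarith
    then show "f (z - u *\<^sub>R axis k 1) = 0" by (rule R)
  qed (use C C' test_function_line_derivative[OF f] in auto)
  then show ?thesis by simp
qed

text \<open>The case V = 1 of \<open>shift_derivative\<close>: the integral of a translate does not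
  depend on the translation, so its derivative is 0. With the product rule this is integration by
  parts.\<close>

lemma integral_pderiv_test:
  assumes f: "test_function f"
  shows "(\<integral>x. pderiv_at k f x \<partial>lborel) = 0"
proof -
  have 1: "locally_integrable (\<lambda>x::R4. 1::real)" by (intro locally_integrable_continuous continuous_intros)
  have "(\<integral>z. f (z - t *\<^sub>R axis k 1) \<partial>lborel) = (\<integral>z. f z \<partial>lborel)" for t
    using lborel_integral_shift[OF test_function_measurable[OF f], of "- t *\<^sub>R axis k 1"] by simp
  then have "((\<lambda>t::real. \<integral>z. f z \<partial>lborel) has_real_derivative - (\<integral>z. pderiv_at k f z \<partial>lborel)) (at 0)"
    using shift_derivative[OF 1 f, of k 0] by simp
  then have "- (\<integral>z. pderiv_at k f z \<partial>lborel) = 0"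
    using DERIV_unique DERIV_const by blast
  then show ?thesis by simp
qed

lemma test_function_mult:
  assumes f: "test_function f" and g: "test_function g"
  shows "test_function (\<lambda>x. f x * g x)"
proof -
  obtain R where R: "R > 0" "\<And>x. norm x \<ge> R \<Longrightarrow> f x = 0" using test_function_support[OF f] by blast
  show ?thesis
    by (rule test_functionI[where R=R, OF C_k_mult[OF test_function_C_k[OF f] test_function_C_k[OF g]]]) (simp add: R)
qed

lemma pderiv_at_mult:
  assumes f: "test_function f" and g: "test_function g"
  shows "pderiv_at k (\<lambda>x. f x * g x) x = f x * pderiv_at k g x + pderiv_at k f x * g x"
proof -
  have "(f has_derivative frechet_derivative f (at x)) (at x)" "(g has_derivative frechet_derivative g (at x)) (at x)"
    using f g by (auto simp: frechet_derivative_works[symmetric] test_function_differentiable)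
  from pderiv_at_eqI[OF has_derivative_mult[OF this]] show ?thesis by (simp add: pderiv_at_def)
qed

lemma is_weak_gradient_test:
  assumes p: "test_function p"
  shows "is_weak_gradient p (\<lambda>x. \<chi> k. pderiv_at k p x)"
  unfolding is_weak_gradient_def
proof (intro conjI allI impI)
  show "locally_integrable p" by (intro locally_integrable_continuous test_function_continuous p)
  show "locally_integrable (\<lambda>x. \<chi> k. pderiv_at k p x)"
    by (intro locally_integrable_continuous continuous_on_vec_lambda test_function_continuous test_function_pderiv p)
  fix f k assume f: "test_function f"
  have i: "integrable lborel (\<lambda>x. p x * pderiv_at k f x)" "integrable lborel (\<lambda>x. pderiv_at k p x * f x)"
    by (intro locally_integrable_mult_test locally_integrable_continuous test_function_continuous test_function_pderiv f p)+
  have "(\<integral>x. p x * pderiv_at k f x \<partial>lborel) + (\<integral>x. pderiv_at k p x * f x \<partial>lborel) = (\<integral>x. pderiv_at k (\<lambda>x. p x * f x) x \<partial>lborel)"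
    unfolding pderiv_at_mult[OF p f] using i by (rule Bochner_Integration.integral_add[symmetric])
  also have "\<dots> = 0" by (rule integral_pderiv_test[OF test_function_mult[OF p f]])
  finally show "(\<integral>x. p x * pderiv_at k f x \<partial>lborel) = - (\<integral>x. (\<chi> k. pderiv_at k p x) $ k * f x \<partial>lborel)" by simp
qed

section \<open>Closure properties of \<open>D12\<close>\<close>

lemma D12I:
  "u \<in> borel_measurable borel \<Longrightarrow> integrable lborel (\<lambda>x. u x ^ 4) \<Longrightarrow> is_weak_gradient u G \<Longrightarrow>
    integrable lborel (\<lambda>x. (norm (G x))\<^sup>2) \<Longrightarrow> u \<in> D12"
  by (auto simp: D12_def)

lemma D12E:
  assumes "u \<in> D12"
  obtains G where "u \<in> borel_measurable borel" "integrable lborel (\<lambda>x. u x ^ 4)" "is_weak_gradient u G"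
    "integrable lborel (\<lambda>x. (norm (G x))\<^sup>2)" "dirichlet u = (\<integral>x. (norm (G x))\<^sup>2 \<partial>lborel)"
  using assms dirichlet_eq by (auto simp: D12_def)

lemma D12_cmult:
  assumes "u \<in> D12"
  shows D12_cmult_mem: "(\<lambda>x. c * u x) \<in> D12" and dirichlet_cmult: "dirichlet (\<lambda>x. c * u x) = c\<^sup>2 * dirichlet u"
proof -
  obtain G where G: "u \<in> borel_measurable borel" "integrable lborel (\<lambda>x. u x ^ 4)" "is_weak_gradient u G"
    "integrable lborel (\<lambda>x. (norm (G x))\<^sup>2)" "dirichlet u = (\<integral>x. (norm (G x))\<^sup>2 \<partial>lborel)" using D12E[OF assms] .
  show "(\<lambda>x. c * u x) \<in> D12"
    by (rule D12I[OF _ _ is_weak_gradient_cmult[OF G(3)]]) (use G in \<open>auto simp: power_mult_distrib\<close>)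
  show "dirichlet (\<lambda>x. c * u x) = c\<^sup>2 * dirichlet u"
    unfolding dirichlet_eq[OF is_weak_gradient_cmult[OF G(3)]] G(5) by (simp add: power_mult_distrib)
qed

lemma D12_shift:
  assumes "u \<in> D12"
  shows D12_shift_mem: "(\<lambda>x. u (a + x)) \<in> D12" and dirichlet_shift: "dirichlet (\<lambda>x. u (a + x)) = dirichlet u"
proof -
  obtain G where G: "u \<in> borel_measurable borel" "integrable lborel (\<lambda>x. u x ^ 4)" "is_weak_gradient u G"
    "integrable lborel (\<lambda>x. (norm (G x))\<^sup>2)" "dirichlet u = (\<integral>x. (norm (G x))\<^sup>2 \<partial>lborel)" using D12E[OF assms] .
  note [measurable] = G(1)
  show "(\<lambda>x. u (a + x)) \<in> D12"
    by (rule D12I[OF _ _ is_weak_gradient_shift[OF G(3)]])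
      (use lborel_integrable_shift[OF G(2), of a] lborel_integrable_shift[OF G(4), of a] in auto)
  show "dirichlet (\<lambda>x. u (a + x)) = dirichlet u"
    unfolding dirichlet_eq[OF is_weak_gradient_shift[OF G(3)]] G(5)
    by (rule lborel_integral_shift[of "\<lambda>x. (norm (G x))\<^sup>2" a]) (use G(4) in \<open>auto dest: borel_measurable_integrable\<close>)
qed

lemma power4_add_le: "(a + b :: real) ^ 4 \<le> 8 * (a ^ 4 + b ^ 4)"
proof -
  have "(a + b)\<^sup>2 \<le> 2 * (a\<^sup>2 + b\<^sup>2)" using sum_squares_bound[of a b] by (simp add: power2_sum)
  then have "((a + b)\<^sup>2)\<^sup>2 \<le> (2 * (a\<^sup>2 + b\<^sup>2))\<^sup>2" by (intro power_mono) auto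
  also have "\<dots> \<le> 4 * (2 * ((a\<^sup>2)\<^sup>2 + (b\<^sup>2)\<^sup>2))"
    using sum_squares_bound[of "a\<^sup>2" "b\<^sup>2"] by (simp add: power_mult_distrib power2_sum)
  finally show ?thesis by (simp add: power_mult[symmetric])
qed

lemma D12_add_mem:
  assumes "u \<in> D12" "v \<in> D12"
  shows "(\<lambda>x. u x + v x) \<in> D12"
proof -
  obtain G where G: "u \<in> borel_measurable borel" "integrable lborel (\<lambda>x. u x ^ 4)" "is_weak_gradient u G"
    "integrable lborel (\<lambda>x. (norm (G x))\<^sup>2)" using D12E[OF assms(1)] .
  obtain H where H: "v \<in> borel_measurable borel" "integrable lborel (\<lambda>x. v x ^ 4)" "is_weak_gradient v H"
    "integrable lborel (\<lambda>x. (norm (H x))\<^sup>2)" using D12E[OF assms(2)] .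
  note [measurable] = G(1) H(1)
  have [measurable]: "G \<in> borel_measurable borel" "H \<in> borel_measurable borel"
    using is_weak_gradientD(2)[OF G(3)] is_weak_gradientD(2)[OF H(3)] by (auto simp: locally_integrable_def)
  show ?thesis
  proof (rule D12I[OF _ _ is_weak_gradient_add[OF G(3) H(3)]])
    show "integrable lborel (\<lambda>x. (u x + v x) ^ 4)"
    proof (rule Bochner_Integration.integrable_bound)
      show "integrable lborel (\<lambda>x. 8 * (u x ^ 4 + v x ^ 4))" using G(2) H(2) by simp
      show "AE x in lborel. norm ((u x + v x) ^ 4) \<le> norm (8 * (u x ^ 4 + v x ^ 4))"
      proof (rule AE_I2)
        fix x
        have "0 \<le> (u x + v x) ^ 4" "0 \<le> u x ^ 4" "0 \<le> v x ^ 4" by auto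
        then show "norm ((u x + v x) ^ 4) \<le> norm (8 * (u x ^ 4 + v x ^ 4))"
          using power4_add_le[of "u x" "v x"] by simp
      qed
    qed simp
    show "integrable lborel (\<lambda>x. (norm (G x + H x))\<^sup>2)"
    proof (rule Bochner_Integration.integrable_bound)
      show "integrable lborel (\<lambda>x. 2 * ((norm (G x))\<^sup>2 + (norm (H x))\<^sup>2))" using G(4) H(4) by simp
      show "AE x in lborel. norm ((norm (G x + H x))\<^sup>2) \<le> norm (2 * ((norm (G x))\<^sup>2 + (norm (H x))\<^sup>2))"
      proof (rule AE_I2)
        fix x
        have "(norm (G x + H x))\<^sup>2 \<le> (norm (G x) + norm (H x))\<^sup>2" by (intro power_mono norm_triangle_ineq) simp
        also have "\<dots> \<le> 2 * ((norm (G x))\<^sup>2 + (norm (H x))\<^sup>2)"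
          using sum_squares_bound[of "norm (G x)" "norm (H x)"] by (simp add: power2_sum)
        finally show "norm ((norm (G x + H x))\<^sup>2) \<le> norm (2 * ((norm (G x))\<^sup>2 + (norm (H x))\<^sup>2))" by simp
      qed
    qed measurable
  qed measurable
qed

lemma D12_test:
  assumes p: "test_function p"
  shows "p \<in> D12"
proof -
  have i: "integrable lborel f" if "test_function f" for f
    using locally_integrable_mult_test[OF locally_integrable_continuous[of "\<lambda>x. 1"] that] by simp
  show ?thesis
  proof (rule D12I[OF _ _ is_weak_gradient_test[OF p]])
    show "integrable lborel (\<lambda>x. p x ^ 4)"
      using i[OF test_function_mult[OF test_function_mult[OF p p] test_function_mult[OF p p]]]
      by (simp add: power4_eq_xxxx mult.assoc)
    have "integrable lborel (\<lambda>x. \<Sum>k\<in>UNIV. pderiv_at k p x * pderiv_at k p x)"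
      by (intro Bochner_Integration.integrable_sum i test_function_mult test_function_pderiv p)
    then show "integrable lborel (\<lambda>x. (norm (\<chi> k. pderiv_at k p x))\<^sup>2)"
      by (simp add: dot_square_norm[symmetric] inner_vec_def)
  qed (rule test_function_measurable[OF p])
qed


section \<open>Increments of functions with a weak gradient\<close>

text \<open>The mean of g over the segment from x to x + v, in the form of an average of shifts with
  a real parameter.\<close>

definition line_average :: "R4 \<Rightarrow> (R4 \<Rightarrow> real) \<Rightarrow> R4 \<Rightarrow> real" where
  "line_average v g x = (\<integral>r. indicator {0..1::real} r * g (r *\<^sub>R v + x) \<partial>lborel)"

lemma line_average_measurable [measurable]:
  assumes [measurable]: "g \<in> borel_measurable borel"
  shows "line_average v g \<in> borel_measurable borel"
  unfolding line_average_def by measurable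

lemma line_average_truncate:
  assumes "norm v \<le> c" "norm x \<le> R"
  shows "line_average v g x = line_average v (\<lambda>x. indicator (cball 0 (R + c)) x * g x) x"
  unfolding line_average_def
proof (intro Bochner_Integration.integral_cong refl)
  fix r :: real
  show "indicator {0..1} r * g (r *\<^sub>R v + x) = indicator {0..1} r * (indicator (cball 0 (R + c)) (r *\<^sub>R v + x) * g (r *\<^sub>R v + x))"
  proof (cases "0 \<le> r \<and> r \<le> 1")
    case True
    then have "r * norm v \<le> 1 * c" using assms by (intro mult_mono) auto
    then have "norm (r *\<^sub>R v + x) \<le> R + c"
      using norm_triangle_ineq[of "r *\<^sub>R v" x] True assms(2) by simp
    then show ?thesis by simp
  qed (auto simp: indicator_def)
qed

lemma unit_indicator_integrable: "integrable lborel (indicator {0..1::real} :: real \<Rightarrow> real)"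
  by simp

lemma line_average_integrable:
  assumes "integrable lborel f"
  shows "integrable lborel (line_average v f)"
  unfolding line_average_def
  by (rule average_of_shifts_integrable[OF sigma_finite_lborel unit_indicator_integrable _ _ assms]) auto

lemma line_average_locally_integrable:
  assumes g: "locally_integrable g"
  shows "locally_integrable (line_average v g)"
proof (rule locally_integrableI)
  have [measurable]: "g \<in> borel_measurable borel" using g by measurable
  show "line_average v g \<in> borel_measurable borel" by measurable
  fix R :: real
  let ?f = "\<lambda>x. indicator (cball 0 (R + norm v)) x * g x"
  have "integrable lborel (\<lambda>x. indicator (cball 0 R) x *\<^sub>R line_average v ?f x)"
    by (intro integrable_mult_indicator line_average_integrable locally_integrable_truncate g) simp
  then show "integrable lborel (\<lambda>x. indicator (cball 0 R) x * line_average v g x)"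
    by (rule Bochner_Integration.integrable_cong[THEN iffD1, rotated -1])
      (auto simp: indicator_def line_average_truncate[OF order_refl, of _ R v g])
qed

text \<open>Fubini. A majorant exists because for x in the ball of radius R that carries f, the
  points r v + x with r in the unit interval stay in the ball of radius R + |v|, on which g is
  integrable.\<close>

lemma line_average_test:
  assumes g: "locally_integrable g" and f: "test_function f"
  shows "(\<integral>x. line_average v g x * f x \<partial>lborel)
    = (\<integral>r. (\<integral>x. g (r *\<^sub>R v + x) * f x \<partial>lborel) * indicator {0..1::real} r \<partial>lborel)"
proof -
  obtain C where C: "C > 0" "\<And>x. \<bar>f x\<bar> \<le> C" using test_function_bounded[OF f] by blast
  obtain R where R: "R > 0" "\<And>x. norm x \<ge> R \<Longrightarrow> f x = 0" using test_function_support[OF f] by blast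
  have [measurable]: "g \<in> borel_measurable borel" "f \<in> borel_measurable borel"
    using g f by (simp_all add: locally_integrable_measurable test_function_measurable)
  define t where "t = (\<lambda>x. indicator (cball 0 (R + norm v)) x * g x)"
  have t: "integrable lborel t" unfolding t_def by (rule locally_integrable_truncate[OF g])
  have [measurable]: "t \<in> borel_measurable borel" using t by (auto dest: borel_measurable_integrable)
  have le: "norm (indicator {0..1} r * g (r *\<^sub>R v + x) * f x) \<le> indicator {0..1} r * (C * \<bar>t (r *\<^sub>R v + x)\<bar>)" for r :: real and x
  proof (cases "0 \<le> r \<and> r \<le> 1 \<and> norm x \<le> R")
    case True
    then have "r * norm v \<le> 1 * norm v" by (intro mult_right_mono) auto
    then have "norm (r *\<^sub>R v + x) \<le> R + norm v"
      using norm_triangle_ineq[of "r *\<^sub>R v" x] True by simp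
    then show ?thesis using True mult_left_mono[OF C(2)[of x], of "\<bar>g (r *\<^sub>R v + x)\<bar>"]
      by (simp add: abs_mult t_def mult.commute)
  next
    case False
    then have "indicator {0..1} r * g (r *\<^sub>R v + x) * f x = 0" using R(2)[of x] by (auto simp: indicator_def)
    moreover have "0 \<le> indicator {0..1} r * (C * \<bar>t (r *\<^sub>R v + x)\<bar>)" using C by simp
    ultimately show ?thesis by (simp only: norm_zero)
  qed
  have it: "integrable lborel (\<lambda>x. indicator {0..1} r * (C * \<bar>t (r *\<^sub>R v + x)\<bar>))" for r :: real
    using lborel_integrable_shift[OF t] by simp
  have ig: "integrable lborel (\<lambda>x. indicator {0..1} r * g (r *\<^sub>R v + x) * f x)" for r :: real
  proof (rule Bochner_Integration.integrable_bound[OF it[of r]])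
    show "AE x in lborel. norm (indicator {0..1} r * g (r *\<^sub>R v + x) * f x) \<le> norm (indicator {0..1} r * (C * \<bar>t (r *\<^sub>R v + x)\<bar>))"
      by (intro AE_I2 order_trans[OF le]) simp
  qed measurable
  have "integrable (lborel \<Otimes>\<^sub>M lborel) (\<lambda>(r::real, x). indicator {0..1} r * g (r *\<^sub>R v + x) * f x)"
  proof (rule lborel_pair.Fubini_integrable)
    show "integrable lborel (\<lambda>r::real. \<integral>x. norm (case (r, x) of (r, x) \<Rightarrow> indicator {0..1} r * g (r *\<^sub>R v + x) * f x) \<partial>lborel)"
    proof (rule Bochner_Integration.integrable_bound)
      show "integrable lborel (\<lambda>r::real. indicator {0..1} r * (C * (\<integral>x. \<bar>t x\<bar> \<partial>lborel)))" by simp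
      show "AE r in lborel. norm (\<integral>x. norm (case (r, x) of (r, x) \<Rightarrow> indicator {0..1::real} r * g (r *\<^sub>R v + x) * f x) \<partial>lborel)
        \<le> norm (indicator {0..1} r * (C * (\<integral>x. \<bar>t x\<bar> \<partial>lborel)))"
      proof (rule AE_I2)
        fix r :: real
        have "(\<integral>x. norm (indicator {0..1} r * g (r *\<^sub>R v + x) * f x) \<partial>lborel) \<le> (\<integral>x. indicator {0..1} r * (C * \<bar>t (r *\<^sub>R v + x)\<bar>) \<partial>lborel)"
          by (intro Bochner_Integration.integral_mono integrable_norm ig it le)
        also have "\<dots> = indicator {0..1} r * (C * (\<integral>x. \<bar>t x\<bar> \<partial>lborel))"
          using lborel_integral_shift[of "\<lambda>x. \<bar>t x\<bar>"] by simp
        finally show "norm (\<integral>x. norm (case (r, x) of (r, x) \<Rightarrow> indicator {0..1} r * g (r *\<^sub>R v + x) * f x) \<partial>lborel)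
          \<le> norm (indicator {0..1} r * (C * (\<integral>x. \<bar>t x\<bar> \<partial>lborel)))"
            using C(1) by (simp add: abs_mult)
      qed
    qed measurable
    show "AE r in lborel. integrable lborel (\<lambda>x. case (r, x) of (r::real, x) \<Rightarrow> indicator {0..1} r * g (r *\<^sub>R v + x) * f x)"
      using ig by simp
  qed measurable
  from lborel_pair.Fubini_integral[OF this]
  have "(\<integral>x. \<integral>r. indicator {0..1::real} r * g (r *\<^sub>R v + x) * f x \<partial>lborel \<partial>lborel)
    = (\<integral>r. \<integral>x. indicator {0..1} r * g (r *\<^sub>R v + x) * f x \<partial>lborel \<partial>lborel)" .
  moreover have "(\<integral>x. indicator {0..1} r * g (r *\<^sub>R v + x) * f x \<partial>lborel)
    = (\<integral>x. g (r *\<^sub>R v + x) * f x \<partial>lborel) * indicator {0..1} r" for r :: real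
    by (simp only: mult.assoc integral_mult_right_zero mult.commute[of _ "indicator {0..1} r"])
  ultimately show ?thesis by (simp only: line_average_def integral_mult_left_zero)
qed

text \<open>A weak fundamental theorem of calculus. Tested against f, the translation passes to f:
  P(t) is the integral of u against f(. - t e_k), and the definition of the weak gradient gives P' =
  Q, the same integral with G_k for u. Integrating Q from 0 to h produces the line average. The
  exceptional null set may depend on h.\<close>

lemma weak_increment:
  assumes "is_weak_gradient u G"
  shows "AE x in lborel. u (h *\<^sub>R axis k 1 + x) - u x = h * line_average (h *\<^sub>R axis k 1) (\<lambda>x. G x $ k) x"
proof -
  note G = is_weak_gradientD[OF assms]
  let ?e = "axis k 1 :: R4" and ?g = "\<lambda>x. G x $ k"
  let ?w = "\<lambda>x. (u (h *\<^sub>R ?e + x) + (-1) *\<^sub>R u x) + (- h) *\<^sub>R line_average (h *\<^sub>R ?e) ?g x"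
  have "AE x in lborel. ?w x = 0"
  proof (rule AE_zero_test_functions)
    show "locally_integrable ?w"
      by (intro locally_integrable_add locally_integrable_scaleR locally_integrable_shift line_average_locally_integrable G)
    fix f assume f: "test_function f"
    have um: "u \<in> borel_measurable borel" and gm: "?g \<in> borel_measurable borel"
      by (intro locally_integrable_measurable G)+
    have fm: "f \<in> borel_measurable borel" by (rule test_function_measurable[OF f])
    define P where "P = (\<lambda>t. \<integral>z. u z * f (z - t *\<^sub>R ?e) \<partial>lborel)"
    define Q where "Q = (\<lambda>t. \<integral>z. ?g z * f (z - t *\<^sub>R ?e) \<partial>lborel)"
    have P: "(P has_real_derivative Q t) (at t)" for t
    proof -
      have "- (\<integral>z. u z * pderiv_at k f (z - t *\<^sub>R ?e) \<partial>lborel) = Q t"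
        using G(4)[OF test_function_shift[OF f], of k "- (t *\<^sub>R ?e)"]
          pderiv_at_shift[OF f, of k "- (t *\<^sub>R ?e)"]
        by (simp add: Q_def)
      then show ?thesis using shift_derivative[OF G(1) f, of k t] by (simp add: P_def)
    qed
    have Q: "isCont Q t" for t
      using shift_derivative[OF G(3)[of k] f, of k t] unfolding Q_def by (rule DERIV_isCont)
    have "(\<integral>r. Q (r * h) * h * indicator {0..1} r \<partial>lborel) = P (1 * h) - P (0 * h)"
    proof (rule integral_FTC_Icc_real[where F="\<lambda>r. P (r * h)"])
      fix r :: real
      show "((\<lambda>r. P (r * h)) has_real_derivative Q (r * h) * h) (at r)"
        by (rule DERIV_chain2[OF P]) (auto intro!: derivative_eq_intros)
      show "isCont (\<lambda>r. Q (r * h) * h) r"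
        by (intro continuous_intros isCont_o2[OF _ Q])
    qed simp
    then have FTC: "h * (\<integral>r. Q (r * h) * indicator {0..1} r \<partial>lborel) = P h - P 0"
      by (simp add: mult.assoc mult.left_commute)
    have sh: "(\<integral>x. g (t *\<^sub>R ?e + x) * f x \<partial>lborel) = (\<integral>z. g z * f (z - t *\<^sub>R ?e) \<partial>lborel)"
      if "g \<in> borel_measurable borel" for g and t
      using integral_shift_test[OF that fm, of "t *\<^sub>R ?e"] by simp
    have m: "(\<integral>x. line_average (h *\<^sub>R ?e) ?g x * f x \<partial>lborel) = (\<integral>r. Q (r * h) * indicator {0..1} r \<partial>lborel)"
      unfolding line_average_test[OF G(3) f] using sh[OF gm] by (simp add: Q_def)
    have i: "integrable lborel (\<lambda>x. u (h *\<^sub>R ?e + x) * f x)" "integrable lborel (\<lambda>x. u x * f x)"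
        "integrable lborel (\<lambda>x. line_average (h *\<^sub>R ?e) ?g x * f x)"
      by (intro locally_integrable_mult_test locally_integrable_shift line_average_locally_integrable G f)+
    have "(\<integral>x. ?w x * f x \<partial>lborel) = (\<integral>x. (u (h *\<^sub>R ?e + x) * f x - u x * f x) - h * (line_average (h *\<^sub>R ?e) ?g x * f x) \<partial>lborel)"
      by (intro Bochner_Integration.integral_cong) (auto simp: algebra_simps)
    also have "\<dots> = (P h - P 0) - h * (\<integral>x. line_average (h *\<^sub>R ?e) ?g x * f x \<partial>lborel)"
      using i sh[OF um, of h] by (simp add: P_def)
    also have "\<dots> = 0" unfolding m FTC by simp
    finally show "(\<integral>x. ?w x * f x \<partial>lborel) = 0" .
  qed
  then show ?thesis by eventually_elim (simp add: algebra_simps)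
qed

text \<open>By \<open>weak_increment\<close> the quotient is a mean of G_k over a segment of length
  at most 1, so on the ball of radius R only the values of G_k in the ball of radius R + 1 matter;
  averages of shifts of that truncation converge in L1.\<close>

lemma difference_quotient_L1:
  assumes "is_weak_gradient u G" and h: "h \<longlonglongrightarrow> 0" "\<And>n. h n \<noteq> 0" "\<And>n. \<bar>h n\<bar> \<le> 1"
  shows "(\<lambda>n. \<integral>x. indicator (cball 0 R) x * \<bar>(u (h n *\<^sub>R axis k 1 + x) - u x) / h n - G x $ k\<bar> \<partial>lborel) \<longlonglongrightarrow> 0"
proof (rule tendsto_sandwich[OF always_eventually always_eventually tendsto_const])
  note G = is_weak_gradientD[OF assms(1)]
  let ?e = "axis k 1 :: R4" and ?g = "\<lambda>x. G x $ k"
  have [measurable]: "u \<in> borel_measurable borel" "?g \<in> borel_measurable borel"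
    by (intro locally_integrable_measurable G)+
  define t where "t = (\<lambda>x. indicator (cball 0 (R + 1)) x * ?g x)"
  have t: "integrable lborel t" unfolding t_def by (rule locally_integrable_truncate[OF G(3)])
  have [measurable]: "t \<in> borel_measurable borel" using t by (auto dest: borel_measurable_integrable)
  have [measurable]: "cball (0::R4) R \<in> sets borel" by simp
  have *: "(\<integral>r. indicator {0..1::real} r \<partial>lborel) = (1::real)" by simp
  show "(\<lambda>n. \<integral>x. \<bar>line_average (h n *\<^sub>R ?e) t x - t x\<bar> \<partial>lborel) \<longlonglongrightarrow> 0"
  proof -
    have "(\<lambda>n. \<integral>x. \<bar>(\<integral>r. indicator {0..1::real} r * t (r *\<^sub>R (h n *\<^sub>R ?e) + x) \<partial>lborel) - (\<integral>r. indicator {0..1::real} r \<partial>lborel) * t x\<bar> \<partial>lborel) \<longlonglongrightarrow> 0"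
    proof (rule average_of_shifts_tendsto[OF sigma_finite_lborel unit_indicator_integrable _ _ t])
      fix r :: real
      have "(\<lambda>n. r *\<^sub>R (h n *\<^sub>R ?e)) \<longlonglongrightarrow> r *\<^sub>R (0 *\<^sub>R ?e)" by (intro tendsto_intros h)
      then show "(\<lambda>n. r *\<^sub>R (h n *\<^sub>R ?e)) \<longlonglongrightarrow> 0" by simp
    qed auto
    then show ?thesis unfolding * line_average_def by simp
  qed
  show "\<forall>n. 0 \<le> (\<integral>x. indicator (cball 0 R) x * \<bar>(u (h n *\<^sub>R axis k 1 + x) - u x) / h n - G x $ k\<bar> \<partial>lborel)"
    by (intro allI Bochner_Integration.integral_nonneg) simp
  show "\<forall>n. (\<integral>x. indicator (cball 0 R) x * \<bar>(u (h n *\<^sub>R axis k 1 + x) - u x) / h n - G x $ k\<bar> \<partial>lborel)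
    \<le> (\<integral>x. \<bar>line_average (h n *\<^sub>R ?e) t x - t x\<bar> \<partial>lborel)"
  proof
    fix n
    have I: "integrable lborel (\<lambda>x. \<bar>line_average (h n *\<^sub>R ?e) t x - t x\<bar>)"
      using line_average_integrable[OF t] t by simp
    have "AE x in lborel. indicator (cball 0 R) x * \<bar>(u (h n *\<^sub>R ?e + x) - u x) / h n - ?g x\<bar>
        = indicator (cball 0 R) x * \<bar>line_average (h n *\<^sub>R ?e) t x - t x\<bar>"
      using weak_increment[OF assms(1), of "h n" k]
    proof eventually_elim
      case (elim x)
      show ?case
      proof (cases "norm x \<le> R")
        case True
        have "line_average (h n *\<^sub>R ?e) ?g x = line_average (h n *\<^sub>R ?e) t x"
          unfolding t_def using h(3)[of n] True by (intro line_average_truncate) (auto simp: norm_axis_1)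
        then show ?thesis using elim True h(2)[of n] by (simp add: t_def)
      qed simp
    qed
    then have "(\<integral>x. indicator (cball 0 R) x * \<bar>(u (h n *\<^sub>R ?e + x) - u x) / h n - ?g x\<bar> \<partial>lborel)
      = (\<integral>x. indicator (cball 0 R) x * \<bar>line_average (h n *\<^sub>R ?e) t x - t x\<bar> \<partial>lborel)"
      by (elim integral_cong_AE[rotated 2]; measurable)
    also have "\<dots> \<le> (\<integral>x. \<bar>line_average (h n *\<^sub>R ?e) t x - t x\<bar> \<partial>lborel)"
      using integrable_mult_indicator[OF _ I, of "cball 0 R"]
      by (intro Bochner_Integration.integral_mono I) (auto simp: indicator_def)
    finally show "(\<integral>x. indicator (cball 0 R) x * \<bar>(u (h n *\<^sub>R axis k 1 + x) - u x) / h n - G x $ k\<bar> \<partial>lborel)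
      \<le> (\<integral>x. \<bar>line_average (h n *\<^sub>R ?e) t x - t x\<bar> \<partial>lborel)" .
  qed
qed


section \<open>Absolute values and functions with vanishing gradient\<close>

text \<open>Clipping removes the excess of |q| over |g|, which is at most |D - g|. This splits a
  difference quotient of |u| into a part dominated by the gradient of u and an error controlled by
  the L1 convergence of the quotients of u.\<close>

lemma abs_clip_le: "\<bar>q\<bar> \<le> \<bar>D\<bar> \<Longrightarrow> \<bar>q - max (- \<bar>g\<bar>) (min \<bar>g\<bar> q)\<bar> \<le> \<bar>D - g\<bar>" for q D g :: real
  by (auto simp: max_def min_def abs_if split: if_splits)

text \<open>For a = 0 the limit is |g| because h > 0; this is the origin of the third case in the
  gradient of |u|.\<close>

lemma abs_difference_quotient_tendsto:
  fixes v h :: "nat \<Rightarrow> real"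
  assumes D: "(\<lambda>n. (v n - a) / h n) \<longlonglongrightarrow> g" and h: "h \<longlonglongrightarrow> 0" "\<And>n. h n > 0"
  shows "(\<lambda>n. (\<bar>v n\<bar> - \<bar>a\<bar>) / h n) \<longlonglongrightarrow> (if a > 0 then g else if a < 0 then - g else \<bar>g\<bar>)"
proof -
  have "(\<lambda>n. a + (v n - a) / h n * h n) \<longlonglongrightarrow> a + g * 0" by (intro tendsto_intros D h)
  moreover have "a + (v n - a) / h n * h n = v n" for n using h(2)[of n] by simp
  ultimately have v: "v \<longlonglongrightarrow> a" by simp
  consider "a > 0" | "a < 0" | "a = 0" by linarith
  then show ?thesis
  proof cases
    case 1
    have "eventually (\<lambda>n. (v n - a) / h n = (\<bar>v n\<bar> - \<bar>a\<bar>) / h n) sequentially"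
      using order_tendstoD(1)[OF v 1] by eventually_elim (use 1 in simp)
    then show ?thesis using D 1 by (simp add: Lim_transform_eventually)
  next
    case 2
    have "eventually (\<lambda>n. - ((v n - a) / h n) = (\<bar>v n\<bar> - \<bar>a\<bar>) / h n) sequentially"
      using order_tendstoD(2)[OF v 2] by eventually_elim (use 2 in \<open>simp add: minus_divide_left\<close>)
    then show ?thesis using tendsto_minus[OF D] 2 by (simp add: Lim_transform_eventually)
  next
    case 3
    have "(\<lambda>n. \<bar>(v n - a) / h n\<bar>) \<longlonglongrightarrow> \<bar>g\<bar>" by (intro tendsto_intros D)
    then show ?thesis using 3 h(2) by (simp add: abs_divide less_imp_le)
  qed
qed

text \<open>The quotients q of |u| converge a.e. along a subsequence, but no majorant is at hand.
  Their clipped versions c are dominated by |G_k|, and the error q - c tends to 0 in L1 where f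
  lives. The integrals of q f are also difference quotients of a translated integral, which
  identifies the limit. The value |G_k| at zeros of u keeps the norm of the gradient equal to that
  of G at every point.\<close>

lemma is_weak_gradient_abs:
  assumes "is_weak_gradient u G"
  shows "is_weak_gradient (\<lambda>x. \<bar>u x\<bar>) (\<lambda>x. \<chi> k. if u x > 0 then G x $ k else if u x < 0 then - G x $ k else \<bar>G x $ k\<bar>)"
    (is "is_weak_gradient _ ?H")
  unfolding is_weak_gradient_def
proof (intro conjI allI impI)
  note G = is_weak_gradientD[OF assms]
  have [measurable]: "u \<in> borel_measurable borel" "\<And>k. (\<lambda>x. G x $ k) \<in> borel_measurable borel"
    by (intro locally_integrable_measurable G)+
  show V: "locally_integrable (\<lambda>x. \<bar>u x\<bar>)"
  proof (rule locally_integrableI)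
    fix R show "integrable lborel (\<lambda>x. indicator (cball 0 R) x * \<bar>u x\<bar>)"
      using Bochner_Integration.integrable_abs[OF locally_integrable_truncate[OF G(1), of R]] by (simp add: abs_mult)
  qed measurable
  have Hle: "norm (?H x) = norm (G x)" for x
    by (simp add: norm_eq_sqrt_inner inner_vec_def) (auto intro!: arg_cong[where f=sqrt] sum.cong)
  have Hm [measurable]: "?H \<in> borel_measurable borel"
    unfolding borel_measurable_euclidean_space[of ?H] by (auto simp: Basis_vec_def inner_axis)
  show "locally_integrable ?H"
    unfolding locally_integrable_def set_integrable_def
  proof (intro conjI allI impI)
    fix K :: "R4 set" assume K: "compact K"
    then have [measurable]: "K \<in> sets borel" by (simp add: compact_imp_closed)
    show "integrable lborel (\<lambda>x. indicator K x *\<^sub>R ?H x)"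
      by (rule Bochner_Integration.integrable_bound[OF locally_integrable_integrable[OF G(2) K]]) (auto simp: Hle)
  qed (rule Hm)
  fix f k assume f: "test_function f"
  have fm [measurable]: "f \<in> borel_measurable borel" by (rule test_function_measurable[OF f])
  obtain C where C: "C > 0" "\<And>x. \<bar>f x\<bar> \<le> C" using test_function_bounded[OF f] by blast
  obtain R where R: "R > 0" "\<And>x. norm x \<ge> R \<Longrightarrow> f x = 0" using test_function_support[OF f] by blast
  let ?e = "axis k 1 :: R4"
  define h0 where "h0 = (\<lambda>n::nat. 1 / real (Suc n))"
  have h0: "h0 \<longlonglongrightarrow> 0" "\<And>n. h0 n > 0" "\<And>n. h0 n \<le> 1"
    unfolding h0_def using LIMSEQ_Suc[OF lim_1_over_n] by auto
  define D0 where "D0 = (\<lambda>h x. (u (h *\<^sub>R ?e + x) - u x) / h)"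
  have D0m [measurable]: "D0 h \<in> borel_measurable borel" for h unfolding D0_def by measurable
  have ind: "integrable lborel (\<lambda>x. indicator (cball 0 R) x *\<^sub>R (D0 h x - G x $ k))" for h
  proof -
    have "locally_integrable (\<lambda>x. (1/h) *\<^sub>R (u (h *\<^sub>R ?e + x) + (-1) *\<^sub>R u x) + (-1) *\<^sub>R G x $ k)"
      by (intro locally_integrable_add locally_integrable_scaleR locally_integrable_shift G)
    from locally_integrable_integrable[OF this compact_cball, of 0 R] show ?thesis
      by (simp add: D0_def)
  qed
  have L1: "(\<lambda>n. \<integral>x. norm (indicator (cball 0 R) x *\<^sub>R (D0 (h0 n) x - G x $ k)) \<partial>lborel) \<longlonglongrightarrow> 0"
    using difference_quotient_L1[OF assms h0(1), of R k] h0(2,3) by (simp add: D0_def abs_mult less_imp_neq less_imp_le)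
      (metis (no_types, lifting) abs_of_pos less_irrefl)
  \<comment> \<open>The limit of the quotients of |u| depends on the sign of u at the point, so L1
    convergence is traded for a.e. convergence along a subsequence.\<close>
  from tendsto_L1_AE_subseq[OF ind L1] obtain r :: "nat \<Rightarrow> nat" where r: "strict_mono r"
    "AE x in lborel. (\<lambda>n. indicator (cball 0 R) x *\<^sub>R (D0 (h0 (r n)) x - G x $ k)) \<longlonglongrightarrow> 0" by auto
  define h where "h = h0 \<circ> r"
  have h: "h \<longlonglongrightarrow> 0" "\<And>n. h n > 0"
    using LIMSEQ_subseq_LIMSEQ[OF h0(1) r(1)] h0(2) by (auto simp: h_def)
  have L1h: "(\<lambda>n. \<integral>x. norm (indicator (cball 0 R) x *\<^sub>R (D0 (h n) x - G x $ k)) \<partial>lborel) \<longlonglongrightarrow> 0"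
    using LIMSEQ_subseq_LIMSEQ[OF L1 r(1)] by (simp add: h_def o_def)
  define q where "q = (\<lambda>n x. (\<bar>u (h n *\<^sub>R ?e + x)\<bar> - \<bar>u x\<bar>) / h n)"
  have qm [measurable]: "q n \<in> borel_measurable borel" for n unfolding q_def by measurable
  have qD: "\<bar>q n x\<bar> \<le> \<bar>D0 (h n) x\<bar>" for n x
    unfolding q_def D0_def abs_divide using h(2)[of n] by (intro divide_right_mono) auto
  define c where "c = (\<lambda>n x. max (- \<bar>G x $ k\<bar>) (min \<bar>G x $ k\<bar> (q n x)))"
  have cm [measurable]: "c n \<in> borel_measurable borel" for n unfolding c_def by measurable
  have cb: "\<bar>c n x\<bar> \<le> \<bar>G x $ k\<bar>" for n x unfolding c_def by auto
  have Hk: "\<bar>?H x $ k\<bar> = \<bar>G x $ k\<bar>" for x by simp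
  have c_lim: "AE x in lborel. (\<lambda>n. c n x * f x) \<longlonglongrightarrow> ?H x $ k * f x"
    using r(2)
  proof eventually_elim
    case (elim x)
    show ?case
    proof (cases "norm x \<le> R")
      case True
      then have "(\<lambda>n. D0 (h n) x - G x $ k) \<longlonglongrightarrow> 0" using elim by (simp add: h_def)
      then have "(\<lambda>n. (u (h n *\<^sub>R ?e + x) - u x) / h n) \<longlonglongrightarrow> G x $ k"
        unfolding D0_def by (simp add: LIM_zero_iff)
      from abs_difference_quotient_tendsto[OF this h] have "(\<lambda>n. q n x) \<longlonglongrightarrow> ?H x $ k" by (simp add: q_def)
      then have "(\<lambda>n. c n x) \<longlonglongrightarrow> max (- \<bar>G x $ k\<bar>) (min \<bar>G x $ k\<bar> (?H x $ k))"
        unfolding c_def by (intro tendsto_max tendsto_min tendsto_const)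
      moreover have "max (- \<bar>G x $ k\<bar>) (min \<bar>G x $ k\<bar> (?H x $ k)) = ?H x $ k" using Hk[of x] by linarith
      ultimately show ?thesis by (intro tendsto_mult tendsto_const) simp
    qed (use R(2)[of x] in simp)
  qed
  have ic: "integrable lborel (\<lambda>x. c n x * f x)" for n
    using locally_integrable_mult_test[OF G(3)[of k] f] 
    by (rule Bochner_Integration.integrable_bound) (auto simp: abs_mult intro!: mult_right_mono cb)
  have [measurable]: "(\<lambda>x. ?H x $ k) \<in> borel_measurable borel" by simp
  have A: "(\<lambda>n. \<integral>x. c n x * f x \<partial>lborel) \<longlonglongrightarrow> (\<integral>x. ?H x $ k * f x \<partial>lborel)"
  proof (rule integral_dominated_convergence[OF _ _ _ c_lim])
    show "integrable lborel (\<lambda>x. \<bar>G x $ k * f x\<bar>)"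
      by (intro Bochner_Integration.integrable_abs locally_integrable_mult_test G f)
    show "AE x in lborel. norm (c n x * f x) \<le> \<bar>G x $ k * f x\<bar>" for n
      by (auto simp: abs_mult intro!: mult_right_mono cb)
  qed measurable
  have iq: "integrable lborel (\<lambda>x. q n x * f x)" for n
  proof -
    have "locally_integrable (\<lambda>x. (1/h n) *\<^sub>R (\<bar>u (h n *\<^sub>R ?e + x)\<bar> + (-1) *\<^sub>R \<bar>u x\<bar>))"
      by (intro locally_integrable_add locally_integrable_scaleR locally_integrable_shift[where f="\<lambda>x. \<bar>u x\<bar>"] V)
    from locally_integrable_mult_test[OF this f] show ?thesis by (simp add: q_def)
  qed
  have "(\<lambda>n. (\<integral>x. q n x * f x \<partial>lborel) - (\<integral>x. c n x * f x \<partial>lborel)) \<longlonglongrightarrow> 0"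
  proof (rule Lim_null_comparison)
    show "(\<lambda>n. C * (\<integral>x. norm (indicator (cball 0 R) x *\<^sub>R (D0 (h n) x - G x $ k)) \<partial>lborel)) \<longlonglongrightarrow> 0"
      by (rule tendsto_mult_right_zero[OF L1h])
    show "eventually (\<lambda>n. norm ((\<integral>x. q n x * f x \<partial>lborel) - (\<integral>x. c n x * f x \<partial>lborel))
      \<le> C * (\<integral>x. norm (indicator (cball 0 R) x *\<^sub>R (D0 (h n) x - G x $ k)) \<partial>lborel)) sequentially"
    proof (intro always_eventually allI)
      fix n
      have "norm ((\<integral>x. q n x * f x \<partial>lborel) - (\<integral>x. c n x * f x \<partial>lborel)) = norm (\<integral>x. q n x * f x - c n x * f x \<partial>lborel)"
        using iq ic by simp
      also have "\<dots> \<le> (\<integral>x. C * norm (indicator (cball 0 R) x *\<^sub>R (D0 (h n) x - G x $ k)) \<partial>lborel)"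
      proof (rule Bochner_Integration.integral_norm_bound_integral)
        show "integrable lborel (\<lambda>x. q n x * f x - c n x * f x)" using iq ic by simp
        show "integrable lborel (\<lambda>x. C * norm (indicator (cball 0 R) x *\<^sub>R (D0 (h n) x - G x $ k)))"
          by (intro integrable_mult_right integrable_norm ind)
        fix x
        show "norm (q n x * f x - c n x * f x) \<le> C * norm (indicator (cball 0 R) x *\<^sub>R (D0 (h n) x - G x $ k))"
        proof (cases "norm x \<le> R")
          case True
          have "\<bar>q n x - c n x\<bar> * \<bar>f x\<bar> \<le> \<bar>D0 (h n) x - G x $ k\<bar> * C"
            unfolding c_def by (intro mult_mono abs_clip_le qD C) auto
          moreover have "\<bar>q n x * f x - c n x * f x\<bar> = \<bar>q n x - c n x\<bar> * \<bar>f x\<bar>"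
            by (simp add: left_diff_distrib[symmetric] abs_mult)
          ultimately show ?thesis using True by (simp add: mult.commute)
        qed (use R(2)[of x] C(1) in simp)
      qed
      finally show "norm ((\<integral>x. q n x * f x \<partial>lborel) - (\<integral>x. c n x * f x \<partial>lborel))
        \<le> C * (\<integral>x. norm (indicator (cball 0 R) x *\<^sub>R (D0 (h n) x - G x $ k)) \<partial>lborel)" by simp
    qed
  qed
  from tendsto_add[OF this A]
  have B: "(\<lambda>n. \<integral>x. q n x * f x \<partial>lborel) \<longlonglongrightarrow> (\<integral>x. ?H x $ k * f x \<partial>lborel)" by simp
  have "(\<lambda>n. \<integral>x. q n x * f x \<partial>lborel) \<longlonglongrightarrow> - (\<integral>x. \<bar>u x\<bar> * pderiv_at k f x \<partial>lborel)"
  proof -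
    define P where "P = (\<lambda>t. \<integral>z. \<bar>u z\<bar> * f (z - t *\<^sub>R ?e) \<partial>lborel)"
    have "(P has_real_derivative - (\<integral>x. \<bar>u x\<bar> * pderiv_at k f x \<partial>lborel)) (at 0)"
      using shift_derivative[OF V f, of k 0] by (simp add: P_def)
    then have "((\<lambda>t. (P t - P 0) / (t - 0)) \<longlongrightarrow> - (\<integral>x. \<bar>u x\<bar> * pderiv_at k f x \<partial>lborel)) (at 0)"
      by (simp add: has_field_derivative_iff)
    moreover have "\<forall>i. h i \<in> UNIV - {0}" using h(2)[THEN less_imp_neq] by auto
    ultimately have "((\<lambda>t. (P t - P 0) / (t - 0)) \<circ> h) \<longlonglongrightarrow> - (\<integral>x. \<bar>u x\<bar> * pderiv_at k f x \<partial>lborel)"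
      using h(1) unfolding tendsto_at_iff_sequentially by blast
    moreover have "((\<lambda>t. (P t - P 0) / (t - 0)) \<circ> h) n = (\<integral>x. q n x * f x \<partial>lborel)" for n
    proof -
      have s: "P (h n) = (\<integral>x. \<bar>u (h n *\<^sub>R ?e + x)\<bar> * f x \<partial>lborel)"
        using integral_shift_test[of "\<lambda>x. \<bar>u x\<bar>" f "h n *\<^sub>R ?e"] by (simp add: P_def)
      have i: "integrable lborel (\<lambda>x. \<bar>u (h n *\<^sub>R ?e + x)\<bar> * f x)" "integrable lborel (\<lambda>x. \<bar>u x\<bar> * f x)"
        by (intro locally_integrable_mult_test locally_integrable_shift[where f="\<lambda>x. \<bar>u x\<bar>"] V f)+
      have "(\<integral>x. q n x * f x \<partial>lborel) = (\<integral>x. (\<bar>u (h n *\<^sub>R ?e + x)\<bar> * f x - \<bar>u x\<bar> * f x) / h n \<partial>lborel)"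
        by (intro Bochner_Integration.integral_cong) (auto simp: q_def left_diff_distrib)
      also have "\<dots> = (P (h n) - P 0) / h n"
        using i s by (simp add: P_def)
      finally show ?thesis by simp
    qed
    ultimately show ?thesis by (simp add: o_def)
  qed
  from LIMSEQ_unique[OF this B]
  show "(\<integral>x. \<bar>u x\<bar> * pderiv_at k f x \<partial>lborel) = - (\<integral>x. ?H x $ k * f x \<partial>lborel)" by simp
qed

lemma D12_abs:
  assumes "u \<in> D12"
  shows D12_abs_mem: "(\<lambda>x. \<bar>u x\<bar>) \<in> D12" and dirichlet_abs: "dirichlet (\<lambda>x. \<bar>u x\<bar>) = dirichlet u"
proof -
  obtain G where G: "u \<in> borel_measurable borel" "integrable lborel (\<lambda>x. u x ^ 4)" "is_weak_gradient u G"
    "integrable lborel (\<lambda>x. (norm (G x))\<^sup>2)" "dirichlet u = (\<integral>x. (norm (G x))\<^sup>2 \<partial>lborel)" using D12E[OF assms] .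
  let ?H = "\<lambda>x. \<chi> k. if u x > 0 then G x $ k else if u x < 0 then - G x $ k else \<bar>G x $ k\<bar>"
  have n: "norm (?H x) = norm (G x)" for x
    by (simp add: norm_eq_sqrt_inner inner_vec_def) (auto intro!: arg_cong[where f=sqrt] sum.cong)
  note [measurable] = G(1)
  show "(\<lambda>x. \<bar>u x\<bar>) \<in> D12"
    by (rule D12I[OF _ _ is_weak_gradient_abs[OF G(3)]]) (use G n in auto)
  show "dirichlet (\<lambda>x. \<bar>u x\<bar>) = dirichlet u"
    unfolding dirichlet_eq[OF is_weak_gradient_abs[OF G(3)]] G(5) n ..
qed

text \<open>With zero gradient all increments vanish, so u is a.e. invariant under translations
  along the first axis. Hence the mass F(t) of u^4 on the half-space x_1 \<le> t is constant in t,
  while it tends to the total mass at infinity and to 0 at minus infinity.\<close>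

lemma dirichlet_eq_0:
  assumes "u \<in> D12" "dirichlet u = 0"
  shows "AE x in lborel. u x = 0"
proof -
  obtain G where G: "u \<in> borel_measurable borel" "integrable lborel (\<lambda>x. u x ^ 4)" "is_weak_gradient u G"
    "integrable lborel (\<lambda>x. (norm (G x))\<^sup>2)" "dirichlet u = (\<integral>x. (norm (G x))\<^sup>2 \<partial>lborel)" using D12E[OF assms(1)] .
  note [measurable] = G(1)
  have "AE x in lborel. (norm (G x))\<^sup>2 = 0"
    using integral_nonneg_eq_0_iff_AE[OF G(4)] G(5) assms(2) by simp
  then have G0: "AE x in lborel. G x = 0" by simp
  \<comment> \<open>Replacing G by the function that is 0 everywhere makes the line averages vanish
    outright, instead of only up to null sets on segments.\<close>
  have "is_weak_gradient u (\<lambda>x. 0)"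
    unfolding is_weak_gradient_def
  proof (intro conjI allI impI)
    show "locally_integrable u" by (rule is_weak_gradientD[OF G(3)])
    show "locally_integrable (\<lambda>x. 0 :: R4)" by (intro locally_integrable_continuous continuous_intros)
    fix f k assume f: "test_function f"
    have "(\<integral>x. G x $ k * f x \<partial>lborel) = 0"
      using G0 by (intro integral_eq_zero_AE) (auto elim: eventually_mono)
    then show "(\<integral>x. u x * pderiv_at k f x \<partial>lborel) = - (\<integral>x. (0::R4) $ k * f x \<partial>lborel)"
      using is_weak_gradientD(4)[OF G(3) f, of k] by simp
  qed
  from weak_increment[OF this]
  have inv: "AE x in lborel. u (t *\<^sub>R axis 1 1 + x) = u x" for t
    by eventually_elim (simp add: line_average_def)
  define F where "F = (\<lambda>t. \<integral>x. indicator {x. x $ 1 \<le> t} x * u x ^ 4 \<partial>lborel)"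
  have [measurable]: "{x :: R4. x $ 1 \<le> t} \<in> sets borel" for t
    by (intro borel_closed closed_Collect_le continuous_intros)
  have Fc: "F t = F 0" for t
  proof -
    have "F t = (\<integral>x. indicator {x. x $ 1 \<le> t} (t *\<^sub>R axis 1 1 + x) * u (t *\<^sub>R axis 1 1 + x) ^ 4 \<partial>lborel)"
      unfolding F_def by (rule lborel_integral_shift[symmetric]) measurable
    also have "\<dots> = F 0"
      unfolding F_def
    proof (rule integral_cong_AE)
      show "AE x in lborel. indicator {x. x $ 1 \<le> t} (t *\<^sub>R axis 1 1 + x) * u (t *\<^sub>R axis 1 1 + x) ^ 4 = indicator {x. x $ 1 \<le> 0} x * u x ^ 4"
        using inv[of t] by eventually_elim (simp add: indicator_def axis_def)
    qed measurable
    finally show ?thesis .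
  qed
  have lim_F0: "(\<lambda>n. F (s n)) = (\<lambda>n. F 0)" for s :: "nat \<Rightarrow> real" by (rule ext) (rule Fc)
  have lim: "(\<lambda>n. F (s n)) \<longlonglongrightarrow> (\<integral>x. l x * u x ^ 4 \<partial>lborel)"
    if l: "\<And>x::R4. (\<lambda>n. indicator {x. x $ 1 \<le> s n} x) \<longlonglongrightarrow> (l x :: real)" and [measurable]: "l \<in> borel_measurable borel" for s l
    unfolding F_def
  proof (rule integral_dominated_convergence[OF _ _ G(2)])
    show "AE x in lborel. (\<lambda>n. indicator {x. x $ 1 \<le> s n} x * u x ^ 4) \<longlonglongrightarrow> l x * u x ^ 4"
      by (intro AE_I2 tendsto_intros l)
  qed (auto simp: indicator_def)
  have "(\<lambda>n. F (real n)) \<longlonglongrightarrow> (\<integral>x. 1 * u x ^ 4 \<partial>lborel)"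
  proof (rule lim)
    fix x :: R4
    obtain N where "x $ 1 \<le> real N" using real_arch_simple by blast
    then have "eventually (\<lambda>n. indicator {x. x $ 1 \<le> real n} x = (1::real)) sequentially"
      unfolding eventually_sequentially by (intro exI[of _ N]) auto
    then show "(\<lambda>n. indicator {x. x $ 1 \<le> real n} x) \<longlonglongrightarrow> (1::real)" by (rule tendsto_eventually)
  qed simp
  then have 1: "F 0 = (\<integral>x. u x ^ 4 \<partial>lborel)" using lim_F0[of real] LIMSEQ_const_iff[of "F 0"] by simp
  have "(\<lambda>n. F (- real n)) \<longlonglongrightarrow> (\<integral>x. 0 * u x ^ 4 \<partial>lborel)"
  proof (rule lim)
    fix x :: R4
    obtain N where N: "- (x $ 1) + 1 \<le> real N" using real_arch_simple by blast
    have "eventually (\<lambda>n. indicator {x. x $ 1 \<le> - real n} x = (0::real)) sequentially"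
      unfolding eventually_sequentially using N by (intro exI[of _ N]) (auto simp: indicator_def)
    then show "(\<lambda>n. indicator {x. x $ 1 \<le> - real n} x) \<longlonglongrightarrow> (0::real)" by (rule tendsto_eventually)
  qed simp
  then have "F 0 = 0" using lim_F0[of "\<lambda>n. - real n"] LIMSEQ_const_iff[of "F 0"] by simp
  then have "AE x in lborel. u x ^ 4 = 0"
    using 1 integral_nonneg_eq_0_iff_AE[OF G(2)] by simp
  then show ?thesis by simp
qed


section \<open>Superharmonic functions\<close>

definition laplacian :: "(R4 \<Rightarrow> real) \<Rightarrow> R4 \<Rightarrow> real" where
  "laplacian f x = (\<Sum>k\<in>UNIV. pderiv_at k (pderiv_at k f) x)"

lemma test_function_add:
  assumes f: "test_function f" and g: "test_function g"
  shows "test_function (\<lambda>x. f x + g x)"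
proof -
  obtain R where R: "\<And>x. norm x \<ge> R \<Longrightarrow> f x = 0" using test_function_support[OF f] by blast
  obtain S where S: "\<And>x. norm x \<ge> S \<Longrightarrow> g x = 0" using test_function_support[OF g] by blast
  show ?thesis
    by (rule test_functionI[where R="max R S", OF C_k_add[OF test_function_C_k[OF f] test_function_C_k[OF g]]])
      (simp add: R S)
qed

lemma test_function_sum:
  assumes "finite A" "\<And>k. k \<in> A \<Longrightarrow> test_function (f k)"
  shows "test_function (\<lambda>x. \<Sum>k\<in>A. f k x)"
  using assms
proof (induction rule: finite_induct)
  case empty
  show ?case using test_function_cmult[OF test_function_rho, of 0] by simp
next
  case (insert k A)
  then show ?case using test_function_add[of "f k" "\<lambda>x. \<Sum>k\<in>A. f k x"] by simp
qed

lemma test_function_laplacian: "test_function f \<Longrightarrow> test_function (laplacian f)"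
  unfolding laplacian_def[abs_def]
  by (intro test_function_sum) (auto intro: test_function_pderiv)

lemma laplacian_affine:
  assumes f: "test_function f"
  shows "laplacian (\<lambda>x. f (a + c *\<^sub>R x)) x = c\<^sup>2 * laplacian f (a + c *\<^sub>R x)"
proof -
  have "pderiv_at k (pderiv_at k (\<lambda>x. f (a + c *\<^sub>R x))) x = c\<^sup>2 * pderiv_at k (pderiv_at k f) (a + c *\<^sub>R x)" for k
  proof -
    have 1: "pderiv_at k (\<lambda>x. f (a + c *\<^sub>R x)) = (\<lambda>x. c * pderiv_at k f (a + c *\<^sub>R x))"
      by (rule ext) (rule pderiv_at_affine[OF test_function_differentiable[OF f]])
    have d: "\<And>x. pderiv_at k f differentiable at x"
      by (rule test_function_differentiable[OF test_function_pderiv[OF f]])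
    have "((\<lambda>x. c * pderiv_at k f (a + c *\<^sub>R x)) has_derivative
        (\<lambda>h. c * frechet_derivative (pderiv_at k f) (at (a + c *\<^sub>R x)) (c *\<^sub>R h))) (at x)"
      by (intro has_derivative_mult_right has_derivative_affine iffD1[OF frechet_derivative_works d])
    from pderiv_at_eqI[OF this, of k] show ?thesis
      unfolding 1 using linear_frechet_derivative[OF d]
      by (simp add: pderiv_at_def[of k "pderiv_at k f"] linear_cmul power2_eq_square)
  qed
  then show ?thesis by (simp add: laplacian_def sum_distrib_left)
qed

text \<open>The coefficient 8 is twice the dimension: each second partial derivative contributes a
  2, while the squares of the coordinates add up to the inner product.\<close>

lemma laplacian_bump:
  "laplacian (bump p) y = - 8 * bump (flat_deriv p) y + 4 * (y \<bullet> y) * bump (flat_deriv (flat_deriv p)) y"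
proof -
  let ?b = "bump (flat_deriv p)" and ?c = "bump (flat_deriv (flat_deriv p))"
  have "pderiv_at k (pderiv_at k (bump p)) y = - 2 * ?b y + 4 * ?c y * (y $ k * y $ k)" for k
  proof -
    have c: "((\<lambda>x::R4. x $ k) has_derivative (\<lambda>h. h $ k)) (at y)"
      by (rule bounded_linear_imp_has_derivative[OF bounded_linear_vec_nth])
    have "((\<lambda>x. - 2 * (?b x * x $ k)) has_derivative
        (\<lambda>h. - 2 * (?b y * h $ k + ?c y * (- 2 * (y \<bullet> h)) * y $ k))) (at y)"
      by (intro has_derivative_mult_right has_derivative_mult bump_has_derivative c)
    from pderiv_at_eqI[OF this, of k] show ?thesis
      unfolding pderiv_at_bump by (simp add: inner_axis algebra_simps)
  qed
  then have "laplacian (bump p) y = (\<Sum>k\<in>UNIV. - 2 * ?b y + 4 * ?c y * (y $ k * y $ k))"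
    by (simp only: laplacian_def)
  also have "\<dots> = - 8 * ?b y + 4 * ?c y * (y \<bullet> y)"
    by (simp add: sum.distrib sum_distrib_left inner_vec_def sum_subtractf)
  finally show ?thesis by simp
qed

definition weakly_superharmonic :: "(R4 \<Rightarrow> real) \<Rightarrow> bool" where
  "weakly_superharmonic V \<longleftrightarrow> locally_integrable V \<and>
    (\<forall>f. test_function f \<longrightarrow> (\<forall>x. 0 \<le> f x) \<longrightarrow> (\<integral>x. V x * laplacian f x \<partial>lborel) \<le> 0)"

lemma flat_deriv_1: "flat_deriv 1 = [:0, 0, 1:]"
  by (simp add: flat_deriv_def)

text \<open>
  With \<open>\<eta> = bump 1\<close> the kernel \<open>k\<^sub>s z = s\<^sup>-\<^sup>4 \<rho> ((z - x) / s)\<close> satisfies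
  \<open>\<partial>\<^sub>s k\<^sub>s = s\<^sup>-\<^sup>5 / 2 \<cdot> (\<Delta> \<eta>) ((z - x) / s)\<close>, so averaging a superharmonic
  function against it gives a nonincreasing function of \<open>s\<close>.
\<close>

lemma rho_kernel_derivative:
  assumes "s > 0"
  shows "((\<lambda>s. (1/s) ^ 4 * rho ((1/s) *\<^sub>R (z - x))) has_real_derivative
    (1/s) ^ 5 / 2 * laplacian (bump 1) ((1/s) *\<^sub>R (z - x))) (at s)"
proof -
  let ?N = "(z - x) \<bullet> (z - x)" and ?p = "[:0, 0, 1:] :: real poly"
  have rho: "rho ((1/s) *\<^sub>R (z - x)) = flat_exp ?p (1 - ?N / s\<^sup>2)" for s
    by (simp add: rho_def bump_def power2_eq_square divide_simps)
  have N: "((\<lambda>s. 1 - ?N / s\<^sup>2) has_real_derivative 2 * ?N / s ^ 3) (at s)"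
    using assms by (auto intro!: derivative_eq_intros simp: field_simps power2_eq_square power3_eq_cube)
  have "((\<lambda>s. (1/s) ^ 4) has_real_derivative - 4 / s ^ 5) (at s)"
    using assms by (auto intro!: derivative_eq_intros simp: field_simps eval_nat_numeral)
  from DERIV_mult[OF this DERIV_chain2[OF flat_exp_deriv N]]
  have "((\<lambda>s. (1/s) ^ 4 * flat_exp ?p (1 - ?N / s\<^sup>2)) has_real_derivative
    - 4 / s ^ 5 * flat_exp ?p (1 - ?N / s\<^sup>2) + flat_exp (flat_deriv ?p) (1 - ?N / s\<^sup>2) * (2 * ?N / s ^ 3) * (1/s) ^ 4) (at s)" .
  \<comment> \<open>At p = 1 half of \<open>laplacian_bump\<close> has the coefficients -4 and 2
    |y|^2 with y = (z - x) / s. The exponent of 1/s being the dimension 4 is what produces the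
    matching -4.\<close>
  moreover have "- 4 / s ^ 5 * flat_exp ?p (1 - ?N / s\<^sup>2) + flat_exp (flat_deriv ?p) (1 - ?N / s\<^sup>2) * (2 * ?N / s ^ 3) * (1/s) ^ 4
    = (1/s) ^ 5 / 2 * laplacian (bump 1) ((1/s) *\<^sub>R (z - x))"
  proof -
    have i: "((1/s) *\<^sub>R (z - x)) \<bullet> ((1/s) *\<^sub>R (z - x)) = ?N / s\<^sup>2"
      by (simp add: power2_eq_square)
    show ?thesis
      unfolding laplacian_bump flat_deriv_1 bump_def i using assms
      by (simp add: field_simps eval_nat_numeral)
  qed
  ultimately show ?thesis by (simp only: rho)
qed

lemma superharmonic_average_antimono:
  assumes V: "weakly_superharmonic V" and s: "0 < s" "s \<le> t"
  shows "(\<integral>y. rho y * V (t *\<^sub>R y + x) \<partial>lborel) \<le> (\<integral>y. rho y * V (s *\<^sub>R y + x) \<partial>lborel)"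
proof -
  have lV: "locally_integrable V" using V by (simp add: weakly_superharmonic_def)
  define m where "m = (\<lambda>s. \<integral>z. V z * ((1/s) ^ 4 * rho ((1/s) *\<^sub>R (z - x))) \<partial>lborel)"
  have m: "(\<integral>y. rho y * V (s *\<^sub>R y + x) \<partial>lborel) = m s" if "s > 0" for s
  proof -
    have "(\<integral>y. rho y * V (s *\<^sub>R y + x) \<partial>lborel) = (1/s) ^ 4 * (\<integral>z. V z * rho ((1/s) *\<^sub>R (z - x)) \<partial>lborel)"
      using mollify_eq[OF locally_integrable_measurable[OF lV] that, of x] by (simp add: scaleR_diff_right)
    also have "\<dots> = (\<integral>z. (1/s) ^ 4 * (V z * rho ((1/s) *\<^sub>R (z - x))) \<partial>lborel)"
      by (rule integral_mult_right_zero[symmetric])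
    also have "\<dots> = m s" by (simp only: m_def mult.left_commute)
    finally show ?thesis .
  qed
  let ?L = "laplacian (bump 1)"
  have tL: "test_function ?L" by (intro test_function_laplacian test_function_bump)
  obtain C where C: "C > 0" "\<And>x. \<bar>?L x\<bar> \<le> C" using test_function_bounded[OF tL] by blast
  obtain C' where C': "C' > 0" "\<And>x. \<bar>rho x\<bar> \<le> C'" using test_function_bounded[OF test_function_rho] by blast
  have [measurable]: "?L \<in> borel_measurable borel" by (rule test_function_measurable[OF tL])
  have D: "(m has_real_derivative (\<integral>z. V z * ((1/t) ^ 5 / 2 * ?L ((1/t) *\<^sub>R (z - x))) \<partial>lborel)) (at t)" if t: "t > 0" for t
    unfolding m_def
  \<comment> \<open>Between the scales t/2 and 2t one has 1/u \<le> 2/t, which bounds the kernels,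
    and all kernels vanish outside the ball of radius |x| + 2t about 0.\<close>
  proof (rule has_derivative_integral_parameter[OF lV, where a="t/2" and b="2*t" and C="(2/t) ^ 5 / 2 * C" and C'="(2/t)^4 * C'"
      and R="norm x + 2 * t" and k="\<lambda>s z. (1/s) ^ 4 * rho ((1/s) *\<^sub>R (z - x))" and k'="\<lambda>t z. (1/t) ^ 5 / 2 * ?L ((1/t) *\<^sub>R (z - x))"])
    fix u z assume u: "t / 2 < u" "u < 2 * t"
    have up: "0 < u" using u t by simp
    have le: "1/u \<le> 2/t" using u t by (simp add: field_simps)
    show "((\<lambda>u. (1 / u) ^ 4 * rho ((1 / u) *\<^sub>R (z - x))) has_real_derivative (1 / u) ^ 5 / 2 * ?L ((1 / u) *\<^sub>R (z - x))) (at u)"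
      by (rule rho_kernel_derivative[OF up])
    show "\<bar>(1 / u) ^ 5 / 2 * ?L ((1 / u) *\<^sub>R (z - x))\<bar> \<le> (2 / t) ^ 5 / 2 * C"
      unfolding abs_mult using up t by (intro mult_mono C) (auto intro!: divide_right_mono power_mono le simp: power_abs abs_divide simp del: power_divide)
    show "\<bar>(1 / u) ^ 4 * rho ((1 / u) *\<^sub>R (z - x))\<bar> \<le> (2 / t) ^ 4 * C'"
      unfolding abs_mult using up t by (intro mult_mono C') (auto intro!: power_mono le simp: power_abs abs_divide simp del: power_divide)
    show "(\<lambda>z. (1 / u) ^ 4 * rho ((1 / u) *\<^sub>R (z - x))) \<in> borel_measurable borel" by measurable
    assume z: "norm x + 2 * t \<le> norm z"
    have "norm z \<le> norm (z - x) + norm x" by (metis diff_add_cancel norm_triangle_ineq)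
    then have "u \<le> norm (z - x)" using z u by linarith
    then have "1 \<le> norm ((1/u) *\<^sub>R (z - x))"
      unfolding norm_scaleR using up by (simp add: field_simps)
    then show "(1 / u) ^ 4 * rho ((1 / u) *\<^sub>R (z - x)) = 0" by (simp add: rho_eq_0)
  qed (use t in auto)
  have D0: "(\<integral>z. V z * ((1/t) ^ 5 / 2 * ?L ((1/t) *\<^sub>R (z - x))) \<partial>lborel) \<le> 0" if t: "t > 0" for t
  proof -
    let ?f = "\<lambda>z. bump 1 (- ((1/t) *\<^sub>R x) + (1/t) *\<^sub>R z)"
    have "test_function ?f" using t by (intro test_function_affine test_function_bump) simp
    moreover have "0 \<le> ?f z" for z by (simp add: bump_def flat_exp_def)
    ultimately have "(\<integral>z. V z * laplacian ?f z \<partial>lborel) \<le> 0" using V by (simp add: weakly_superharmonic_def)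
    \<comment> \<open>Rescaling the bump multiplies its Laplacian by (1/t)^2; the factor (1/t)^3/2
      completes the (1/t)^5/2 of the kernel derivative.\<close>
    then have "(1/t)^3/2 * (\<integral>z. V z * laplacian ?f z \<partial>lborel) \<le> 0"
      using t by (intro mult_nonneg_nonpos) auto
    also have "(1/t)^3/2 * (\<integral>z. V z * laplacian ?f z \<partial>lborel) = (\<integral>z. (1/t)^3/2 * (V z * laplacian ?f z) \<partial>lborel)"
      by simp
    also have "\<dots> = (\<integral>z. V z * ((1/t) ^ 5 / 2 * ?L ((1/t) *\<^sub>R (z - x))) \<partial>lborel)"
      unfolding laplacian_affine[OF test_function_bump]
      by (intro Bochner_Integration.integral_cong refl) (simp add: scaleR_diff_right eval_nat_numeral)
    finally show ?thesis .
  qed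
  have "m t \<le> m s"
  proof (rule DERIV_nonpos_imp_nonincreasing[OF s(2)])
    fix u assume "s \<le> u"
    then have "u > 0" using s by simp
    then show "\<exists>y. (m has_real_derivative y) (at u) \<and> y \<le> 0" using D D0 by blast
  qed
  then show ?thesis using m[of s] m[of t] s by simp
qed

text \<open>A strong minimum principle. Along a subsequence of scales the averages of V tend a.e. to
  a multiple of V, so some zero x of V has averages tending to 0. Averages at larger scales are no
  larger, hence nonpositive at every scale. As V is nonnegative and the kernel positive inside its
  ball, V vanishes a.e. on every ball about x.\<close>

lemma superharmonic_zero:
  assumes V: "weakly_superharmonic V" and pos: "\<And>x. 0 \<le> V x" and Z: "\<not> (AE x in lborel. V x \<noteq> 0)"
  shows "AE x in lborel. V x = 0"
proof -
  have lV: "locally_integrable V" using V by (simp add: weakly_superharmonic_def)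
  obtain R :: nat where R: "\<not> (AE x in lborel. norm x \<le> real R \<longrightarrow> V x \<noteq> 0)"
    using Z AE_all_cballI[of "\<lambda>x. V x \<noteq> 0"] by blast
  let ?s = "\<lambda>n::nat. 1 / real (Suc n)"
  let ?m = "\<lambda>s x. \<integral>y. rho y * V (s *\<^sub>R y + x) \<partial>lborel"
  let ?I = "\<integral>y. rho y \<partial>lborel"
  have sl: "?s \<longlonglongrightarrow> 0" by (rule LIMSEQ_Suc[OF lim_1_over_n])
  have im: "integrable lborel (\<lambda>x. indicator (cball 0 R) x * ?m (?s n) x)" for n
    by (rule mollify_L1(2)[OF lV sl]) auto
  have i: "integrable lborel (\<lambda>x. indicator (cball 0 R) x * ?m (?s n) x - ?I * (indicator (cball 0 R) x * V x))" for n
    by (rule Bochner_Integration.integrable_diff[OF im integrable_mult_right[OF locally_integrable_truncate[OF lV]]])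
  have "(\<lambda>n. \<integral>x. norm (indicator (cball 0 R) x * ?m (?s n) x - ?I * (indicator (cball 0 R) x * V x)) \<partial>lborel) \<longlonglongrightarrow> 0"
  proof -
    have "norm (indicator (cball 0 R) x * ?m s x - ?I * (indicator (cball 0 R) x * V x))
      = indicator (cball 0 R) x * \<bar>?m s x - ?I * V x\<bar>" for s and x :: R4
      by (simp add: indicator_def)
    then show ?thesis using mollify_L1(1)[OF lV sl, of "real R"] by simp
  qed
  from tendsto_L1_AE_subseq[OF i this] obtain r :: "nat \<Rightarrow> nat" where r: "strict_mono r"
    "AE x in lborel. (\<lambda>n. indicator (cball 0 R) x * ?m (?s (r n)) x - ?I * (indicator (cball 0 R) x * V x)) \<longlonglongrightarrow> 0" by auto
  \<comment> \<open>The zeros of V in the ball are not negligible, so they meet the set of full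
    measure on which the averages converge.\<close>
  have "\<exists>x. norm x \<le> real R \<and> V x = 0 \<and> (\<lambda>n. ?m (?s (r n)) x) \<longlonglongrightarrow> 0"
  proof (rule ccontr)
    assume *: "\<not> ?thesis"
    have "AE x in lborel. norm x \<le> real R \<longrightarrow> V x \<noteq> 0"
      using r(2)
    proof eventually_elim
      case (elim x)
      show ?case
      proof (intro impI notI)
        assume x: "norm x \<le> real R" "V x = 0"
        then have "(\<lambda>n. ?m (?s (r n)) x) \<longlonglongrightarrow> 0" using elim by simp
        with * x show False by blast
      qed
    qed
    then show False using R by simp
  qed
  then obtain x where x: "(\<lambda>n. ?m (?s (r n)) x) \<longlonglongrightarrow> 0" by blast
  have m0: "?m S x \<le> 0" if S: "S > 0" for S
  proof (rule tendsto_lowerbound[OF x])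
    have "(\<lambda>n. ?s (r n)) \<longlonglongrightarrow> 0" using LIMSEQ_subseq_LIMSEQ[OF sl r(1)] by (simp add: o_def)
    from order_tendstoD(2)[OF this S] show "eventually (\<lambda>n. ?m S x \<le> ?m (?s (r n)) x) sequentially"
      by eventually_elim (intro superharmonic_average_antimono[OF V], auto)
  qed simp
  have "AE z in lborel. norm (z - x) < S \<longrightarrow> V z = 0" if S: "S > 0" for S
  proof -
    let ?k = "\<lambda>z. rho (- ((1/S) *\<^sub>R x) + (1/S) *\<^sub>R z)"
    have k: "test_function ?k" using S by (intro test_function_affine test_function_rho) simp
    have i: "integrable lborel (\<lambda>z. V z * ?k z)" by (rule locally_integrable_mult_test[OF lV k])
    have "(1/S)^4 * (\<integral>z. V z * ?k z \<partial>lborel) \<le> 0"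
      using m0[OF S] mollify_eq[OF locally_integrable_measurable[OF lV] S, of x] by simp
    then have "(\<integral>z. V z * ?k z \<partial>lborel) \<le> 0" 
      using S by (meson mult_pos_pos not_le zero_less_divide_1_iff zero_less_power)
    moreover have "0 \<le> (\<integral>z. V z * ?k z \<partial>lborel)"
      by (intro Bochner_Integration.integral_nonneg mult_nonneg_nonneg pos rho_nonneg)
    ultimately have "(\<integral>z. V z * ?k z \<partial>lborel) = 0" by linarith
    then have "AE z in lborel. V z * ?k z = 0"
      using integral_nonneg_eq_0_iff_AE[OF i AE_I2[OF mult_nonneg_nonneg[OF pos rho_nonneg]]] by simp
    then show ?thesis
    proof eventually_elim
      case (elim z)
      show ?case
      proof
        assume "norm (z - x) < S"
        then have "norm ((1/S) *\<^sub>R (z - x)) < 1"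
          unfolding norm_scaleR using S by (simp add: field_simps)
        then have "0 < ?k z" using rho_pos[of "(1/S) *\<^sub>R (z - x)"] by (simp add: scaleR_diff_right)
        then show "V z = 0" using elim by simp
      qed
    qed
  qed
  then have "AE z in lborel. \<forall>n::nat. norm (z - x) < real (Suc n) \<longrightarrow> V z = 0"
    unfolding AE_all_countable by simp
  then show ?thesis
  proof eventually_elim
    case (elim z)
    obtain n where "norm (z - x) < real n" using reals_Archimedean2 by blast
    then have "norm (z - x) < real (Suc n)" by simp
    then show ?case using elim by blast
  qed
qed


section \<open>The energy on the Nehari set\<close>

definition quartic :: "(R4 \<Rightarrow> real) \<Rightarrow> real" where
  "quartic u = (\<integral>x. u x ^ 4 \<partial>lborel)"

definition interaction :: "(R4 \<Rightarrow> real) \<Rightarrow> (R4 \<Rightarrow> real) \<Rightarrow> real" where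
  "interaction u v = (\<integral>x. (u x)\<^sup>2 * (v x)\<^sup>2 \<partial>lborel)"

lemma D12_measurable [measurable_dest]: "u \<in> D12 \<Longrightarrow> u \<in> borel_measurable borel"
  by (simp add: D12_def)

lemma D12_integrable4: "u \<in> D12 \<Longrightarrow> integrable lborel (\<lambda>x. u x ^ 4)"
  by (simp add: D12_def)

lemma interaction_integrable:
  assumes u: "u \<in> D12" and v: "v \<in> D12"
  shows "integrable lborel (\<lambda>x. (u x)\<^sup>2 * (v x)\<^sup>2)"
proof (rule Bochner_Integration.integrable_bound)
  show "integrable lborel (\<lambda>x. u x ^ 4 + v x ^ 4)" using D12_integrable4 u v by simp
  show "(\<lambda>x. (u x)\<^sup>2 * (v x)\<^sup>2) \<in> borel_measurable lborel"
    using D12_measurable[OF u] D12_measurable[OF v] by measurable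
  show "AE x in lborel. norm ((u x)\<^sup>2 * (v x)\<^sup>2) \<le> norm (u x ^ 4 + v x ^ 4)"
  proof (rule AE_I2)
    fix x
    have "2 * (u x)\<^sup>2 * (v x)\<^sup>2 \<le> ((u x)\<^sup>2)\<^sup>2 + ((v x)\<^sup>2)\<^sup>2" by (rule sum_squares_bound)
    moreover have "0 \<le> (u x)\<^sup>2 * (v x)\<^sup>2" by simp
    ultimately have "(u x)\<^sup>2 * (v x)\<^sup>2 \<le> ((u x)\<^sup>2)\<^sup>2 + ((v x)\<^sup>2)\<^sup>2" by linarith
    then show "norm ((u x)\<^sup>2 * (v x)\<^sup>2) \<le> norm (u x ^ 4 + v x ^ 4)"
      by (simp add: power_mult[symmetric])
  qed
qed

lemma interaction_nonneg: "0 \<le> interaction u v"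
  unfolding interaction_def by (intro Bochner_Integration.integral_nonneg) simp

lemma interaction_cmult: "interaction (\<lambda>x. a * u x) (\<lambda>x. b * v x) = a\<^sup>2 * b\<^sup>2 * interaction u v"
proof -
  have "interaction (\<lambda>x. a * u x) (\<lambda>x. b * v x) = (\<integral>x. (a\<^sup>2 * b\<^sup>2) * ((u x)\<^sup>2 * (v x)\<^sup>2) \<partial>lborel)"
    unfolding interaction_def by (intro Bochner_Integration.integral_cong) (auto simp: power_mult_distrib)
  then show ?thesis by (simp add: interaction_def)
qed

lemma interaction_self: "interaction u u = quartic u"
  by (simp add: interaction_def quartic_def power_add[symmetric])

lemma quartic_cmult: "quartic (\<lambda>x. c * u x) = c ^ 4 * quartic u"
  by (simp add: quartic_def power_mult_distrib)

lemma quartic_nonneg: "0 \<le> quartic u"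
  unfolding quartic_def by (intro Bochner_Integration.integral_nonneg) simp

lemma quartic_pos_iff:
  assumes "u \<in> D12"
  shows "0 < quartic u \<longleftrightarrow> nonzero u"
  using integral_nonneg_eq_0_iff_AE[OF D12_integrable4[OF assms]] quartic_nonneg[of u]
  by (auto simp: quartic_def nonzero_def less_le)

lemma dirichlet_pos:
  assumes "u \<in> D12" "nonzero u"
  shows "0 < dirichlet u"
  using dirichlet_eq_0[OF assms(1)] assms(2) dirichlet_nonneg[of u] by (auto simp: nonzero_def less_le)

lemma energy_eq:
  "energy d \<beta> u = 1/2 * (\<Sum>i=1..d. dirichlet (u i)) - 1/4 * (\<Sum>i=1..d. \<Sum>j=1..d. \<beta> i j * interaction (u i) (u j))"
  by (simp add: energy_def interaction_def mult.assoc)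

text \<open>Replacing u_i by (1 + t) u_i makes the energy a polynomial in t. Each squared factor has
  derivative 2 at 0, and the interaction of i with another index occurs twice in the double sum, so
  the prefactors 1/2 and 1/4 leave coefficient 1 everywhere.\<close>

lemma partial_energy_eq:
  assumes u: "\<forall>a\<in>{1..d}. u a \<in> D12" and sym: "\<forall>i\<in>{1..d}. \<forall>j\<in>{1..d}. \<beta> i j = \<beta> j i" and i: "i \<in> {1..d}"
  shows "partial_energy d \<beta> i u (u i) = dirichlet (u i) - (\<Sum>j=1..d. \<beta> i j * interaction (u i) (u j))"
proof -
  define c where "c = (\<lambda>(t::real) a. if a = i then 1 + t else 1)"
  define J where "J = (\<lambda>a b. \<beta> a b * interaction (u a) (u b))"
  have J: "J a b = J b a" if "a \<in> {1..d}" "b \<in> {1..d}" for a b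
    using sym that by (simp add: J_def interaction_def mult.commute)
  define del where "del = (\<lambda>a. if a = i then 2 else 0 :: real)"
  have up: "(u(i := (\<lambda>x. u i x + t * u i x))) a = (\<lambda>x. c t a * u a x)" for t a
    by (auto simp: c_def algebra_simps)
  have E: "energy d \<beta> (u(i := (\<lambda>x. u i x + t * u i x)))
    = 1/2 * (\<Sum>a=1..d. (c t a)\<^sup>2 * dirichlet (u a)) - 1/4 * (\<Sum>a=1..d. \<Sum>b=1..d. (c t a)\<^sup>2 * (c t b)\<^sup>2 * J a b)" for t
  proof -
    have "(\<Sum>a=1..d. dirichlet (\<lambda>x. c t a * u a x)) = (\<Sum>a=1..d. (c t a)\<^sup>2 * dirichlet (u a))"
      using u by (intro sum.cong refl dirichlet_cmult) auto
    moreover have "(\<Sum>a=1..d. \<Sum>b=1..d. \<beta> a b * interaction (\<lambda>x. c t a * u a x) (\<lambda>x. c t b * u b x))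
      = (\<Sum>a=1..d. \<Sum>b=1..d. (c t a)\<^sup>2 * (c t b)\<^sup>2 * J a b)"
      by (intro sum.cong refl) (simp add: interaction_cmult J_def)
    ultimately show ?thesis unfolding energy_eq up by simp
  qed
  have c: "((\<lambda>t. (c t a)\<^sup>2) has_real_derivative del a) (at 0)" for a
    by (cases "a = i") (auto simp: c_def del_def intro!: derivative_eq_intros)
  have c0: "c 0 a = 1" for a by (simp add: c_def)
  have cc: "((\<lambda>t. (c t a)\<^sup>2 * (c t b)\<^sup>2 * J a b) has_real_derivative (del a + del b) * J a b) (at 0)" for a b
    using DERIV_cmult_right[OF DERIV_mult[OF c[of a] c[of b]], of "J a b"] by (simp add: c0)
  have "((\<lambda>t. energy d \<beta> (u(i := (\<lambda>x. u i x + t * u i x)))) has_real_derivative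
    1/2 * (\<Sum>a=1..d. del a * dirichlet (u a)) - 1/4 * (\<Sum>a=1..d. \<Sum>b=1..d. (del a + del b) * J a b)) (at 0)"
    unfolding E by (intro DERIV_diff DERIV_cmult DERIV_sum cc DERIV_cmult_right c)
  then have "partial_energy d \<beta> i u (u i)
    = 1/2 * (\<Sum>a=1..d. del a * dirichlet (u a)) - 1/4 * (\<Sum>a=1..d. \<Sum>b=1..d. (del a + del b) * J a b)"
    unfolding partial_energy_def by (rule DERIV_imp_deriv)
  also have "(\<Sum>a=1..d. del a * dirichlet (u a)) = 2 * dirichlet (u i)"
    using i by (simp add: del_def if_distrib[of "\<lambda>x. x * _"] sum.delta cong: if_cong)
  also have "(\<Sum>a=1..d. \<Sum>b=1..d. (del a + del b) * J a b) = 4 * (\<Sum>b=1..d. J i b)"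
  proof -
    have "(\<Sum>a=1..d. \<Sum>b=1..d. (del a + del b) * J a b) = (\<Sum>a=1..d. \<Sum>b=1..d. del a * J a b) + (\<Sum>a=1..d. \<Sum>b=1..d. del b * J a b)"
      by (simp add: distrib_right sum.distrib)
    \<comment> \<open>Symmetry of the couplings enters here: exchanging the indices turns one half
      of the double sum into the other.\<close>
    also have "(\<Sum>a=1..d. \<Sum>b=1..d. del b * J a b) = (\<Sum>a=1..d. \<Sum>b=1..d. del a * J a b)"
      using J by (subst sum.swap) (intro sum.cong refl, simp)
    also have "(\<Sum>a=1..d. \<Sum>b=1..d. del a * J a b) = (\<Sum>a=1..d. if a = i then 2 * (\<Sum>b=1..d. J i b) else 0)"
      by (intro sum.cong refl) (simp add: del_def sum_distrib_left)
    also have "\<dots> = 2 * (\<Sum>b=1..d. J i b)" using i by simp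
    finally show ?thesis by simp
  qed
  finally show ?thesis by (simp add: J_def)
qed

lemma nehari_iff:
  assumes sym: "\<forall>i\<in>{1..d}. \<forall>j\<in>{1..d}. \<beta> i j = \<beta> j i"
  shows "u \<in> nehari d \<beta> \<longleftrightarrow> (\<forall>i\<in>{1..d}. u i \<in> D12 \<and> nonzero (u i)
    \<and> dirichlet (u i) = (\<Sum>j=1..d. \<beta> i j * interaction (u i) (u j)))"
proof (cases "\<forall>i\<in>{1..d}. u i \<in> D12")
  case True
  then show ?thesis using partial_energy_eq[OF True sym] by (auto simp: nehari_def)
qed (auto simp: nehari_def)

lemma energy_nehari:
  assumes sym: "\<forall>i\<in>{1..d}. \<forall>j\<in>{1..d}. \<beta> i j = \<beta> j i" and u: "u \<in> nehari d \<beta>"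
  shows "energy d \<beta> u = (\<Sum>i=1..d. 1/4 * dirichlet (u i))"
proof -
  have "(\<Sum>i=1..d. \<Sum>j=1..d. \<beta> i j * interaction (u i) (u j)) = (\<Sum>i=1..d. dirichlet (u i))"
    using u unfolding nehari_iff[OF sym] by (intro sum.cong) auto
  then show ?thesis by (simp add: energy_eq sum_divide_distrib[symmetric])
qed

section \<open>The scalar problem\<close>

lemma scalar_level_eq:
  "scalar_level \<beta> h = (INF v\<in>{v \<in> D12. nonzero v \<and> dirichlet v = \<beta> h h * quartic v}. ereal (1/4 * dirichlet v))"
  unfolding scalar_level_def quartic_def by (intro INF_cong) auto

lemma scalar_level_nonneg: "0 \<le> scalar_level \<beta> h"
  unfolding scalar_level_eq
proof (rule INF_greatest)
  fix v show "0 \<le> ereal (1/4 * dirichlet v)" using dirichlet_nonneg[of v] by simp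
qed

text \<open>The multiple sqrt(t) w satisfies the scalar constraint for t = A / (\<beta> B), where
  its energy is the bound. The quotient is invariant under scaling of w, so the level can be
  compared with any nonzero function.\<close>

lemma scalar_level_le:
  assumes w: "w \<in> D12" "nonzero w" and b: "\<beta> h h > 0"
  shows "scalar_level \<beta> h \<le> ereal (1/4 * ((dirichlet w)\<^sup>2 / (\<beta> h h * quartic w)))"
proof -
  have A: "dirichlet w > 0" and B: "quartic w > 0" using dirichlet_pos[OF w] quartic_pos_iff[OF w(1)] w by auto
  define t where "t = dirichlet w / (\<beta> h h * quartic w)"
  have t: "t > 0" using A B b by (simp add: t_def)
  let ?v = "\<lambda>x. sqrt t * w x"
  have s2: "(sqrt t)\<^sup>2 = t" and s4: "sqrt t ^ 4 = t\<^sup>2"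
    using t power_mult[of "sqrt t" 2 2] by auto
  have v: "?v \<in> D12" by (rule D12_cmult_mem[OF w(1)])
  have dv: "dirichlet ?v = t * dirichlet w" unfolding dirichlet_cmult[OF w(1)] s2 ..
  have qv: "quartic ?v = t\<^sup>2 * quartic w" unfolding quartic_cmult s4 ..
  have "nonzero ?v" using quartic_pos_iff[OF v] qv t B by simp
  moreover have "dirichlet ?v = \<beta> h h * quartic ?v"
    unfolding dv qv using A B b by (simp add: t_def power2_eq_square)
  ultimately have "scalar_level \<beta> h \<le> ereal (1/4 * dirichlet ?v)"
    unfolding scalar_level_eq using v by (intro INF_lower) simp
  also have "1/4 * dirichlet ?v = 1/4 * ((dirichlet w)\<^sup>2 / (\<beta> h h * quartic w))"
    unfolding dv by (simp add: t_def power2_eq_square)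
  finally show ?thesis .
qed

section \<open>The variational inequality of a minimiser\<close>

lemma nonneg_linear_imp_nonneg:
  fixes a b :: real
  assumes "\<And>t. t > 0 \<Longrightarrow> 0 \<le> a + t * b" "b \<ge> 0"
  shows "0 \<le> a"
proof (rule ccontr)
  assume "\<not> 0 \<le> a"
  then have a: "a < 0" by simp
  \<comment> \<open>Chosen so that t (b + 1) = -a/2, whence a + t b \<le> a/2 < 0; the summand 1
    keeps the denominator positive when b = 0.\<close>
  define t where "t = - a / (2 * (b + 1))"
  have "t > 0" unfolding t_def using a assms(2) by (intro divide_pos_pos) auto
  moreover have "t * b \<le> t * (b + 1)" using \<open>t > 0\<close> by simp
  moreover have "t * (b + 1) = - a / 2" using assms(2) by (simp add: t_def field_simps)
  ultimately show False using assms(1)[of t] a by simp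
qed

lemma inner_test_gradient:
  assumes G: "is_weak_gradient u G" and f: "test_function f"
  shows "integrable lborel (\<lambda>x. G x \<bullet> (\<chi> k. pderiv_at k f x))"
    and "(\<integral>x. G x \<bullet> (\<chi> k. pderiv_at k f x) \<partial>lborel) = - (\<integral>x. u x * laplacian f x \<partial>lborel)"
proof -
  note D = is_weak_gradientD[OF G]
  have i: "integrable lborel (\<lambda>x. G x $ k * pderiv_at k f x)" for k
    by (intro locally_integrable_mult_test D test_function_pderiv f)
  have j: "integrable lborel (\<lambda>x. u x * pderiv_at k (pderiv_at k f) x)" for k
    by (intro locally_integrable_mult_test D test_function_pderiv f)
  have e: "G x \<bullet> (\<chi> k. pderiv_at k f x) = (\<Sum>k\<in>UNIV. G x $ k * pderiv_at k f x)" for x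
    by (simp add: inner_vec_def)
  show "integrable lborel (\<lambda>x. G x \<bullet> (\<chi> k. pderiv_at k f x))"
    unfolding e by (intro Bochner_Integration.integrable_sum i)
  have "(\<integral>x. u x * laplacian f x \<partial>lborel) = (\<Sum>k\<in>UNIV. \<integral>x. u x * pderiv_at k (pderiv_at k f) x \<partial>lborel)"
    unfolding laplacian_def sum_distrib_left using j by (intro Bochner_Integration.integral_sum)
  also have "\<dots> = - (\<Sum>k\<in>UNIV. \<integral>x. G x $ k * pderiv_at k f x \<partial>lborel)"
    unfolding sum_negf[symmetric] by (intro sum.cong refl D(4) test_function_pderiv f)
  also have "(\<Sum>k\<in>UNIV. \<integral>x. G x $ k * pderiv_at k f x \<partial>lborel) = (\<integral>x. G x \<bullet> (\<chi> k. pderiv_at k f x) \<partial>lborel)"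
    unfolding e using i by (intro Bochner_Integration.integral_sum[symmetric])
  finally show "(\<integral>x. G x \<bullet> (\<chi> k. pderiv_at k f x) \<partial>lborel) = - (\<integral>x. u x * laplacian f x \<partial>lborel)" by simp
qed

lemma power2_norm_add_scaleR:
  "(norm (a + t *\<^sub>R b))\<^sup>2 = ((norm a)\<^sup>2 + 2 * t * (a \<bullet> b)) + t\<^sup>2 * (norm b)\<^sup>2"
proof -
  have "(a + t *\<^sub>R b) \<bullet> (a + t *\<^sub>R b) = (a \<bullet> a + 2 * t * (a \<bullet> b)) + t\<^sup>2 * (b \<bullet> b)"
    using inner_commute[of b a] by (simp add: inner_add_left inner_add_right power2_eq_square distrib_left)
  then show ?thesis by (simp only: power2_norm_eq_inner)
qed

lemma dirichlet_add_test:
  assumes u: "u \<in> D12" and f: "test_function f"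
  shows "dirichlet (\<lambda>x. u x + t * f x) = dirichlet u - 2 * t * (\<integral>x. u x * laplacian f x \<partial>lborel) + t\<^sup>2 * dirichlet f"
proof -
  obtain G where G: "is_weak_gradient u G" "integrable lborel (\<lambda>x. (norm (G x))\<^sup>2)"
    "dirichlet u = (\<integral>x. (norm (G x))\<^sup>2 \<partial>lborel)" using D12E[OF u] by blast
  let ?D = "\<lambda>x. \<chi> k. pderiv_at k f x"
  have F: "is_weak_gradient f ?D" by (rule is_weak_gradient_test[OF f])
  have iF: "integrable lborel (\<lambda>x. (norm (?D x))\<^sup>2)"
  proof -
    \<comment> \<open>\<open>D12_test\<close> gives square integrability of some weak gradient;
      uniqueness carries it over to the classical one.\<close>
    obtain H where H: "is_weak_gradient f H" "integrable lborel (\<lambda>x. (norm (H x))\<^sup>2)" using D12E[OF D12_test[OF f]] by blast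
    have [measurable]: "?D \<in> borel_measurable borel"
      using is_weak_gradientD(2)[OF F] by (simp add: locally_integrable_def)
    have "AE x in lborel. (norm (H x))\<^sup>2 = (norm (?D x))\<^sup>2"
      using is_weak_gradient_unique[OF H(1) F] by eventually_elim simp
    moreover have "(\<lambda>x. (norm (?D x))\<^sup>2) \<in> borel_measurable lborel" by simp
    ultimately show ?thesis using integrable_cong_AE_imp[OF H(2)] by blast
  qed
  have "dirichlet (\<lambda>x. u x + t * f x) = (\<integral>x. (norm (G x + t *\<^sub>R ?D x))\<^sup>2 \<partial>lborel)"
    by (rule dirichlet_eq[OF is_weak_gradient_add[OF G(1) is_weak_gradient_cmult[OF F]]])
  also have "\<dots> = (\<integral>x. ((norm (G x))\<^sup>2 + 2 * t * (G x \<bullet> ?D x)) + t\<^sup>2 * (norm (?D x))\<^sup>2 \<partial>lborel)"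
    by (simp only: power2_norm_add_scaleR)
  also have "\<dots> = dirichlet u + 2 * t * (\<integral>x. G x \<bullet> ?D x \<partial>lborel) + t\<^sup>2 * dirichlet f"
    using G(2) iF inner_test_gradient(1)[OF G(1) f] by (simp add: G(3) dirichlet_eq[OF F])
  finally show ?thesis unfolding inner_test_gradient(2)[OF G(1) f] by simp
qed

text \<open>Adding t f with f \<ge> 0 to |u| cannot decrease B, so minimality of A^2/B forces A not
  to decrease either. The term of A linear in t is -2t times the integral of |u| against the
  Laplacian of f; dividing by t and letting t tend to 0 gives its sign.\<close>

lemma minimizer_superharmonic:
  assumes u: "u \<in> D12" "nonzero u"
    and min: "\<And>w. w \<in> D12 \<Longrightarrow> nonzero w \<Longrightarrow> (dirichlet u)\<^sup>2 / quartic u \<le> (dirichlet w)\<^sup>2 / quartic w"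
  shows "weakly_superharmonic (\<lambda>x. \<bar>u x\<bar>)"
  unfolding weakly_superharmonic_def
proof (intro conjI allI impI)
  let ?U = "\<lambda>x. \<bar>u x\<bar>"
  have U: "?U \<in> D12" and dU: "dirichlet ?U = dirichlet u" using D12_abs[OF u(1)] by auto
  have qU: "quartic ?U = quartic u" by (simp add: quartic_def)
  show "locally_integrable ?U" using D12E[OF U] is_weak_gradientD(1) by blast
  fix f assume f: "test_function f" and pos: "\<forall>x. 0 \<le> f x"
  have "0 \<le> - 2 * (\<integral>x. ?U x * laplacian f x \<partial>lborel) + t * dirichlet f" if t: "t > 0" for t
  proof -
    let ?w = "\<lambda>x. ?U x + t * f x"
    have w: "?w \<in> D12" by (intro D12_add_mem[OF U] D12_cmult_mem D12_test f)
    have q: "quartic ?U \<le> quartic ?w"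
      unfolding quartic_def using t pos
      by (intro Bochner_Integration.integral_mono D12_integrable4 U w power_mono) auto
    have qu: "quartic u > 0" using quartic_pos_iff[OF u(1)] u(2) by simp
    then have qw: "quartic ?w > 0" using q qU by simp
    then have "nonzero ?w" using quartic_pos_iff[OF w] by simp
    from min[OF w this] have "(dirichlet u)\<^sup>2 * quartic ?w \<le> (dirichlet ?w)\<^sup>2 * quartic u"
      using qu qw by (simp add: field_simps)
    moreover have "(dirichlet u)\<^sup>2 * quartic u \<le> (dirichlet u)\<^sup>2 * quartic ?w"
      using q qU by (intro mult_left_mono) auto
    ultimately have "(dirichlet u)\<^sup>2 * quartic u \<le> (dirichlet ?w)\<^sup>2 * quartic u" by linarith
    then have "(dirichlet u)\<^sup>2 \<le> (dirichlet ?w)\<^sup>2" using qu by simp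
    then have "dirichlet ?U \<le> dirichlet ?w"
      unfolding dU using power2_le_imp_le dirichlet_nonneg by blast
    then have "0 \<le> t * (- 2 * (\<integral>x. ?U x * laplacian f x \<partial>lborel) + t * dirichlet f)"
      unfolding dirichlet_add_test[OF U f] by (simp add: algebra_simps power2_eq_square)
    then show ?thesis using t by (simp add: zero_le_mult_iff)
  qed
  from nonneg_linear_imp_nonneg[OF this dirichlet_nonneg]
  show "(\<integral>x. ?U x * laplacian f x \<partial>lborel) \<le> 0" by simp
qed

section \<open>Separating the components by translations\<close>

lemma quartic_tail_tendsto_0:
  assumes "u \<in> D12"
  shows "(\<lambda>n. \<integral>x. indicator {x. real n \<le> 2 * norm x} x * u x ^ 4 \<partial>lborel) \<longlonglongrightarrow> 0"
proof -
  have [measurable]: "u \<in> borel_measurable borel" using assms by (rule D12_measurable)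
  have [measurable]: "{x::R4. real n \<le> 2 * norm x} \<in> sets borel" for n
    by (intro borel_closed closed_Collect_le continuous_intros)
  have "(\<lambda>n. \<integral>x. indicator {x. real n \<le> 2 * norm x} x * u x ^ 4 \<partial>lborel) \<longlonglongrightarrow> (\<integral>x. 0 \<partial>(lborel :: R4 measure))"
  proof (rule integral_dominated_convergence[OF _ _ D12_integrable4[OF assms]])
    show "AE x in lborel. (\<lambda>n. indicator {x. real n \<le> 2 * norm x} x * u x ^ 4) \<longlonglongrightarrow> 0"
    proof (rule AE_I2)
      fix x :: R4
      obtain N where N: "2 * norm x < real N" using reals_Archimedean2 by blast
      have "eventually (\<lambda>n. indicator {x. real n \<le> 2 * norm x} x * u x ^ 4 = 0) sequentially"
        unfolding eventually_sequentially using N by (intro exI[of _ N]) (auto simp: indicator_def)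
      then show "(\<lambda>n. indicator {x. real n \<le> 2 * norm x} x * u x ^ 4) \<longlonglongrightarrow> 0" by (rule tendsto_eventually)
    qed
  qed (auto simp: indicator_def)
  then show ?thesis by simp
qed

lemma young_epsilon: "p * q \<le> e * p\<^sup>2 + (1/e) * q\<^sup>2" if "e > 0" for p q e :: real
proof -
  have "0 \<le> (e * p - q)\<^sup>2 + (e * p)\<^sup>2 + q\<^sup>2" by simp
  then have "2 * e * (p * q) \<le> 2 * e * (e * p\<^sup>2 + (1/e) * q\<^sup>2)"
    using that by (simp add: power2_eq_square algebra_simps)
  then show ?thesis using that by simp
qed

text \<open>Since the shift is at least n, at each x one of the two arguments has norm at least n/2.
  Young's inequality puts the large factor 1/e on the function evaluated in its tail and the small
  factor e on the other one, whose total mass is fixed.\<close>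

lemma interaction_far_tendsto_0:
  assumes u: "u \<in> D12" and v: "v \<in> D12" and c: "\<And>n. real n \<le> norm (c n)"
  shows "(\<lambda>n. interaction u (\<lambda>x. v (c n + x))) \<longlonglongrightarrow> 0"
proof (rule tendstoI)
  fix e0 :: real assume e0: "e0 > 0"
  \<comment> \<open>The summand 1 makes S positive, so that e = e0 / (2 S) is defined and the part
    with factor e costs at most e0/2.\<close>
  define S where "S = quartic u + quartic v + 1"
  have S: "S > 0" using quartic_nonneg[of u] quartic_nonneg[of v] by (simp add: S_def)
  define e where "e = e0 / (2 * S)"
  have e: "e > 0" using e0 S by (simp add: e_def)
  have [measurable]: "u \<in> borel_measurable borel" "v \<in> borel_measurable borel" using u v by (auto intro: D12_measurable)
  let ?T = "\<lambda>w n. \<integral>x. indicator {x. real n \<le> 2 * norm x} x * w x ^ 4 \<partial>lborel"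
  have [measurable]: "{x::R4. real n \<le> 2 * norm x} \<in> sets borel" for n
    by (intro borel_closed closed_Collect_le continuous_intros)
  have bound: "interaction u (\<lambda>x. v (c n + x)) \<le> e * (quartic u + quartic v) + (1/e) * (?T u n + ?T v n)" for n
  proof -
    let ?I = "\<lambda>x. indicator {x::R4. real n \<le> 2 * norm x} x :: real"
    have iu: "integrable lborel (\<lambda>x. u x ^ 4)" and iv: "integrable lborel (\<lambda>x. v x ^ 4)"
      using u v by (auto intro: D12_integrable4)
    have iIu: "integrable lborel (\<lambda>x. ?I x * u x ^ 4)" and iIv: "integrable lborel (\<lambda>x. ?I x * v x ^ 4)"
      using integrable_mult_indicator[OF _ iu, of "{x. real n \<le> 2 * norm x}"] integrable_mult_indicator[OF _ iv, of "{x. real n \<le> 2 * norm x}"] by simp_all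
    note sv = lborel_integrable_shift[OF iv, of "c n"] and sIv = lborel_integrable_shift[OF iIv, of "c n"]
    have "interaction u (\<lambda>x. v (c n + x)) \<le> (\<integral>x. (e * (u x ^ 4) + e * (v (c n + x) ^ 4))
        + ((1/e) * (?I x * u x ^ 4) + (1/e) * (?I (c n + x) * v (c n + x) ^ 4)) \<partial>lborel)"
      unfolding interaction_def
    proof (rule Bochner_Integration.integral_mono)
      show "integrable lborel (\<lambda>x. (u x)\<^sup>2 * (v (c n + x))\<^sup>2)"
        by (intro interaction_integrable u D12_shift_mem v)
      show "integrable lborel (\<lambda>x. (e * (u x ^ 4) + e * (v (c n + x) ^ 4))
        + ((1/e) * (?I x * u x ^ 4) + (1/e) * (?I (c n + x) * v (c n + x) ^ 4)))"
        by (intro Bochner_Integration.integrable_add integrable_mult_right iu sv iIu sIv)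
      fix x
      have p4: "((u x)\<^sup>2)\<^sup>2 = u x ^ 4" "((v (c n + x))\<^sup>2)\<^sup>2 = v (c n + x) ^ 4" by (simp_all add: power_mult[symmetric])
      have "norm (c n) \<le> norm (c n + x) + norm x" by (metis add_diff_cancel norm_triangle_ineq4)
      then consider "real n \<le> 2 * norm x" | "real n \<le> 2 * norm (c n + x)" using c[of n] by linarith
      then show "(u x)\<^sup>2 * (v (c n + x))\<^sup>2 \<le> (e * (u x ^ 4) + e * (v (c n + x) ^ 4))
        + ((1/e) * (?I x * u x ^ 4) + (1/e) * (?I (c n + x) * v (c n + x) ^ 4))"
      proof cases
        case 1
        have "(u x)\<^sup>2 * (v (c n + x))\<^sup>2 \<le> e * v (c n + x) ^ 4 + (1/e) * u x ^ 4"
          using young_epsilon[OF e, of "(v (c n + x))\<^sup>2" "(u x)\<^sup>2"] unfolding p4 by (simp only: mult.commute[of "(u x)\<^sup>2"])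
        also have "\<dots> = e * v (c n + x) ^ 4 + (1/e) * (?I x * u x ^ 4)" using 1 by simp
        finally show ?thesis using e by (smt (verit) divide_nonneg_nonneg indicator_pos_le mult_nonneg_nonneg zero_le_even_power even_numeral)
      next
        case 2
        have "(u x)\<^sup>2 * (v (c n + x))\<^sup>2 \<le> e * u x ^ 4 + (1/e) * v (c n + x) ^ 4"
          using young_epsilon[OF e, of "(u x)\<^sup>2" "(v (c n + x))\<^sup>2"] unfolding p4 .
        also have "\<dots> = e * u x ^ 4 + (1/e) * (?I (c n + x) * v (c n + x) ^ 4)" using 2 by simp
        finally show ?thesis using e by (smt (verit) divide_nonneg_nonneg indicator_pos_le mult_nonneg_nonneg zero_le_even_power even_numeral)
      qed
    qed
    also have "\<dots> = (e * quartic u + e * (\<integral>x. v (c n + x) ^ 4 \<partial>lborel))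
        + ((1/e) * ?T u n + (1/e) * (\<integral>x. ?I (c n + x) * v (c n + x) ^ 4 \<partial>lborel))"
      using iu sv iIu sIv by (simp add: quartic_def)
    also have "(\<integral>x. v (c n + x) ^ 4 \<partial>lborel) = quartic v"
      unfolding quartic_def by (rule lborel_integral_shift[of "\<lambda>x. v x ^ 4"]) measurable
    also have "(\<integral>x. ?I (c n + x) * v (c n + x) ^ 4 \<partial>lborel) = ?T v n"
      by (rule lborel_integral_shift[of "\<lambda>x. ?I x * v x ^ 4"]) measurable
    finally show ?thesis by (simp add: algebra_simps add_divide_distrib)
  qed
  have "(\<lambda>n. (1/e) * (?T u n + ?T v n)) \<longlonglongrightarrow> (1/e) * (0 + 0)"
    by (intro tendsto_intros quartic_tail_tendsto_0 u v)
  then have "eventually (\<lambda>n. (1/e) * (?T u n + ?T v n) < e0 / 2) sequentially"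
    using e0 by (intro order_tendstoD(2)[where a="e0/2"]) auto
  then show "eventually (\<lambda>n. dist (interaction u (\<lambda>x. v (c n + x))) 0 < e0) sequentially"
  proof eventually_elim
    case (elim n)
    have "e * (quartic u + quartic v) \<le> e * S" using e by (simp add: S_def)
    also have "\<dots> = e0 / 2" using S by (simp add: e_def)
    finally show ?case unfolding dist_real_def
      using bound[of n] elim interaction_nonneg[of u "\<lambda>x. v (c n + x)"] by linarith
  qed
qed

text \<open>Fixed-point iteration from the constant 1. Nonnegativity of K makes the iterates
  increase, and row sums at most e \<le> 1/2 preserve the bound 1 + 2e because e (1 + 2e) \<le> 2e.
  The monotone limits solve the system, with positivity and the bound read off.\<close>

lemma diagonally_dominant_solution:
  fixes K :: "'i \<Rightarrow> 'i \<Rightarrow> real"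
  assumes K: "\<And>i j. i \<in> S \<Longrightarrow> j \<in> S \<Longrightarrow> 0 \<le> K i j" and s: "\<And>i. i \<in> S \<Longrightarrow> (\<Sum>j\<in>S. K i j) \<le> e"
    and e: "0 \<le> e" "e \<le> 1/2"
  shows "\<exists>t. \<forall>i\<in>S. 1 \<le> t i \<and> t i \<le> 1 + 2 * e \<and> t i = 1 + (\<Sum>j\<in>S. K i j * t j)"
proof -
  define T where "T = (\<lambda>n. ((\<lambda>t i. 1 + (\<Sum>j\<in>S. K i j * t j)) ^^ n) (\<lambda>i. 1))"
  have T0: "T 0 i = 1" and TS: "T (Suc n) i = 1 + (\<Sum>j\<in>S. K i j * T n j)" for n i
    by (simp_all add: T_def)
  have b: "i \<in> S \<Longrightarrow> 1 \<le> T n i \<and> T n i \<le> 1 + 2 * e" for n i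
  proof (induction n arbitrary: i)
    case 0
    then show ?case using e by (simp add: T0)
  next
    case (Suc n)
    have "(\<Sum>j\<in>S. K i j * T n j) \<le> (\<Sum>j\<in>S. K i j * (1 + 2 * e))"
      using Suc K by (intro sum_mono mult_left_mono) auto
    also have "\<dots> = (\<Sum>j\<in>S. K i j) * (1 + 2 * e)" by (simp add: sum_distrib_right)
    also have "\<dots> \<le> e * (1 + 2 * e)" using s[OF Suc.prems] e by (intro mult_right_mono) auto
    also have "\<dots> \<le> e * 2" using e by (intro mult_left_mono) auto
    finally have "(\<Sum>j\<in>S. K i j * T n j) \<le> 2 * e" by simp
    moreover have "0 \<le> (\<Sum>j\<in>S. K i j * T n j)"
      using Suc.IH K Suc.prems by (intro sum_nonneg mult_nonneg_nonneg) (auto intro: order_trans[OF zero_le_one])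
    ultimately show ?case by (simp add: TS)
  qed
  have mono: "i \<in> S \<Longrightarrow> T n i \<le> T (Suc n) i" for n i
  proof (induction n arbitrary: i)
    case 0
    then show ?case using b[of i "Suc 0"] by (simp only: T0)
  next
    case (Suc n)
    have "(\<Sum>j\<in>S. K i j * T n j) \<le> (\<Sum>j\<in>S. K i j * T (Suc n) j)"
      by (intro sum_mono mult_left_mono Suc.IH K Suc.prems) auto
    then show ?case by (simp only: TS[of n] TS[of "Suc n"] add_left_mono)
  qed
  have "\<exists>L. (\<lambda>n. T n i) \<longlonglongrightarrow> L" if "i \<in> S" for i
  proof -
    have "incseq (\<lambda>n. T n i)" using mono[OF that] by (simp add: incseq_Suc_iff)
    then show ?thesis using incseq_convergent[of "\<lambda>n. T n i" "1 + 2 * e"] b[OF that] by blast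
  qed
  then obtain t where t: "\<And>i. i \<in> S \<Longrightarrow> (\<lambda>n. T n i) \<longlonglongrightarrow> t i" by metis
  show ?thesis
  proof (intro exI[of _ t] ballI conjI)
    fix i assume i: "i \<in> S"
    show "1 \<le> t i" using t[OF i] b[OF i] by (intro LIMSEQ_le_const) auto
    show "t i \<le> 1 + 2 * e" using t[OF i] b[OF i] by (intro LIMSEQ_le_const2) auto
    have "(\<lambda>n. 1 + (\<Sum>j\<in>S. K i j * T n j)) \<longlonglongrightarrow> 1 + (\<Sum>j\<in>S. K i j * t j)"
      by (intro tendsto_add tendsto_const tendsto_sum tendsto_mult t)
    then have "(\<lambda>n. T (Suc n) i) \<longlonglongrightarrow> 1 + (\<Sum>j\<in>S. K i j * t j)" by (simp only: TS)
    from LIMSEQ_unique[OF LIMSEQ_Suc[OF t[OF i]] this] show "t i = 1 + (\<Sum>j\<in>S. K i j * t j)" .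
  qed
qed


text \<open>Put u_i = sqrt(t_i) w_i with w_i a translate of v_i. Interactions are quadratic in each
  component, so division by t_i A(v_i) makes the Nehari equations linear: t_i = 1 + sum_j K_ij t_j.
  The coefficient of t_i is 1 because v_i satisfies the scalar constraint; K_ij is nonnegative for
  nonpositive couplings and small for distant translates. The energy is a quarter of the sum of t_i
  A(v_i).\<close>

lemma nehari_near_scalar_minimizers:
  assumes sym: "\<forall>i\<in>{1..d}. \<forall>j\<in>{1..d}. \<beta> i j = \<beta> j i"
    and off: "\<forall>i\<in>{1..d}. \<forall>j\<in>{1..d}. i \<noteq> j \<longrightarrow> \<beta> i j \<le> 0"
    and v: "\<And>h. h \<in> {1..d} \<Longrightarrow> v h \<in> D12" "\<And>h. h \<in> {1..d} \<Longrightarrow> nonzero (v h)"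
      "\<And>h. h \<in> {1..d} \<Longrightarrow> dirichlet (v h) = \<beta> h h * quartic (v h)"
    and e: "0 < e" "e \<le> 1/2"
  shows "\<exists>u\<in>nehari d \<beta>. energy d \<beta> u \<le> (1 + 2 * e) * (\<Sum>h=1..d. 1/4 * dirichlet (v h))"
proof -
  let ?S = "{1..d}"
  \<comment> \<open>Multiples of n along one axis place the components i and j at distance n |i - j|
    \<ge> n from each other.\<close>
  define w where "w = (\<lambda>n i x. v i ((real n * real i) *\<^sub>R (axis 1 1 :: R4) + x))"
  have A: "dirichlet (v i) > 0" if "i \<in> ?S" for i using dirichlet_pos v(1,2) that by blast
  have w: "w n i \<in> D12" "dirichlet (w n i) = dirichlet (v i)" if "i \<in> ?S" for n i
    unfolding w_def using D12_shift_mem[OF v(1)[OF that]] dirichlet_shift[OF v(1)[OF that]] by auto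
  have wq: "quartic (w n i) = quartic (v i)" if "i \<in> ?S" for n i
    unfolding w_def quartic_def
    by (rule lborel_integral_shift[of "\<lambda>x. v i x ^ 4"]) (use D12_measurable[OF v(1)[OF that]] in measurable)
  define K where "K = (\<lambda>n i j. if i = j then 0 else - \<beta> i j * interaction (w n i) (w n j) / dirichlet (v i))"
  have Ilim: "(\<lambda>n. interaction (w n i) (w n j)) \<longlonglongrightarrow> 0" if ij: "i \<in> ?S" "j \<in> ?S" "i \<noteq> j" for i j
  proof -
    let ?c = "\<lambda>n. (real n * (real j - real i)) *\<^sub>R (axis 1 1 :: R4)"
    have "interaction (w n i) (w n j) = interaction (v i) (\<lambda>x. v j (?c n + x))" for n
    proof -
      have [measurable]: "v i \<in> borel_measurable borel" "v j \<in> borel_measurable borel"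
        using v(1) ij by (auto intro: D12_measurable)
      have "?c n + ((real n * real i) *\<^sub>R axis 1 1 + x) = (real n * real j) *\<^sub>R axis 1 1 + x" for x
        by (simp add: right_diff_distrib scaleR_diff_left)
      then have "interaction (w n i) (w n j) = (\<integral>x. (v i ((real n * real i) *\<^sub>R axis 1 1 + x))\<^sup>2
          * (v j (?c n + ((real n * real i) *\<^sub>R axis 1 1 + x)))\<^sup>2 \<partial>lborel)"
        by (simp only: interaction_def w_def)
      also have "\<dots> = interaction (v i) (\<lambda>x. v j (?c n + x))"
        unfolding interaction_def
        by (rule lborel_integral_shift[of "\<lambda>x. (v i x)\<^sup>2 * (v j (?c n + x))\<^sup>2"]) measurable
      finally show ?thesis .
    qed
    moreover have "(\<lambda>n. interaction (v i) (\<lambda>x. v j (?c n + x))) \<longlonglongrightarrow> 0"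
    proof (rule interaction_far_tendsto_0)
      fix n
      have "1 \<le> \<bar>real j - real i\<bar>" using ij(3) by linarith
      then have "real n * 1 \<le> real n * \<bar>real j - real i\<bar>" by (intro mult_left_mono) auto
      then show "real n \<le> norm (?c n)" by (simp add: norm_axis_1 abs_mult)
    qed (use v(1) ij in auto)
    ultimately show ?thesis by simp
  qed
  have "(\<lambda>n. \<Sum>j\<in>?S. K n i j) \<longlonglongrightarrow> (\<Sum>j\<in>?S. 0)" if i: "i \<in> ?S" for i
  proof (rule tendsto_sum)
    fix j assume j: "j \<in> ?S"
    show "(\<lambda>n. K n i j) \<longlonglongrightarrow> 0"
    proof (cases "i = j")
      case False
      then have "(\<lambda>n. (- \<beta> i j / dirichlet (v i)) * interaction (w n i) (w n j)) \<longlonglongrightarrow> 0"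
        using Ilim[OF i j] by (intro tendsto_mult_right_zero)
      then show ?thesis using False by (simp add: K_def)
    qed (simp add: K_def)
  qed
  then have "eventually (\<lambda>n. (\<Sum>j\<in>?S. K n i j) < e) sequentially" if "i \<in> ?S" for i
    using order_tendstoD(2)[of _ 0 sequentially e] that e by simp
  then have "eventually (\<lambda>n. \<forall>i\<in>?S. (\<Sum>j\<in>?S. K n i j) < e) sequentially"
    by (intro eventually_ball_finite) auto
  then obtain n where "\<forall>i\<in>?S. (\<Sum>j\<in>?S. K n i j) < e"
    using eventually_happens'[OF sequentially_bot] by blast
  then have n: "\<And>i. i \<in> ?S \<Longrightarrow> (\<Sum>j\<in>?S. K n i j) \<le> e" by (simp add: less_imp_le)
  have K0: "0 \<le> K n i j" if "i \<in> ?S" "j \<in> ?S" for i j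
  proof (cases "i = j")
    case False
    then have "0 \<le> - \<beta> i j" using off that by auto
    then show ?thesis
      using False A[OF that(1)] interaction_nonneg[of "w n i" "w n j"]
      unfolding K_def by (simp only: if_False) (intro divide_nonneg_pos mult_nonneg_nonneg)
  qed (simp add: K_def)
  obtain t where t: "\<And>i. i \<in> ?S \<Longrightarrow> 1 \<le> t i" "\<And>i. i \<in> ?S \<Longrightarrow> t i \<le> 1 + 2 * e"
    "\<And>i. i \<in> ?S \<Longrightarrow> t i = 1 + (\<Sum>j\<in>?S. K n i j * t j)"
  proof -
    have "\<exists>t. \<forall>i\<in>?S. 1 \<le> t i \<and> t i \<le> 1 + 2 * e \<and> t i = 1 + (\<Sum>j\<in>?S. K n i j * t j)"
      by (rule diagonally_dominant_solution[OF K0 n less_imp_le[OF e(1)] e(2)])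
    then show ?thesis using that by blast
  qed
  define u where "u = (\<lambda>i x. sqrt (t i) * w n i x)"
  have s2: "(sqrt (t i))\<^sup>2 = t i" if "i \<in> ?S" for i using t(1)[OF that] by simp
  have du: "dirichlet (u i) = t i * dirichlet (v i)" if "i \<in> ?S" for i
    unfolding u_def dirichlet_cmult[OF w(1)[OF that]] s2[OF that] w(2)[OF that] ..
  have uD: "u i \<in> D12" if "i \<in> ?S" for i unfolding u_def by (intro D12_cmult_mem w that)
  have "u \<in> nehari d \<beta>"
    unfolding nehari_iff[OF sym]
  proof (intro ballI conjI uD)
    fix i assume i: "i \<in> ?S"
    have "quartic (u i) > 0"
      unfolding u_def quartic_cmult wq[OF i] using t(1)[OF i] quartic_pos_iff[OF v(1)[OF i]] v(2)[OF i] by simp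
    then show "nonzero (u i)" using quartic_pos_iff[OF uD[OF i]] by simp
    have "(\<Sum>j\<in>?S. \<beta> i j * interaction (u i) (u j))
      = (\<Sum>j\<in>?S. t i * dirichlet (v i) * ((if j = i then t i else 0) - K n i j * t j))"
    proof (rule sum.cong[OF refl])
      fix j assume j: "j \<in> ?S"
      have I: "interaction (u i) (u j) = t i * t j * interaction (w n i) (w n j)"
        unfolding u_def interaction_cmult s2[OF i] s2[OF j] ..
      show "\<beta> i j * interaction (u i) (u j) = t i * dirichlet (v i) * ((if j = i then t i else 0) - K n i j * t j)"
      proof (cases "j = i")
        case True
        then show ?thesis unfolding I using v(3)[OF i] by (simp add: K_def interaction_self wq[OF i])
      next
        case False
        then show ?thesis unfolding I using A[OF i] by (simp add: K_def)
      qed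
    qed
    also have "\<dots> = t i * dirichlet (v i) * ((\<Sum>j\<in>?S. if j = i then t i else 0) - (\<Sum>j\<in>?S. K n i j * t j))"
      by (simp only: sum_distrib_left[symmetric] sum_subtractf)
    also have "\<dots> = t i * dirichlet (v i)" using t(3)[OF i] i by simp
    finally show "dirichlet (u i) = (\<Sum>j\<in>?S. \<beta> i j * interaction (u i) (u j))" using du[OF i] by simp
  qed
  moreover have "energy d \<beta> u \<le> (1 + 2 * e) * (\<Sum>h=1..d. 1/4 * dirichlet (v h))"
    unfolding energy_nehari[OF sym calculation] sum_distrib_left
  proof (rule sum_mono)
    fix i assume i: "i \<in> ?S"
    have "t i * dirichlet (v i) \<le> (1 + 2 * e) * dirichlet (v i)"
      using t(2)[OF i] A[OF i] by (intro mult_right_mono) auto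
    then show "1/4 * dirichlet (u i) \<le> (1 + 2 * e) * (1/4 * dirichlet (v i))" using du[OF i] by simp
  qed
  ultimately show ?thesis by blast
qed

lemma level_le_sum_scalar_levels:
  assumes sym: "\<forall>i\<in>{1..d}. \<forall>j\<in>{1..d}. \<beta> i j = \<beta> j i"
    and off: "\<forall>i\<in>{1..d}. \<forall>j\<in>{1..d}. i \<noteq> j \<longrightarrow> \<beta> i j \<le> 0"
  shows "level d \<beta> \<le> (\<Sum>h=1..d. scalar_level \<beta> h)"
\<comment> \<open>An infinite scalar level means an empty constraint set; the sum on the right is
  then infinite, the other levels being nonnegative.\<close>
proof (cases "\<exists>h\<in>{1..d}. scalar_level \<beta> h = \<infinity>")
  case True
  then have "(\<Sum>h=1..d. scalar_level \<beta> h) = \<infinity>"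
    using scalar_level_nonneg by (subst sum_Pinfty) auto
  then show ?thesis by simp
next
  case False
  define L where "L = (\<lambda>h. real_of_ereal (scalar_level \<beta> h))"
  have L: "scalar_level \<beta> h = ereal (L h)" if "h \<in> {1..d}" for h
    using False that scalar_level_nonneg[of \<beta> h] by (auto simp: L_def ereal_real)
  define s where "s = (\<Sum>h=1..d. L h)"
  have bound: "level d \<beta> \<le> ereal ((1 + 2 * e) * (s + real d * e))" if e: "0 < e" "e \<le> 1/2" for e
  proof -
    have "\<exists>v. v \<in> D12 \<and> nonzero v \<and> dirichlet v = \<beta> h h * quartic v \<and> 1/4 * dirichlet v \<le> L h + e" if h: "h \<in> {1..d}" for h
    proof -
      have "scalar_level \<beta> h < ereal (L h + e)" using L[OF h] e by simp
      then show ?thesis unfolding scalar_level_eq INF_less_iff by (auto simp: less_imp_le)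
    qed
    then obtain v where v: "\<And>h. h \<in> {1..d} \<Longrightarrow> v h \<in> D12" "\<And>h. h \<in> {1..d} \<Longrightarrow> nonzero (v h)"
      "\<And>h. h \<in> {1..d} \<Longrightarrow> dirichlet (v h) = \<beta> h h * quartic (v h)"
      "\<And>h. h \<in> {1..d} \<Longrightarrow> 1/4 * dirichlet (v h) \<le> L h + e" by metis
    obtain u where u: "u \<in> nehari d \<beta>" "energy d \<beta> u \<le> (1 + 2 * e) * (\<Sum>h=1..d. 1/4 * dirichlet (v h))"
      using nehari_near_scalar_minimizers[OF sym off v(1-3) e] by blast
    have "level d \<beta> \<le> ereal (energy d \<beta> u)" unfolding level_def by (rule INF_lower[OF u(1)])
    also have "(\<Sum>h=1..d. 1/4 * dirichlet (v h)) \<le> (\<Sum>h=1..d. L h + e)" by (intro sum_mono v)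
    then have "(1 + 2 * e) * (\<Sum>h=1..d. 1/4 * dirichlet (v h)) \<le> (1 + 2 * e) * (s + real d * e)"
      using e by (intro mult_left_mono) (auto simp: s_def sum.distrib)
    then have "ereal (energy d \<beta> u) \<le> ereal ((1 + 2 * e) * (s + real d * e))" using u(2) by simp
    finally show ?thesis .
  qed
  \<comment> \<open>The sequence e = 1/(n + 2) satisfies e \<le> 1/2 from its first term on.\<close>
  have "(\<lambda>n. ereal ((1 + 2 * (1 / real (Suc (Suc n)))) * (s + real d * (1 / real (Suc (Suc n))))))
    \<longlonglongrightarrow> ereal ((1 + 2 * 0) * (s + real d * 0))"
    unfolding lim_ereal by (intro tendsto_intros LIMSEQ_Suc lim_1_over_n)
  then have "level d \<beta> \<le> ereal ((1 + 2 * 0) * (s + real d * 0))"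
    by (rule LIMSEQ_le_const) (intro exI[of _ 0] allI impI bound; simp add: field_simps)
  also have "\<dots> = (\<Sum>h=1..d. scalar_level \<beta> h)" using L by (simp add: s_def)
  finally show ?thesis .
qed

section \<open>The lower bound for the level and its non-attainment\<close>

lemma nehari_scalar_bound:
  assumes sym: "\<forall>i\<in>{1..d}. \<forall>j\<in>{1..d}. \<beta> i j = \<beta> j i"
    and diag: "\<forall>i\<in>{1..d}. \<beta> i i > 0"
    and off: "\<forall>i\<in>{1..d}. \<forall>j\<in>{1..d}. i \<noteq> j \<longrightarrow> \<beta> i j \<le> 0"
    and u: "u \<in> nehari d \<beta>" and i: "i \<in> {1..d}"
  shows "dirichlet (u i) \<le> \<beta> i i * quartic (u i)"
    and "(dirichlet (u i))\<^sup>2 / (\<beta> i i * quartic (u i)) \<le> dirichlet (u i)"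
    and "dirichlet (u i) = \<beta> i i * quartic (u i) + (\<Sum>j\<in>{1..d} - {i}. \<beta> i j * interaction (u i) (u j))"
proof -
  have ui: "u i \<in> D12" "nonzero (u i)" and N: "dirichlet (u i) = (\<Sum>j=1..d. \<beta> i j * interaction (u i) (u j))"
    using u i unfolding nehari_iff[OF sym] by auto
  show eq: "dirichlet (u i) = \<beta> i i * quartic (u i) + (\<Sum>j\<in>{1..d} - {i}. \<beta> i j * interaction (u i) (u j))"
    unfolding N using sum.remove[OF _ i, of "\<lambda>j. \<beta> i j * interaction (u i) (u j)"] by (simp add: interaction_self)
  have "(\<Sum>j\<in>{1..d} - {i}. \<beta> i j * interaction (u i) (u j)) \<le> 0"
    using off i by (intro sum_nonpos mult_nonpos_nonneg interaction_nonneg) auto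
  then show le: "dirichlet (u i) \<le> \<beta> i i * quartic (u i)" using eq by simp
  have A: "dirichlet (u i) > 0" by (rule dirichlet_pos[OF ui])
  then have "dirichlet (u i) * dirichlet (u i) \<le> dirichlet (u i) * (\<beta> i i * quartic (u i))"
    using le by (intro mult_left_mono) auto
  then show "(dirichlet (u i))\<^sup>2 / (\<beta> i i * quartic (u i)) \<le> dirichlet (u i)"
    using A le by (subst pos_divide_le_eq) (auto simp: power2_eq_square)
qed

lemma scalar_level_le_component:
  assumes sym: "\<forall>i\<in>{1..d}. \<forall>j\<in>{1..d}. \<beta> i j = \<beta> j i"
    and diag: "\<forall>i\<in>{1..d}. \<beta> i i > 0"
    and off: "\<forall>i\<in>{1..d}. \<forall>j\<in>{1..d}. i \<noteq> j \<longrightarrow> \<beta> i j \<le> 0"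
    and u: "u \<in> nehari d \<beta>" and i: "i \<in> {1..d}"
  shows "scalar_level \<beta> i \<le> ereal (1/4 * dirichlet (u i))"
proof -
  have "scalar_level \<beta> i \<le> ereal (1/4 * ((dirichlet (u i))\<^sup>2 / (\<beta> i i * quartic (u i))))"
    using u i diag unfolding nehari_iff[OF sym] by (intro scalar_level_le) auto
  also have "\<dots> \<le> ereal (1/4 * dirichlet (u i))"
    using nehari_scalar_bound(2)[OF assms] by simp
  finally show ?thesis .
qed

lemma sum_scalar_levels_le_level:
  assumes sym: "\<forall>i\<in>{1..d}. \<forall>j\<in>{1..d}. \<beta> i j = \<beta> j i"
    and diag: "\<forall>i\<in>{1..d}. \<beta> i i > 0"
    and off: "\<forall>i\<in>{1..d}. \<forall>j\<in>{1..d}. i \<noteq> j \<longrightarrow> \<beta> i j \<le> 0"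
  shows "(\<Sum>h=1..d. scalar_level \<beta> h) \<le> level d \<beta>"
  unfolding level_def
proof (rule INF_greatest)
  fix u assume u: "u \<in> nehari d \<beta>"
  have "(\<Sum>h=1..d. scalar_level \<beta> h) \<le> (\<Sum>h=1..d. ereal (1/4 * dirichlet (u h)))"
    by (intro sum_mono scalar_level_le_component[OF sym diag off u])
  also have "\<dots> = ereal (energy d \<beta> u)" unfolding energy_nehari[OF sym u] by (rule sum_ereal)
  finally show "(\<Sum>h=1..d. scalar_level \<beta> h) \<le> ereal (energy d \<beta> u)" .
qed

text \<open>Zero interaction means that v vanishes a.e. where u does not. As v is nonzero, the zeros
  of |u| are then not negligible, which \<open>superharmonic_zero\<close> excludes for the
  superharmonic function |u|.\<close>

lemma interaction_minimizer_pos: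
  assumes u: "u \<in> D12" "nonzero u" and v: "v \<in> D12" "nonzero v"
    and min: "\<And>w. w \<in> D12 \<Longrightarrow> nonzero w \<Longrightarrow> (dirichlet u)\<^sup>2 / quartic u \<le> (dirichlet w)\<^sup>2 / quartic w"
  shows "0 < interaction u v"
proof (rule ccontr)
  assume "\<not> ?thesis"
  then have "interaction u v = 0" using interaction_nonneg[of u v] by simp
  then have "AE x in lborel. (u x)\<^sup>2 * (v x)\<^sup>2 = 0"
    using integral_nonneg_eq_0_iff_AE[OF interaction_integrable[OF u(1) v(1)]] by (simp add: interaction_def)
  then have uv: "AE x in lborel. \<bar>u x\<bar> \<noteq> 0 \<longrightarrow> v x = 0" by eventually_elim auto
  have "\<not> (AE x in lborel. \<bar>u x\<bar> \<noteq> 0)"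
  proof
    assume "AE x in lborel. \<bar>u x\<bar> \<noteq> 0"
    with uv have "AE x in lborel. v x = 0" by eventually_elim blast
    then show False using v(2) by (simp add: nonzero_def)
  qed
  from superharmonic_zero[OF minimizer_superharmonic[OF u min] _ this]
  have "AE x in lborel. \<bar>u x\<bar> = 0" by simp
  then show False using u(2) by (simp add: nonzero_def)
qed

text \<open>Attainment forces A(u_i)/4 to equal the scalar level, so that u_i minimises A^2/B and
  satisfies the scalar constraint. The Nehari equation of u_i then leaves a vanishing sum of
  nonpositive coupling terms, whose j-th term is strictly negative.\<close>

lemma level_not_attained:
  assumes sym: "\<forall>i\<in>{1..d}. \<forall>j\<in>{1..d}. \<beta> i j = \<beta> j i"
    and diag: "\<forall>i\<in>{1..d}. \<beta> i i > 0"
    and off: "\<forall>i\<in>{1..d}. \<forall>j\<in>{1..d}. i \<noteq> j \<longrightarrow> \<beta> i j \<le> 0"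
    and neg: "i \<in> {1..d}" "j \<in> {1..d}" "i \<noteq> j" "\<beta> i j < 0"
    and eq: "level d \<beta> = (\<Sum>h=1..d. scalar_level \<beta> h)"
    and u: "u \<in> nehari d \<beta>"
  shows "ereal (energy d \<beta> u) \<noteq> level d \<beta>"
proof
  assume E: "ereal (energy d \<beta> u) = level d \<beta>"
  note comp = scalar_level_le_component[OF sym diag off u]
  define L where "L = (\<lambda>h. real_of_ereal (scalar_level \<beta> h))"
  \<comment> \<open>The level is a real number because it lies between 0 and the quarter of the
    Dirichlet integral of the component of u.\<close>
  have L: "scalar_level \<beta> h = ereal (L h)" if "h \<in> {1..d}" for h
    using comp[OF that] scalar_level_nonneg[of \<beta> h]
    by (cases "scalar_level \<beta> h") (auto simp: L_def)
  have Lle: "L h \<le> 1/4 * dirichlet (u h)" if "h \<in> {1..d}" for h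
    using comp[OF that] L[OF that] by simp
  have "(\<Sum>h=1..d. L h) = (\<Sum>h=1..d. 1/4 * dirichlet (u h))"
    using E L unfolding eq energy_nehari[OF sym u] by simp
  \<comment> \<open>Equal sums with termwise inequality give equality of each term.\<close>
  then have Leq: "L i = 1/4 * dirichlet (u i)"
    by (rule sum_mono_inv[OF _ Lle neg(1)]) auto
  have D: "\<And>h. h \<in> {1..d} \<Longrightarrow> u h \<in> D12 \<and> nonzero (u h)" using u unfolding nehari_iff[OF sym] by blast
  have b: "\<beta> i i > 0" using diag neg by blast
  have q: "quartic (u i) > 0" using D[OF neg(1)] quartic_pos_iff by blast
  have A: "dirichlet (u i) > 0" using D[OF neg(1)] dirichlet_pos by blast
  have le: "1/4 * dirichlet (u i) \<le> 1/4 * ((dirichlet w)\<^sup>2 / (\<beta> i i * quartic w))" if "w \<in> D12" "nonzero w" for w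
    using scalar_level_le[of w \<beta> i] that b L[OF neg(1)] Leq by simp
  \<comment> \<open>Minimality tested with u_i itself gives A \<le> A^2 / (\<beta> B), the reverse
    of the inequality from the Nehari equation.\<close>
  have "dirichlet (u i) * (\<beta> i i * quartic (u i)) \<le> dirichlet (u i) * dirichlet (u i)"
    using le[of "u i"] D[OF neg(1)] b q by (simp add: pos_le_divide_eq power2_eq_square)
  then have "\<beta> i i * quartic (u i) \<le> dirichlet (u i)" using A by simp
  then have S: "dirichlet (u i) = \<beta> i i * quartic (u i)"
    using nehari_scalar_bound(1)[OF sym diag off u neg(1)] by simp
  have I: "0 < interaction (u i) (u j)"
  proof (rule interaction_minimizer_pos)
    fix w assume w: "w \<in> D12" "nonzero w"
    have qw: "quartic w > 0" using quartic_pos_iff w by blast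
    have "(dirichlet (u i))\<^sup>2 / quartic (u i) = \<beta> i i * dirichlet (u i)"
      using S q by (simp add: power2_eq_square)
    also have "\<dots> \<le> \<beta> i i * ((dirichlet w)\<^sup>2 / (\<beta> i i * quartic w))"
      using le[OF w] b by (intro mult_left_mono) auto
    also have "\<dots> = (dirichlet w)\<^sup>2 / quartic w" using b by simp
    finally show "(dirichlet (u i))\<^sup>2 / quartic (u i) \<le> (dirichlet w)\<^sup>2 / quartic w" .
  qed (use D neg in auto)
  have "(\<Sum>k\<in>{1..d} - {i}. \<beta> i k * interaction (u i) (u k)) < 0"
  proof -
    have "(\<Sum>k\<in>{1..d} - {i}. \<beta> i k * interaction (u i) (u k))
      = \<beta> i j * interaction (u i) (u j) + (\<Sum>k\<in>{1..d} - {i} - {j}. \<beta> i k * interaction (u i) (u k))"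
      using neg by (intro sum.remove) auto
    moreover have "(\<Sum>k\<in>{1..d} - {i} - {j}. \<beta> i k * interaction (u i) (u k)) \<le> 0"
      using off neg(1) by (intro sum_nonpos mult_nonpos_nonneg interaction_nonneg) auto
    moreover have "\<beta> i j * interaction (u i) (u j) < 0"
      using neg(4) I by (intro mult_neg_pos)
    ultimately show ?thesis by linarith
  qed
  then show False using nehari_scalar_bound(3)[OF sym diag off u neg(1)] S by simp
qed

theorem corollary1p15:
  fixes d :: nat and \<beta> :: "nat \<Rightarrow> nat \<Rightarrow> real"
  assumes "d \<ge> 2"
    and "\<forall>i\<in>{1..d}. \<forall>j\<in>{1..d}. \<beta> i j = \<beta> j i"
    and "\<forall>i\<in>{1..d}. \<beta> i i > 0"
    and "\<forall>i\<in>{1..d}. \<forall>j\<in>{1..d}. i \<noteq> j \<longrightarrow> \<beta> i j \<le> 0"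
    and "\<exists>i\<in>{1..d}. \<exists>j\<in>{1..d}. i \<noteq> j \<and> \<beta> i j < 0"
  shows "(\<not> (\<exists>u\<in>nehari d \<beta>. ereal (energy d \<beta> u) = level d \<beta>))
    \<and> level d \<beta> = (\<Sum>h=1..d. scalar_level \<beta> h)"
proof -
  have eq: "level d \<beta> = (\<Sum>h=1..d. scalar_level \<beta> h)"
    using level_le_sum_scalar_levels[OF assms(2,4)] sum_scalar_levels_le_level[OF assms(2,3,4)] by (rule antisym)
  obtain i j where "i \<in> {1..d}" "j \<in> {1..d}" "i \<noteq> j" "\<beta> i j < 0" using assms(5) by blast
  from level_not_attained[OF assms(2,3,4) this eq] eq show ?thesis by blast
qed


end
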